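(* For every $n\in\mathbb{N}$, $n\ge 1$, let $$D_n=\frac{1}{\sqrt{2}}\,\frac{\binom{2n}{n}^{\frac12+\frac1n}}{\binom{2n+2}{n}^{\frac12}}.$$ Then, for every $n\ge 1$ and every isotropic convex body $K\subseteq\mathbb{R}^n$, $$L_K\le D_n\,L_{K_{n+2}(g_K)}.$$ Furthermore, there is equality if and only if $K$ is a regular simplex. Moreover, $\sup_{n\in\mathbb{N}}D_n=\sqrt{2}$.
   Context: A convex body $K\subseteq\mathbb{R}^n$ is a compact convex set with non-empty interior; $|K|$ denotes its Lebesgue measure. $K$ is isotropic if $|K|=1$, its barycenter is at the origin, and there is $L_K>0$ (the isotropic constant of $K$) such that $\int_K\langle x,\theta\rangle^2dx=L_K^2$ for every $\theta\in S^{n-1}$ (the Euclidean unit sphere). For every convex body $K$ there is an affine map $x\mapsto a+Tx$ with $a\in\mathbb{R}^n$, $T\in GL(n)$, unique up to orthogonal maps, such that $a+TK$ is isotropic; the isotropic constant $L_K$ of an arbitrary convex body $K$ is defined as the isotropic constant of any such isotropic image. The covariogram function of a convex body $K\subseteq\mathbb{R}^n$ is $g_K(x)=|K\cap(x+K)|$, $x\in\mathbb{R}^n$. It is log-concave (its logarithm is concave, as a function with values in $[-\infty,\infty)$) and $g_K(0)=|K|>0$. For a log-concave function $g:\mathbb{R}^n\to[0,\infty)$ with $g(0)>0$ and $p>0$, the Ball body $K_p(g)$ is $$K_p(g)=\left\{x\in\mathbb{R}^n:\int_0^\infty pt^{p-1}g(tx)\,dt\ge g(0)\right\}.$$ The set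 $K_{n+2}(g_K)$ is a (centrally symmetric) convex body, so $L_{K_{n+2}(g_K)}$ is defined. *)

theory Defs
  imports "HOL-Analysis.Analysis"
begin

definition convex_body :: "'a::euclidean_space set \<Rightarrow> bool" where
  "convex_body K \<longleftrightarrow> compact K \<and> convex K \<and> interior K \<noteq> {}"

definition barycenter :: "'a::euclidean_space set \<Rightarrow> 'a" where
  "barycenter K = (1 / measure lebesgue K) *\<^sub>R (LINT x:K|lebesgue. x)"

definition isotropic_with :: "'a::euclidean_space set \<Rightarrow> real \<Rightarrow> bool" where
  "isotropic_with K L \<longleftrightarrow>
     convex_body K \<and> measure lebesgue K = 1 \<and> barycenter K = 0 \<and> L > 0 \<and>
     (\<forall>\<theta>\<in>sphere 0 1. (LINT x:K|lebesgue. (x \<bullet> \<theta>)\<^sup>2) = L\<^sup>2)"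

definition isotropic :: "'a::euclidean_space set \<Rightarrow> bool" where
  "isotropic K \<longleftrightarrow> (\<exists>L. isotropic_with K L)"

text \<open>The constant of any isotropic affine image. Such an image exists and is unique up to
  orthogonal maps for every convex body, so the description is well defined there; for isotropic
  \<open>K\<close> one may take the identity map.\<close>

definition isotropic_const :: "'a::euclidean_space set \<Rightarrow> real" where
  "isotropic_const K =
     (THE L. \<exists>a (T :: 'a \<Rightarrow> 'a). linear T \<and> bij T \<and> isotropic_with ((\<lambda>x. a + T x) ` K) L)"

definition covariogram :: "'a::euclidean_space set \<Rightarrow> 'a \<Rightarrow> real" where
  "covariogram K x = measure lebesgue (K \<inter> (+) x ` K)"

text \<open>The integral takes values in \<open>[0, \<infinity>]\<close>: at \<open>x = 0\<close> it is infinite, so \<open>0\<close> belongs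
  to the body, whereas a real-valued integral would default to \<open>0\<close> there.\<close>

definition ball_body :: "real \<Rightarrow> ('a::euclidean_space \<Rightarrow> real) \<Rightarrow> 'a set" where
  "ball_body p g =
     {x. (\<integral>\<^sup>+t\<in>{0..}. ennreal (p * t powr (p - 1) * g (t *\<^sub>R x)) \<partial>lebesgue) \<ge> ennreal (g 0)}"

definition regular_simplex :: "'a::euclidean_space set \<Rightarrow> bool" where
  "regular_simplex K \<longleftrightarrow>
     (\<exists>V d. \<not> affine_dependent V \<and> card V = DIM('a) + 1 \<and> K = convex hull V \<and>
        (\<forall>v\<in>V. \<forall>w\<in>V. v \<noteq> w \<longrightarrow> dist v w = d))"

definition D_const :: "nat \<Rightarrow> real" where
  "D_const n = 1 / sqrt 2 *
     (real ((2 * n) choose n) powr (1 / 2 + 1 / real n) /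
      real ((2 * n + 2) choose n) powr (1 / 2))"

end

(* Put g = covariogram K, M = K_(n+2)(g) and let K be isotropic, so |K| = 1.  By Fubini the integral of g
   is 1 and its second moments are 2 L_K^2 in every direction; integrating along rays, M has the same
   second moments as g.  Hence M is isotropic up to scaling, L_M = sqrt 2 L_K / |M|^(1/2 + 1/n), and the
   inequality is an upper bound for |M|.  By Brunn-Minkowski, g^(1/n) is concave on its support;
   Berwald's inequality on each ray compares the moments of order n + 2 (volume of M) and n (integral
   of g), with equality only for t |-> max 0 (1 - t/a).

   If g has this form on all rays, the inclusion of (1 - l) K + l q in the intersection of K and
   l x + K, for q in K and x + K, is an equality of volumes, so K meets its translates in homothets of
   itself.  The cone over K is then a lattice, which forces the extreme points of K to be affinely
   independent: K is a simplex.  In an isotropic simplex the affine map swapping two vertices is an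
   isometry, so the simplex is regular.  Conversely, intersections of a simplex with its translates
   are explicit homothets. *)
theory Submission
  imports Defs "HOL-Real_Asymp.Real_Asymp"
begin


section \<open>The constants $D_n$\<close>

text \<open>The binomials in D_n are reciprocals of moments of the extremal profile: n B(n, n+1) = 1
  / binom(2n, n) and (n+2) B(n+2, n+1) = 1 / binom(2n+2, n). With C and E these two binomials, the
  volume bound reads E^(n/(n+2)) |M| \<le> C, and the power 1/2 + 1/n = (n+2)/(2n) turns the left
  constant into E^(1/2). The bound needs only one-dimensional information on rays, but the isotropic
  constant of M is evaluated for convex bodies, so M must be shown convex. This is the subadditivity
  of its gauge; it rests on the level sets of t^(n+3) h(tx)^n, with h = g^(1/n), measured in the
  variable 1/t. Equality of volumes gives the affine profile only on almost every ray; the set of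
  such directions is closed, which recovers all of them. To recognise the simplex, no suprema of
  general elements of the cone are needed: equal multiples of two extreme rays suffice, and a
  relation among extreme points is then reduced one point at a time. The value sqrt 2 comes from
  D_n^2 = C^(2/n) (n+2) / (4 (2n+1)), which tends to 16/8.\<close>

lemma choose_ratio:
  fixes n :: nat assumes "n \<ge> 1"
  shows "real ((2*n) choose n) / real ((2*n+2) choose n) = (real n + 2) / (2 * (2 * real n + 1))"
proof -
  have f1: "fact (2*n+2) = real (2*n+2) * real (2*n+1) * fact (2*n)"
    by (simp add: algebra_simps)
  have f2: "(fact (n+2) :: real) = real (n+2) * real (n+1) * fact n"
    by (simp add: algebra_simps)
  have "2*n+2-n = n+2" by simp
  then have c2: "real ((2*n+2) choose n) = fact (2*n+2) / (fact n * fact (n+2))"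
    using binomial_fact[of n "2*n+2", where 'a=real] by (simp del: fact_Suc fact_2)
  have "2*n-n = n" by simp
  then have c1: "real ((2*n) choose n) = fact (2*n) / (fact n * fact n)"
    using binomial_fact[of n "2*n", where 'a=real] by simp
  have ratio: "(F / (f * f)) / ((real (2*n+2) * real (2*n+1) * F) / (f * (real (n+2) * real (n+1) * f)))
      = (real n + 2) / (2 * (2 * real n + 1))" if "F > 0" "f > 0" for F f :: real
  proof -
    have "real (2*n+2) = 2 * real (n+1)" by simp
    then show ?thesis using that by (simp add: divide_simps) (simp add: add_eq_0_iff algebra_simps)
  qed
  show ?thesis unfolding c1 c2 f1 f2 by (rule ratio) simp_all
qed

text \<open>The quotient of the two binomials is rational in n, so squaring leaves only a power of
  the central binomial; both the bound and the limit are read off from this form.\<close>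

lemma D_const_square:
  assumes "n \<ge> 1"
  shows "(D_const n)\<^sup>2 = real ((2*n) choose n) powr (2 / real n) * ((real n + 2) / (4 * (2 * real n + 1)))"
proof -
  define C where "C = real ((2*n) choose n)"
  define E where "E = real ((2*n+2) choose n)"
  have C: "C > 0" and E: "E > 0" by (auto simp: C_def E_def)
  have "(D_const n)\<^sup>2 = (1/2) * ((C powr (1/2 + 1/real n))\<^sup>2 / (E powr (1/2))\<^sup>2)"
    unfolding D_const_def C_def E_def by (simp add: power_mult_distrib power_divide)
  also have "(C powr (1/2 + 1/real n))\<^sup>2 = C * C powr (2/real n)"
  proof -
    have "(C powr (1/2 + 1/real n))\<^sup>2 = C powr (1/2 + 1/real n + (1/2 + 1/real n))"
      by (simp only: power2_eq_square powr_add[symmetric])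
    also have "(1/2 + 1/real n + (1/2 + 1/real n)) = 1 + 2/real n" by simp
    finally show ?thesis using C by (simp add: powr_add)
  qed
  also have "(E powr (1/2))\<^sup>2 = E"
    using E by (simp add: power2_eq_square powr_add[symmetric])
  also have "(1/2) * (C * C powr (2/real n) / E) = C powr (2/real n) * ((C / E) / 2)" by (simp add: mult.commute)
  also have "C / E = (real n + 2) / (2 * (2 * real n + 1))"
    unfolding C_def E_def by (rule choose_ratio[OF assms])
  finally show ?thesis by (simp add: C_def mult.commute)
qed

lemma D_const_nonneg: "D_const n \<ge> 0"
  unfolding D_const_def by simp

lemma central_choose_Suc:
  "real ((2*Suc n) choose Suc n) * (real n + 1) = 2 * (2 * real n + 1) * real ((2*n) choose n)"
proof -
  have c: "real ((2*m) choose m) = fact (2*m) / (fact m * fact m)" for m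
    using binomial_fact[of m "2*m", where 'a=real] by simp
  have f1: "fact (2*Suc n) = real (2*n+2) * real (2*n+1) * fact (2*n)"
    by (simp add: algebra_simps)
  have ratio: "(2 * N * m * F) / ((N * f) * (N * f)) * N = 2 * m * (F / (f * f))"
    if "f > 0" "N > 0" for F f m N :: real
    using that by (simp add: field_simps)
  have e: "real (2*n+2) = 2 * real (Suc n)" "real n + 1 = real (Suc n)" by simp_all
  have "real ((2*Suc n) choose Suc n) * (real n + 1)
      = (2 * real (Suc n) * real (2*n+1) * fact (2*n)) / ((real (Suc n) * fact n) * (real (Suc n) * fact n)) * real (Suc n)"
    unfolding c f1 fact_Suc e ..
  also have "\<dots> = 2 * real (2*n+1) * (fact (2*n) / (fact n * fact n))" by (rule ratio) auto
  finally show ?thesis unfolding c by (simp add: add.commute)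
qed

text \<open>Passing from n to n + 1 multiplies the central binomial by 2 (2n+1) / (n+1) < 4, so its
  square divided by 16^n decreases; 36/256 is the value at n = 2. The start at n = 2 matters: the
  value 1/4 at n = 1 would not absorb the factor exp (3/2) in \<open>D_const_le\<close>.\<close>

lemma central_choose_square_le:
  assumes "n \<ge> 2"
  shows "(real ((2*n) choose n))\<^sup>2 \<le> 36 / 256 * 16 ^ n"
  using assms
proof (induction n rule: nat_induct_at_least)
  case base
  have "(2*2) choose (2::nat) = (6::nat)" by (simp add: choose_two)
  then have e: "(real ((2*2) choose (2::nat)))\<^sup>2 = 36" by (simp only:) simp
  show ?case unfolding e by simp
next
  case (Suc n)
  define C where "C = real ((2*n) choose n)"
  define C' where "C' = real ((2*Suc n) choose Suc n)"
  have e: "C' * (real n + 1) = 2 * (2 * real n + 1) * C"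
    unfolding C_def C'_def by (rule central_choose_Suc)
  have "C' * (real n + 1) \<le> (4 * C) * (real n + 1)"
    unfolding e by (simp add: C_def algebra_simps)
  then have "C' \<le> 4 * C" by (rule mult_right_le_imp_le) simp
  then have "C'\<^sup>2 \<le> (4*C)\<^sup>2" by (intro power_mono) (auto simp: C'_def)
  also have "\<dots> = 16 * C\<^sup>2" by (simp add: power_mult_distrib)
  also have "\<dots> \<le> 36 / 256 * 16 ^ Suc n" using Suc.IH unfolding C_def by simp
  finally show ?case by (simp only: C'_def)
qed

text \<open>With r = (2n+4) / (2n+1) the square of \<open>D_const n\<close> is C^(2/n) r / 8, so the
  n-th power of the claim is C^2 r^n \<le> 16^n. Here r^n stays below exp (3/2), while the decay of
  the central binomial provides the factor 256/36.\<close>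

lemma D_const_le: "n \<ge> 1 \<Longrightarrow> D_const n \<le> sqrt 2"
proof -
  assume n: "n \<ge> 1"
  define C where "C = real ((2*n) choose n)"
  have C: "C > 0" by (auto simp: C_def)
  define r where "r = 1 + 3 / (2 * real n + 1)"
  have r: "r > 0" "r = (2 * real n + 4) / (2 * real n + 1)" by (auto simp: r_def add_pos_nonneg field_simps)
  have key: "C\<^sup>2 * r ^ n \<le> 16 ^ n"
  proof (cases "n = 1")
    case True then show ?thesis by (simp add: C_def r_def)
  next
    case False
    have "r \<le> exp (3 / (2 * real n + 1))" unfolding r_def by (rule exp_ge_add_one_self)
    then have "r ^ n \<le> exp (3 / (2 * real n + 1)) ^ n" using r by (intro power_mono) auto
    then have "r ^ n \<le> exp (real n * (3 / (2 * real n + 1)))" by (simp only: exp_of_nat_mult)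
    also have "\<dots> \<le> exp (3/2)" by (simp add: field_simps)
    also have "\<dots> \<le> 256 / 36"
    \<comment> \<open>Squaring replaces exp (3/2) by the cube of exp 1, for which exp 1 \<le> 3 is
      enough.\<close>
    proof (rule power2_le_imp_le)
      have "(exp (3/2 :: real))\<^sup>2 = exp (real 2 * (3/2))" by (simp only: exp_of_nat_mult)
      also have "\<dots> = exp (real 3 * 1)" by simp
      also have "\<dots> = exp 1 ^ 3" by (simp only: exp_of_nat_mult)
      also have "\<dots> \<le> 3 ^ 3" by (intro power_mono exp_le) simp
      also have "\<dots> \<le> (256/36)\<^sup>2" by (simp add: power2_eq_square)
      finally show "(exp (3/2 :: real))\<^sup>2 \<le> (256/36)\<^sup>2" .
    qed simp
    finally have "r ^ n \<le> 256 / 36" .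
    then have "C\<^sup>2 * r ^ n \<le> (36 / 256 * 16 ^ n) * (256 / 36)"
      using central_choose_square_le[of n] False n r by (intro mult_mono) (auto simp: C_def)
    then show ?thesis by simp
  qed
  have "(C powr (2/real n)) ^ n = (C powr (2/real n)) powr real n"
    by (rule powr_realpow[symmetric]) (use C in simp)
  also have "\<dots> = C\<^sup>2" using n C by (simp add: powr_powr)
  finally have "(C powr (2/real n) * r) ^ n = C\<^sup>2 * r ^ n" by (simp only: power_mult_distrib)
  then have "(C powr (2/real n) * r) ^ n \<le> 16 ^ n" using key by simp
  then have *: "C powr (2/real n) * r \<le> 16" using n C r power_mono_iff[of "C powr (2/real n) * r" 16 n] by simp
  have "(D_const n)\<^sup>2 = C powr (2/real n) * r / 8"
    unfolding D_const_square[OF n] C_def r(2) by (simp add: field_simps)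
  also have "\<dots> \<le> 2" using * by simp
  finally show ?thesis using D_const_nonneg real_le_rsqrt by blast
qed

text \<open>The squares are squeezed between 2 and the expression obtained from the lower bound 4^n
  / (2n) for the central binomial, whose 2/n-th power still tends to 16.\<close>

lemma D_const_tendsto: "D_const \<longlonglongrightarrow> sqrt 2"
proof -
  have sq: "(\<lambda>n. (D_const n)\<^sup>2) \<longlonglongrightarrow> 2"
  proof (rule tendsto_sandwich)
    show "\<forall>\<^sub>F n in sequentially. (4 ^ n / (2 * real n)) powr (2 / real n) * ((real n + 2) / (4 * (2 * real n + 1))) \<le> (D_const n)\<^sup>2"
      using eventually_ge_at_top[of 1]
    proof eventually_elim
      case (elim n)
      then show ?case unfolding D_const_square[OF elim]
        by (intro mult_right_mono powr_mono2) (auto simp: central_binomial_lower_bound)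
    qed
    show "\<forall>\<^sub>F n in sequentially. (D_const n)\<^sup>2 \<le> 2"
      using eventually_ge_at_top[of 1]
    proof eventually_elim
      case (elim n)
      then show ?case using power_mono[OF D_const_le[OF elim] D_const_nonneg, of 2] by simp
    qed
    show "(\<lambda>n. (4 ^ n / (2 * real n)) powr (2 / real n) * ((real n + 2) / (4 * (2 * real n + 1)))) \<longlonglongrightarrow> 2"
    proof -
      have "exp (ln 4 * 2) = (exp (ln (4::real)))\<^sup>2"
        using exp_double[of "ln 4 :: real"] by (simp only: mult.commute)
      then have "exp (ln 4 * 2) / 8 = (2::real)" by simp
      then show ?thesis by real_asymp
    qed
  qed simp
  have "(\<lambda>n. sqrt ((D_const n)\<^sup>2)) \<longlonglongrightarrow> sqrt 2" by (intro tendsto_real_sqrt sq)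
  then show ?thesis by (simp add: D_const_nonneg)
qed

lemma D_const_bdd_above: "bdd_above (D_const ` {1..})"
  by (rule bdd_aboveI[of _ "sqrt 2"]) (auto intro: D_const_le)

lemma D_const_SUP: "(SUP n\<in>{1..}. D_const n) = sqrt 2"
proof (rule antisym)
  show "(SUP n\<in>{1..}. D_const n) \<le> sqrt 2" by (rule cSUP_least) (auto intro: D_const_le)
  show "sqrt 2 \<le> (SUP n\<in>{1..}. D_const n)"
  proof (rule LIMSEQ_le_const2[OF D_const_tendsto])
    show "\<exists>N. \<forall>n\<ge>N. D_const n \<le> (SUP n\<in>{1..}. D_const n)"
      by (intro exI[of _ 1]) (auto intro!: cSUP_upper D_const_bdd_above[simplified])
  qed
qed


section \<open>The Brunn--Minkowski inequality\<close>

text \<open>Dominated convergence for indicators. Membership may oscillate on a negligible set,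
  which is a hyperplane in \<open>halfspace_measure_IVT\<close> and a translated boundary in
  \<open>covariogram_continuous\<close>.\<close>

lemma measure_tendsto_AE:
  fixes S :: "nat \<Rightarrow> 'a::euclidean_space set"
  assumes S: "\<And>k. S k \<in> sets lebesgue" and T: "T \<in> sets lebesgue"
    and C: "C \<in> lmeasurable" "\<And>k. S k \<subseteq> C"
    and N: "negligible N" "\<And>x. x \<notin> N \<Longrightarrow> \<forall>\<^sub>F k in sequentially. x \<in> S k \<longleftrightarrow> x \<in> T"
  shows "(\<lambda>k. measure lebesgue (S k)) \<longlonglongrightarrow> measure lebesgue T"
proof -
  have "(\<lambda>k. LINT x|lebesgue. indicat_real (S k) x) \<longlonglongrightarrow> (LINT x|lebesgue. indicat_real T x)"
  proof (rule integral_dominated_convergence[where w="indicat_real C"])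
    show "integrable lebesgue (indicat_real C)" using C by (auto simp: integrable_indicator_iff fmeasurable_def)
    show "AE x in lebesgue. (\<lambda>k. indicat_real (S k) x) \<longlonglongrightarrow> indicat_real T x"
    proof (rule AE_I'[where N=N])
      show "N \<in> null_sets lebesgue" using N by (simp add: negligible_iff_null_sets)
      have "(\<lambda>k. indicat_real (S k) x) \<longlonglongrightarrow> indicat_real T x" if "x \<notin> N" for x
        by (rule tendsto_eventually, rule eventually_mono[OF N(2)[OF that]]) (auto simp: indicator_def)
      then show "{x \<in> space lebesgue. \<not> (\<lambda>k. indicat_real (S k) x) \<longlonglongrightarrow> indicat_real T x} \<subseteq> N" by blast
    qed
    show "AE x in lebesgue. norm (indicat_real (S k) x) \<le> indicat_real C x" for k
      using C(2)[of k] by (auto simp: indicator_def)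
  qed (use S T in auto)
  then show ?thesis by simp
qed

section \<open>Finite unions of disjoint open boxes and their sections by half-spaces\<close>

definition disjoint_boxes :: "'a::euclidean_space set set \<Rightarrow> bool" where
  "disjoint_boxes \<D> \<longleftrightarrow> finite \<D> \<and> disjoint \<D> \<and> (\<forall>Q\<in>\<D>. Q \<noteq> {} \<and> (\<exists>a b. Q = box a b))"

lemma disjoint_boxes_open: "disjoint_boxes \<D> \<Longrightarrow> open (\<Union>\<D>)"
  unfolding disjoint_boxes_def by (metis open_Union open_box)

lemma disjoint_boxes_bounded: "disjoint_boxes \<D> \<Longrightarrow> bounded (\<Union>\<D>)"
  unfolding disjoint_boxes_def by (metis bounded_Union bounded_box)

lemma disjoint_boxes_lmeasurable: "disjoint_boxes \<D> \<Longrightarrow> \<Union>\<D> \<in> lmeasurable"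
  by (simp add: disjoint_boxes_bounded disjoint_boxes_open lmeasurable_open)

lemma lmeasurable_open_pos:
  assumes "S \<in> lmeasurable" "open S" "S \<noteq> {}" shows "measure lebesgue S > 0"
proof -
  have "\<not> negligible S" using assms open_not_negligible by blast
  then show ?thesis using assms by (metis measure_nonneg negligible_iff_measure order_less_le)
qed

lemma box_Int_less:
  assumes i: "i \<in> Basis"
  shows "\<exists>b'. box a b \<inter> {x. x \<bullet> i < c} = box a b'"
proof
  show "box a b \<inter> {x. x \<bullet> i < c} = box a (\<Sum>j\<in>Basis. (if j = i then min (b \<bullet> j) c else b \<bullet> j) *\<^sub>R j)"
    using i by (auto simp: mem_box inner_sum_left_Basis split: if_splits)
qed

lemma box_Int_greater:
  assumes i: "i \<in> Basis"
  shows "\<exists>a'. box a b \<inter> {x. c < x \<bullet> i} = box a' b"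
proof
  show "box a b \<inter> {x. c < x \<bullet> i} = box (\<Sum>j\<in>Basis. (if j = i then max (a \<bullet> j) c else a \<bullet> j) *\<^sub>R j) b"
    using i by (auto simp: mem_box inner_sum_left_Basis split: if_splits)
qed

text \<open>Empty pieces are discarded, so the number of boxes drops strictly whenever one of them
  misses H; this drives the induction.\<close>

definition restrict_boxes :: "'a set \<Rightarrow> 'a set set \<Rightarrow> 'a::euclidean_space set set" where
  "restrict_boxes H \<D> = (\<lambda>Q. Q \<inter> H) ` \<D> - {{}}"

lemma Union_restrict_boxes: "\<Union>(restrict_boxes H \<D>) = \<Union>\<D> \<inter> H"
  by (auto simp: restrict_boxes_def)

lemma disjoint_restrict_boxes:
  assumes "disjoint_boxes \<D>" "\<And>a b. \<exists>a' b'. box a b \<inter> H = box a' b'"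
  shows "disjoint_boxes (restrict_boxes H \<D>)"
proof -
  have "disjoint (restrict_boxes H \<D>)"
    using assms(1) unfolding disjoint_boxes_def restrict_boxes_def disjoint_def by blast
  moreover have "finite (restrict_boxes H \<D>)"
    using assms(1) by (simp add: disjoint_boxes_def restrict_boxes_def)
  moreover have "\<exists>a b. Q = box a b" if "Q \<in> restrict_boxes H \<D>" for Q
    using that assms unfolding disjoint_boxes_def restrict_boxes_def by (metis (no_types, lifting) DiffD1 imageE)
  ultimately show ?thesis by (auto simp: disjoint_boxes_def) (auto simp: restrict_boxes_def)
qed

lemma card_restrict_boxes_le: "finite \<D> \<Longrightarrow> card (restrict_boxes H \<D>) \<le> card \<D>"
  unfolding restrict_boxes_def
  by (meson Diff_subset card_image_le card_mono dual_order.trans finite_imageI)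

lemma card_restrict_boxes_less:
  assumes "finite \<D>" "Q \<in> \<D>" "Q \<inter> H = {}"
  shows "card (restrict_boxes H \<D>) < card \<D>"
proof -
  have "restrict_boxes H \<D> \<subseteq> (\<lambda>Q. Q \<inter> H) ` (\<D> - {Q})" using assms by (auto simp: restrict_boxes_def)
  then have "card (restrict_boxes H \<D>) \<le> card (\<D> - {Q})"
    by (meson assms(1) card_image_le card_mono dual_order.trans finite_Diff finite_imageI)
  also have "\<dots> < card \<D>" using assms by (meson card_Diff1_less)
  finally show ?thesis .
qed

text \<open>Both half-spaces are open so that boxes are cut into open boxes; the hyperplane lost in
  between is negligible.\<close>

lemma measure_halfspaces:
  fixes A :: "'a::euclidean_space set"
  assumes A: "A \<in> lmeasurable" and i: "i \<in> Basis"
  shows "measure lebesgue A = measure lebesgue (A \<inter> {x. x \<bullet> i < c}) + measure lebesgue (A \<inter> {x. c < x \<bullet> i})"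
proof -
  have o: "open {x::'a. x \<bullet> i < c}" "open {x::'a. c < x \<bullet> i}"
    by (auto intro!: open_Collect_less continuous_intros)
  have m: "A \<inter> {x. x \<bullet> i < c} \<in> lmeasurable" "A \<inter> {x. c < x \<bullet> i} \<in> lmeasurable"
    using A o by (auto intro!: fmeasurable.Int fmeasurable_Int_fmeasurable)
  have "measure lebesgue (A \<inter> {x. x \<bullet> i < c}) + measure lebesgue (A \<inter> {x. c < x \<bullet> i})
     = measure lebesgue ((A \<inter> {x. x \<bullet> i < c}) \<union> (A \<inter> {x. c < x \<bullet> i}))"
  proof -
    have "A \<inter> {x. x \<bullet> i < c} \<inter> (A \<inter> {x. c < x \<bullet> i}) = {}" by auto
    then show ?thesis using measure_Un3[OF m] by simp
  qed
  also have "\<dots> = measure lebesgue A"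
  proof (rule measure_negligible_symdiff[symmetric])
    show "(A \<inter> {x. x \<bullet> i < c}) \<union> (A \<inter> {x. c < x \<bullet> i}) \<in> lmeasurable" using m by blast
    show "negligible (sym_diff (A \<inter> {x. x \<bullet> i < c} \<union> A \<inter> {x. c < x \<bullet> i}) A)"
      by (rule negligible_subset[OF negligible_standard_hyperplane[OF i, of c]]) auto
  qed
  finally show ?thesis by simp
qed

text \<open>As the levels converge to d, membership in the half-space is eventually constant off the
  hyperplane at height d, so the measure depends continuously on d and the intermediate value
  theorem applies.\<close>

lemma halfspace_measure_IVT:
  fixes B :: "'a::euclidean_space set"
  assumes B: "bounded B" "B \<in> lmeasurable" and i: "i \<in> Basis" and t: "0 \<le> t" "t \<le> measure lebesgue B"
  obtains d where "measure lebesgue (B \<inter> {x. x \<bullet> i < d}) = t"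
proof -
  define f where "f d = measure lebesgue (B \<inter> {x. x \<bullet> i < d})" for d
  obtain M where M: "M > 0" "\<And>x. x \<in> B \<Longrightarrow> norm x \<le> M" using B bounded_pos by metis
  have b: "\<bar>x \<bullet> i\<bar> \<le> M" if "x \<in> B" for x using M(2)[OF that] Basis_le_norm[OF i, of x] by simp
  have cont: "continuous_on UNIV f"
  proof (rule continuous_on_sequentiallyI)
    fix u :: "nat \<Rightarrow> real" and d assume u: "u \<longlonglongrightarrow> d"
    have o: "open {x::'a. x \<bullet> i < c}" for c by (auto intro!: open_Collect_less continuous_intros)
    have m: "B \<inter> {x. x \<bullet> i < c} \<in> sets lebesgue" for c using B o by auto
    show "(\<lambda>n. f (u n)) \<longlonglongrightarrow> f d" unfolding f_def
    proof (rule measure_tendsto_AE[where C=B and N="{x. x \<bullet> i = d}"])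
      fix x assume "x \<notin> {x. x \<bullet> i = d}"
      then consider "x \<bullet> i < d" | "d < x \<bullet> i" by fastforce
      then show "\<forall>\<^sub>F k in sequentially. (x \<in> B \<inter> {x. x \<bullet> i < u k}) = (x \<in> B \<inter> {x. x \<bullet> i < d})"
      proof cases
        case 1 then show ?thesis by (auto intro!: eventually_mono[OF order_tendstoD(1)[OF u 1]])
      next
        case 2 then show ?thesis by (auto intro!: eventually_mono[OF order_tendstoD(2)[OF u 2]])
      qed
    qed (use m B i in auto)
  qed
  have "B \<inter> {x. x \<bullet> i < - M} = {}" using b by fastforce
  then have f0: "f (- M) = 0" by (simp add: f_def)
  \<comment> \<open>The half-space is open and the bound M may be attained on B, hence M +
    1.\<close>
  have "B \<inter> {x. x \<bullet> i < M + 1} = B" using b by fastforce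
  then have f1: "f (M + 1) = measure lebesgue B" by (simp add: f_def)
  have "\<exists>d\<ge>-M. d \<le> M + 1 \<and> f d = t"
    by (rule IVT') (use f0 f1 t M cont in \<open>auto intro: continuous_on_subset\<close>)
  then show ?thesis using that unfolding f_def by blast
qed

section \<open>The Brunn-Minkowski inequality for two boxes\<close>

lemma root_DIM_power: "x \<ge> 0 \<Longrightarrow> root DIM('a::euclidean_space) x ^ DIM('a) = x"
  by (rule real_root_pow_pos2) auto

text \<open>In each coordinate the point sits at some relative position \<open>\<theta>\<close> in
  the sum interval; taking the same relative position in both summands splits it.\<close>

lemma box_add_subset:
  fixes a b c d :: "'a::euclidean_space"
  assumes ab: "\<And>i. i \<in> Basis \<Longrightarrow> a \<bullet> i < b \<bullet> i" and cd: "\<And>i. i \<in> Basis \<Longrightarrow> c \<bullet> i < d \<bullet> i"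
  shows "box (a + c) (b + d) \<subseteq> box a b + box c d"
proof
  fix x assume x: "x \<in> box (a + c) (b + d)"
  define \<theta> where "\<theta> i = (x \<bullet> i - a \<bullet> i - c \<bullet> i) / ((b \<bullet> i - a \<bullet> i) + (d \<bullet> i - c \<bullet> i))" for i
  define y where "y = (\<Sum>i\<in>Basis. (a \<bullet> i + \<theta> i * (b \<bullet> i - a \<bullet> i)) *\<^sub>R i)"
  define z where "z = (\<Sum>i\<in>Basis. (c \<bullet> i + \<theta> i * (d \<bullet> i - c \<bullet> i)) *\<^sub>R i)"
  have \<theta>: "0 < \<theta> i" "\<theta> i < 1" "\<theta> i * ((b \<bullet> i - a \<bullet> i) + (d \<bullet> i - c \<bullet> i)) = x \<bullet> i - a \<bullet> i - c \<bullet> i" if "i \<in> Basis" for i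
    using ab[OF that] cd[OF that] x that by (auto simp: \<theta>_def mem_box inner_add_left field_simps)
  have in1: "p < p + \<theta> i * (q - p) \<and> p + \<theta> i * (q - p) < q" if "i \<in> Basis" "p < q" for i p q
  proof -
    have "0 < \<theta> i * (q - p)" using \<theta>(1)[OF that(1)] that(2) by simp
    moreover have "\<theta> i * (q - p) < 1 * (q - p)" using \<theta>(2)[OF that(1)] that(2) by (intro mult_strict_right_mono) auto
    ultimately show ?thesis by simp
  qed
  have "y \<in> box a b" using ab in1 by (auto simp: y_def mem_box inner_sum_left_Basis)
  moreover have "z \<in> box c d" using cd in1 by (auto simp: z_def mem_box inner_sum_left_Basis)
  moreover have "x = y + z"
  proof (rule euclidean_eqI)
    fix i :: 'a assume i: "i \<in> Basis"
    have "y \<bullet> i = a \<bullet> i + \<theta> i * (b \<bullet> i - a \<bullet> i)" "z \<bullet> i = c \<bullet> i + \<theta> i * (d \<bullet> i - c \<bullet> i)"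
      using i by (simp_all add: y_def z_def inner_sum_left_Basis)
    then show "x \<bullet> i = (y + z) \<bullet> i" using \<theta>(3)[OF i]
      by (simp add: inner_add_left algebra_simps)
  qed
  ultimately show "x \<in> box a b + box c d" by (auto intro: set_plus_intro)
qed

lemma lmeasurable_open_add:
  fixes A B :: "'a::euclidean_space set"
  assumes "open A" "bounded A" "bounded B" shows "open (A + B)" "A + B \<in> lmeasurable"
proof -
  have eq: "A + B = (\<Union>x\<in>A. \<Union>y\<in>B. {x + y})" by (auto simp: set_plus_def)
  show o: "open (A + B)" unfolding eq using assms open_sums by blast
  have "bounded (A + B)" unfolding eq using bounded_sums[of A B] assms by blast
  then show "A + B \<in> lmeasurable" using o lmeasurable_open by blast
qed

lemma measure_box_prod:
  fixes a b :: "'a::euclidean_space"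
  assumes "\<And>i. i \<in> Basis \<Longrightarrow> a \<bullet> i < b \<bullet> i"
  shows "measure lebesgue (box a b) = (\<Prod>i\<in>Basis. b \<bullet> i - a \<bullet> i)"
proof -
  have "measure lebesgue (box a b) = measure lborel (box a b)" by simp
  also have "\<dots> = (\<Prod>i\<in>Basis. b \<bullet> i - a \<bullet> i)"
    using assms by (subst measure_lborel_box) (auto simp: inner_diff_left less_imp_le)
  finally show ?thesis .
qed

text \<open>After division by the right-hand side, the arithmetic-geometric mean inequality applies
  to the ratios u / (u + v) and v / (u + v) separately, and the two arithmetic means add up to
  1.\<close>

lemma root_prod_add_ge:
  fixes u v :: "'b \<Rightarrow> real"
  assumes I: "finite I" "I \<noteq> {}" and u: "\<And>i. i \<in> I \<Longrightarrow> u i > 0" and v: "\<And>i. i \<in> I \<Longrightarrow> v i > 0"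
  shows "root (card I) (\<Prod>i\<in>I. u i) + root (card I) (\<Prod>i\<in>I. v i) \<le> root (card I) (\<Prod>i\<in>I. u i + v i)"
proof -
  let ?r = "root (card I)"
  have n: "card I > 0" using I by (simp add: card_gt_0_iff)
  have uv: "u i + v i > 0" if "i \<in> I" for i using u[OF that] v[OF that] by simp
  have P: "(\<Prod>i\<in>I. u i + v i) > 0" using uv by (simp add: prod_pos)
  have amgm: "?r (\<Prod>i\<in>I. w i) \<le> (\<Sum>i\<in>I. w i) / card I" if w: "\<And>i. i \<in> I \<Longrightarrow> w i > 0" for w
  proof -
    have "?r (\<Prod>i\<in>I. w i) = (\<Prod>i\<in>I. w i) powr (1 / card I)"
      by (intro root_powr_inverse prod_nonneg less_imp_le w n)
    also have "\<dots> \<le> (\<Sum>i\<in>I. w i / card I)" using w I by (intro arith_geom_mean) (auto simp: less_imp_le)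
    finally show ?thesis by (simp add: sum_divide_distrib)
  qed
  have "?r (\<Prod>i\<in>I. u i / (u i + v i)) \<le> (\<Sum>i\<in>I. u i / (u i + v i)) / card I"
    using u uv by (intro amgm) auto
  moreover have "?r (\<Prod>i\<in>I. v i / (u i + v i)) \<le> (\<Sum>i\<in>I. v i / (u i + v i)) / card I"
    using v uv by (intro amgm) auto
  moreover have "(\<Sum>i\<in>I. u i / (u i + v i)) / card I + (\<Sum>i\<in>I. v i / (u i + v i)) / card I = 1"
  proof -
    have "(\<Sum>i\<in>I. u i / (u i + v i)) + (\<Sum>i\<in>I. v i / (u i + v i)) = (\<Sum>i\<in>I. 1)"
      unfolding sum.distrib[symmetric] by (rule sum.cong) (use uv in \<open>auto simp: add_divide_distrib[symmetric]\<close>, metis less_irrefl uv)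
    then show ?thesis using n by (simp add: add_divide_distrib[symmetric])
  qed
  ultimately have "?r ((\<Prod>i\<in>I. u i) / (\<Prod>i\<in>I. u i + v i)) + ?r ((\<Prod>i\<in>I. v i) / (\<Prod>i\<in>I. u i + v i)) \<le> 1"
    by (simp add: prod_dividef)
  then have "(?r (\<Prod>i\<in>I. u i) + ?r (\<Prod>i\<in>I. v i)) / ?r (\<Prod>i\<in>I. u i + v i) \<le> 1"
    by (simp add: real_root_divide add_divide_distrib)
  then show ?thesis using P n by (simp add: divide_le_eq_1_pos real_root_gt_zero)
qed

lemma Brunn_Minkowski_box:
  fixes a b c d :: "'a::euclidean_space"
  assumes ab: "box a b \<noteq> {}" and cd: "box c d \<noteq> {}"
  shows "root DIM('a) (measure lebesgue (box a b)) + root DIM('a) (measure lebesgue (box c d))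
     \<le> root DIM('a) (measure lebesgue (box a b + box c d))"
proof -
  have lt: "a \<bullet> i < b \<bullet> i" "c \<bullet> i < d \<bullet> i" if "i \<in> Basis" for i
    using ab cd that by (auto simp: box_ne_empty)
  have m: "measure lebesgue (box a b) = (\<Prod>i\<in>Basis. b \<bullet> i - a \<bullet> i)"
    "measure lebesgue (box c d) = (\<Prod>i\<in>Basis. d \<bullet> i - c \<bullet> i)"
    using lt by (auto intro: measure_box_prod simp del: measure_completion)
  have "root DIM('a) (measure lebesgue (box a b)) + root DIM('a) (measure lebesgue (box c d))
     \<le> root DIM('a) (\<Prod>i\<in>Basis. (b \<bullet> i - a \<bullet> i) + (d \<bullet> i - c \<bullet> i))"
    unfolding m by (rule root_prod_add_ge) (use lt in auto)
  also have "(\<Prod>i\<in>Basis. (b \<bullet> i - a \<bullet> i) + (d \<bullet> i - c \<bullet> i)) = measure lebesgue (box (a + c) (b + d))"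
    by (subst measure_box_prod) (use lt in \<open>auto simp: inner_add_left algebra_simps intro: add_strict_mono\<close>)
  also have "root DIM('a) \<dots> \<le> root DIM('a) (measure lebesgue (box a b + box c d))"
    by (intro real_root_le_mono measure_mono_fmeasurable box_add_subset lmeasurable_open_add)
      (use lt in auto)
  finally show ?thesis .
qed


text \<open>Nonempty disjoint boxes have disjoint projections to some coordinate axis, and an
  endpoint of one projection gives the height of a separating hyperplane.\<close>

lemma disjoint_boxes_separate:
  assumes D: "disjoint_boxes \<D>" and card: "card \<D> \<ge> 2"
  obtains i c Q1 Q2 where "i \<in> Basis" "Q1 \<in> \<D>" "Q2 \<in> \<D>"
    "Q1 \<subseteq> {x. x \<bullet> i < c}" "Q2 \<subseteq> {x. c < x \<bullet> i}"
proof -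
  obtain Q1 Q2 where Q: "Q1 \<in> \<D>" "Q2 \<in> \<D>" "Q1 \<noteq> Q2"
    using card card_le_Suc0_iff_eq[of \<D>] D unfolding disjoint_boxes_def by force
  then obtain a b c d where eq: "Q1 = box a b" "Q2 = box c d" using D unfolding disjoint_boxes_def by metis
  have ne: "box a b \<noteq> {}" "box c d \<noteq> {}" using Q eq D unfolding disjoint_boxes_def by auto
  have "box a b \<inter> box c d = {}" using Q eq D unfolding disjoint_boxes_def disjoint_def by auto
  then obtain i where i: "i \<in> Basis" "b \<bullet> i \<le> c \<bullet> i \<or> d \<bullet> i \<le> a \<bullet> i"
    using ne unfolding disjoint_interval box_ne_empty by force
  have sub: "box p q \<subseteq> {x. x \<bullet> i < q \<bullet> i}" "box p q \<subseteq> {x. p \<bullet> i < x \<bullet> i}" for p q :: 'a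
    using i(1) by (auto simp: mem_box)
  show ?thesis
  proof (cases "b \<bullet> i \<le> c \<bullet> i")
    case True
    then have "Q2 \<subseteq> {x. b \<bullet> i < x \<bullet> i}" using sub(2)[of c d] eq by force
    then show ?thesis using that[OF i(1) Q(1,2)] sub(1)[of a b] eq by blast
  next
    case False
    then have "Q1 \<subseteq> {x. d \<bullet> i < x \<bullet> i}" using sub(2)[of a b] eq i by force
    then show ?thesis using that[OF i(1) Q(2,1)] sub(1)[of c d] eq by blast
  qed
qed

text \<open>The Hadwiger--Ohmann step: cut the first union of boxes by a hyperplane that leaves a box on
  each side, and the second by a parallel hyperplane in the same volume ratio.\<close>

lemma Brunn_Minkowski_boxes_step:
  fixes \<A> \<B> :: "'a::euclidean_space set set"
  assumes A: "disjoint_boxes \<A>" "card \<A> \<ge> 2" and B: "disjoint_boxes \<B>" "\<B> \<noteq> {}"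
    and IH: "\<And>\<A>' \<B>' :: 'a set set. \<lbrakk>disjoint_boxes \<A>'; disjoint_boxes \<B>'; \<A>' \<noteq> {}; \<B>' \<noteq> {};
       card \<A>' < card \<A>; card \<B>' \<le> card \<B>\<rbrakk> \<Longrightarrow>
       root DIM('a) (measure lebesgue (\<Union>\<A>')) + root DIM('a) (measure lebesgue (\<Union>\<B>'))
         \<le> root DIM('a) (measure lebesgue (\<Union>\<A>' + \<Union>\<B>'))"
  shows "root DIM('a) (measure lebesgue (\<Union>\<A>)) + root DIM('a) (measure lebesgue (\<Union>\<B>))
     \<le> root DIM('a) (measure lebesgue (\<Union>\<A> + \<Union>\<B>))"
proof -
  let ?m = "measure lebesgue :: 'a set \<Rightarrow> real" and ?r = "root DIM('a)"
  obtain i c Q1 Q2 where i: "i \<in> Basis" and Q: "Q1 \<in> \<A>" "Q2 \<in> \<A>"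
    "Q1 \<subseteq> {x. x \<bullet> i < c}" "Q2 \<subseteq> {x. c < x \<bullet> i}"
    by (rule disjoint_boxes_separate[OF A])
  have fin: "finite \<A>" "finite \<B>" using A B by (auto simp: disjoint_boxes_def)
  have Qne: "Q1 \<noteq> {}" "Q2 \<noteq> {}" using Q A by (auto simp: disjoint_boxes_def)
  have BL: "\<And>a b. \<exists>a' b'. box a b \<inter> {x. x \<bullet> i < e} = box a' b'" for e using box_Int_less[OF i] by blast
  have BG: "\<And>a b. \<exists>a' b'. box a b \<inter> {x. e < x \<bullet> i} = box a' b'" for e using box_Int_greater[OF i] by blast
  define A1 where "A1 = restrict_boxes {x. x \<bullet> i < c} \<A>"
  define A2 where "A2 = restrict_boxes {x. c < x \<bullet> i} \<A>"
  have dA: "disjoint_boxes A1" "disjoint_boxes A2"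
    unfolding A1_def A2_def by (intro disjoint_restrict_boxes A BL BG)+
  have cA: "card A1 < card \<A>" "card A2 < card \<A>"
  proof -
    have "{x. x \<bullet> i < c} \<inter> {x. c < x \<bullet> i} = {}" by auto
    then have "Q2 \<inter> {x. x \<bullet> i < c} = {}" "Q1 \<inter> {x. c < x \<bullet> i} = {}" using Q(3,4) by blast+
    then show "card A1 < card \<A>" "card A2 < card \<A>"
      unfolding A1_def A2_def using card_restrict_boxes_less[OF fin(1)] Q(1,2) by blast+
  qed
  have neA: "A1 \<noteq> {}" "A2 \<noteq> {}" using Q Qne unfolding A1_def A2_def restrict_boxes_def by blast+
  have UA: "\<Union>A1 = \<Union>\<A> \<inter> {x. x \<bullet> i < c}" "\<Union>A2 = \<Union>\<A> \<inter> {x. c < x \<bullet> i}"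
    unfolding A1_def A2_def by (rule Union_restrict_boxes)+
  have pos: "?m (\<Union>D) > 0" if "disjoint_boxes D" "D \<noteq> {}" for D
    using that by (intro lmeasurable_open_pos disjoint_boxes_lmeasurable disjoint_boxes_open) (auto simp: disjoint_boxes_def)
  define a where "a = ?m (\<Union>\<A>)"
  define b where "b = ?m (\<Union>\<B>)"
  have ab: "a > 0" "b > 0" using A B unfolding a_def b_def by (auto intro!: pos)
  define \<alpha> where "\<alpha> = ?m (\<Union>A1) / a"
  have sumA: "a = ?m (\<Union>A1) + ?m (\<Union>A2)" unfolding a_def UA
    by (rule measure_halfspaces[OF disjoint_boxes_lmeasurable[OF A(1)] i])
  have \<alpha>: "0 < \<alpha>" "\<alpha> < 1" using pos[OF dA(1) neA(1)] pos[OF dA(2) neA(2)] sumA ab by (auto simp: \<alpha>_def field_simps)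
  have mA: "?m (\<Union>A1) = \<alpha> * a" "?m (\<Union>A2) = (1 - \<alpha>) * a" using ab sumA by (auto simp: \<alpha>_def field_simps)
  obtain d where d: "?m (\<Union>\<B> \<inter> {x. x \<bullet> i < d}) = \<alpha> * b"
    by (rule halfspace_measure_IVT[OF disjoint_boxes_bounded[OF B(1)] disjoint_boxes_lmeasurable[OF B(1)] i, of "\<alpha> * b"])
      (use \<alpha> ab in \<open>auto simp: b_def mult_left_le_one_le\<close>)
  define B1 where "B1 = restrict_boxes {x. x \<bullet> i < d} \<B>"
  define B2 where "B2 = restrict_boxes {x. d < x \<bullet> i} \<B>"
  have dB: "disjoint_boxes B1" "disjoint_boxes B2"
    unfolding B1_def B2_def by (intro disjoint_restrict_boxes B BL BG)+
  have cB: "card B1 \<le> card \<B>" "card B2 \<le> card \<B>"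
    unfolding B1_def B2_def by (intro card_restrict_boxes_le fin)+
  have UB: "\<Union>B1 = \<Union>\<B> \<inter> {x. x \<bullet> i < d}" "\<Union>B2 = \<Union>\<B> \<inter> {x. d < x \<bullet> i}"
    unfolding B1_def B2_def by (rule Union_restrict_boxes)+
  have sumB: "b = ?m (\<Union>B1) + ?m (\<Union>B2)" unfolding b_def UB
    by (rule measure_halfspaces[OF disjoint_boxes_lmeasurable[OF B(1)] i])
  have mB: "?m (\<Union>B1) = \<alpha> * b" "?m (\<Union>B2) = (1 - \<alpha>) * b" using d sumB UB by (auto simp: algebra_simps)
  have "?m (\<Union>B1) > 0" "?m (\<Union>B2) > 0" unfolding mB using \<alpha> ab by auto
  then have neB: "B1 \<noteq> {}" "B2 \<noteq> {}" by auto
  \<comment> \<open>Both pieces carry the same fraction \<beta> of their unions and the root is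
    multiplicative, so the induction hypothesis yields the fraction \<beta> of the desired bound;
    the fractions \<alpha> and 1 - \<alpha> then add up.\<close>
  have piece: "\<beta> * (?r a + ?r b) ^ DIM('a) \<le> ?m (\<Union>A' + \<Union>B')"
    if D: "disjoint_boxes A'" "disjoint_boxes B'" "A' \<noteq> {}" "B' \<noteq> {}" "card A' < card \<A>" "card B' \<le> card \<B>"
      and m: "?m (\<Union>A') = \<beta> * a" "?m (\<Union>B') = \<beta> * b" and \<beta>: "\<beta> > 0" for A' B' \<beta>
  proof -
    have "?r \<beta> * (?r a + ?r b) \<le> ?r (?m (\<Union>A' + \<Union>B'))"
      using IH[OF D] unfolding m by (simp add: real_root_mult algebra_simps)
    then have "(?r \<beta> * (?r a + ?r b)) ^ DIM('a) \<le> ?r (?m (\<Union>A' + \<Union>B')) ^ DIM('a)"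
      using ab \<beta> by (intro power_mono) auto
    then show ?thesis using \<beta> by (simp add: power_mult_distrib root_DIM_power)
  qed
  have p1: "\<alpha> * (?r a + ?r b) ^ DIM('a) \<le> ?m (\<Union>A1 + \<Union>B1)"
    by (rule piece[OF dA(1) dB(1) neA(1) neB(1) cA(1) cB(1) mA(1) mB(1) \<alpha>(1)])
  have p2: "(1 - \<alpha>) * (?r a + ?r b) ^ DIM('a) \<le> ?m (\<Union>A2 + \<Union>B2)"
    by (rule piece[OF dA(2) dB(2) neA(2) neB(2) cA(2) cB(2) mA(2) mB(2)]) (use \<alpha> in simp)
  have meas: "\<Union>A1 + \<Union>B1 \<in> lmeasurable" "\<Union>A2 + \<Union>B2 \<in> lmeasurable" "\<Union>\<A> + \<Union>\<B> \<in> lmeasurable"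
    by (intro lmeasurable_open_add disjoint_boxes_open disjoint_boxes_bounded dA dB A B)+
  have "(?r a + ?r b) ^ DIM('a) = \<alpha> * (?r a + ?r b) ^ DIM('a) + (1 - \<alpha>) * (?r a + ?r b) ^ DIM('a)"
    by (simp add: algebra_simps)
  also have "\<dots> \<le> ?m (\<Union>A1 + \<Union>B1) + ?m (\<Union>A2 + \<Union>B2)" using p1 p2 by (rule add_mono)
  also have "\<dots> = ?m ((\<Union>A1 + \<Union>B1) \<union> (\<Union>A2 + \<Union>B2))"
  proof -
    \<comment> \<open>The two partial sums lie on opposite sides of the hyperplane at height c + d,
      so they are disjoint and their measures add.\<close>
    have "x \<bullet> i < c + d" if "x \<in> \<Union>A1 + \<Union>B1" for x
      using that unfolding UA UB by (auto elim!: set_plus_elim simp: inner_add_left)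
    moreover have "c + d < x \<bullet> i" if "x \<in> \<Union>A2 + \<Union>B2" for x
      using that unfolding UA UB by (auto elim!: set_plus_elim simp: inner_add_left)
    ultimately have "(\<Union>A1 + \<Union>B1) \<inter> (\<Union>A2 + \<Union>B2) = {}" by force
    then show ?thesis using measure_Un3[OF meas(1,2)] by simp
  qed
  also have "\<dots> \<le> ?m (\<Union>\<A> + \<Union>\<B>)"
  proof (rule measure_mono_fmeasurable)
    show "(\<Union>A1 + \<Union>B1) \<union> (\<Union>A2 + \<Union>B2) \<subseteq> \<Union>\<A> + \<Union>\<B>"
      unfolding UA UB by (auto elim!: set_plus_elim intro!: set_plus_intro)
  qed (use meas in auto)
  finally have "?r ((?r a + ?r b) ^ DIM('a)) \<le> ?r (?m (\<Union>\<A> + \<Union>\<B>))" by (intro real_root_le_mono) auto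
  moreover have "?r ((?r a + ?r b) ^ DIM('a)) = ?r a + ?r b"
    by (rule real_root_power_cancel) (use ab in auto)
  ultimately show ?thesis unfolding a_def b_def by (simp only:)
qed

text \<open>Induction on the total number of boxes. The step cuts a family with at least two
  members, and commutativity of the sum allows it to be either one; two single boxes remain.\<close>

lemma Brunn_Minkowski_boxes:
  fixes \<A> \<B> :: "'a::euclidean_space set set"
  assumes "disjoint_boxes \<A>" "disjoint_boxes \<B>" "\<A> \<noteq> {}" "\<B> \<noteq> {}"
  shows "root DIM('a) (measure lebesgue (\<Union>\<A>)) + root DIM('a) (measure lebesgue (\<Union>\<B>))
     \<le> root DIM('a) (measure lebesgue (\<Union>\<A> + \<Union>\<B>))"
  using assms
proof (induction "card \<A> + card \<B>" arbitrary: \<A> \<B> rule: less_induct)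
  case less
  have fin: "finite \<A>" "finite \<B>" using less by (auto simp: disjoint_boxes_def)
  then have pos: "card \<A> > 0" "card \<B> > 0" using less by (auto simp: card_gt_0_iff)
  consider "card \<A> \<ge> 2" | "card \<B> \<ge> 2" | "card \<A> = 1" "card \<B> = 1" using pos by linarith
  then show ?case
  proof cases
    case 1
    show ?thesis
      by (rule Brunn_Minkowski_boxes_step) (use less 1 in auto)
  next
    case 2
    have "root DIM('a) (measure lebesgue (\<Union>\<B>)) + root DIM('a) (measure lebesgue (\<Union>\<A>))
     \<le> root DIM('a) (measure lebesgue (\<Union>\<B> + \<Union>\<A>))"
      by (rule Brunn_Minkowski_boxes_step) (use less 2 in auto)
    then show ?thesis by (simp add: add.commute)
  next
    case 3
    then obtain P Q where PQ: "\<A> = {P}" "\<B> = {Q}" by (metis card_1_singletonE)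
    then obtain a b c d where "P = box a b" "Q = box c d" "box a b \<noteq> {}" "box c d \<noteq> {}"
      using less unfolding disjoint_boxes_def by (metis insertI1)
    then show ?thesis using PQ Brunn_Minkowski_box[of a b c d] by simp
  qed
qed

text \<open>Inner regularity gives a compact set of almost full measure, covered by finitely many
  boxes whose closures lie in U. A division of the union of these closures has non-overlapping
  pieces, and passing to their interiors loses only faces.\<close>

lemma open_inner_boxes:
  fixes U :: "'a::euclidean_space set"
  assumes U: "open U" "bounded U" and e: "e > 0"
  obtains \<D> where "disjoint_boxes \<D>" "\<Union>\<D> \<subseteq> U" "measure lebesgue U - e < measure lebesgue (\<Union>\<D>)"
proof -
  have Um: "U \<in> lmeasurable" using U lmeasurable_open by blast
  obtain T where T: "closed T" "T \<subseteq> U" "U - T \<in> lmeasurable" "emeasure lebesgue (U - T) < ennreal e"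
    using sets_lebesgue_inner_closed[of U e] Um e by (metis fmeasurableD)
  have cT: "compact T" using T U by (metis bounded_subset compact_eq_bounded_closed)
  have mT: "measure lebesgue U - e < measure lebesgue T"
  proof -
    have "measure lebesgue (U - T) < e"
      using T e by (simp add: emeasure_eq_measure2 ennreal_less_iff fmeasurableD2)
    moreover have "measure lebesgue (U - T) = measure lebesgue U - measure lebesgue T"
      using T Um cT by (intro measurable_measure_Diff) (auto simp: lmeasurable_compact fmeasurableD)
    ultimately show ?thesis by simp
  qed
  have "\<exists>a b. x \<in> box a b \<and> cbox a b \<subseteq> U" if "x \<in> T" for x
    using open_contains_cbox[OF U(1)] that T(2) by (metis subsetD)
  then obtain fa fb where f: "\<And>x. x \<in> T \<Longrightarrow> x \<in> box (fa x) (fb x) \<and> cbox (fa x) (fb x) \<subseteq> U" by metis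
  obtain C' where C: "C' \<subseteq> T" "finite C'" "T \<subseteq> (\<Union>x\<in>C'. box (fa x) (fb x))"
    using compactE_image[OF cT, of T "\<lambda>x. box (fa x) (fb x)"] f open_box by (metis (no_types, lifting) UN_I subsetI)
  define F where "F = (\<Union>x\<in>C'. cbox (fa x) (fb x))"
  have F: "T \<subseteq> F" "F \<subseteq> U"
  proof -
    show "T \<subseteq> F" unfolding F_def by (rule order_trans[OF C(3)]) (intro UN_mono order_refl box_subset_cbox)
    show "F \<subseteq> U" unfolding F_def using C(1) f by blast
  qed
  have "\<exists>p. p division_of F" unfolding F_def
    by (rule elementary_unions_intervals[of "(\<lambda>x. cbox (fa x) (fb x)) ` C'"]) (use C in auto)
  then obtain p where p: "p division_of F" ..
  define \<D> where "\<D> = interior ` p - {{}}"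
  have fp: "finite p" using p by blast
  have box: "\<exists>a b. k = cbox a b" if "k \<in> p" for k using division_ofD(4)[OF p that] by blast
  have D: "disjoint_boxes \<D>"
    unfolding disjoint_boxes_def
  proof (intro conjI ballI)
    show "finite \<D>" using fp by (simp add: \<D>_def)
    show "disjoint \<D>" unfolding disjoint_def \<D>_def using division_ofD(5)[OF p] by blast
    fix Q assume Q: "Q \<in> \<D>"
    then show "Q \<noteq> {}" by (simp add: \<D>_def)
    show "\<exists>a b. Q = box a b" using Q box unfolding \<D>_def by (metis DiffD1 imageE interior_cbox)
  qed
  have UD: "\<Union>\<D> = (\<Union>k\<in>p. interior k)" by (auto simp: \<D>_def)
  have Fp: "F = \<Union>p" using p by blast
  have sub: "\<Union>\<D> \<subseteq> F" unfolding UD Fp using interior_subset by blast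
  have neg: "negligible (F - \<Union>\<D>)"
  proof (rule negligible_subset)
    show "negligible (\<Union>k\<in>p. k - interior k)"
    proof (rule negligible_Union)
      fix t assume "t \<in> (\<lambda>k. k - interior k) ` p"
      then obtain k where "k \<in> p" "t = k - interior k" by blast
      then show "negligible t" using box negligible_frontier_interval by (metis interior_cbox)
    qed (use fp in simp)
    show "F - \<Union>\<D> \<subseteq> (\<Union>k\<in>p. k - interior k)" unfolding UD Fp by blast
  qed
  have Fm: "F \<in> lmeasurable" unfolding F_def using C by (intro fmeasurable.finite_UN) auto
  have "sym_diff F (\<Union>\<D>) = F - \<Union>\<D>" using sub by blast
  then have "measure lebesgue F = measure lebesgue (\<Union>\<D>)"
    using measure_negligible_symdiff[OF Fm, of "\<Union>\<D>"] neg by (simp only:)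
  moreover have "measure lebesgue T \<le> measure lebesgue F"
    by (rule measure_mono_fmeasurable) (use F Fm cT in \<open>auto simp: lmeasurable_compact fmeasurableD\<close>)
  ultimately show ?thesis using that[OF D] sub F mT by force
qed

lemma measure_interior_convex_body:
  assumes "convex_body K" shows "measure lebesgue (interior K) = measure lebesgue K"
  using assms unfolding convex_body_def
  by (metis compact_imp_bounded measure_interior negligible_convex_frontier)

lemma compact_set_plus:
  fixes A B :: "'a::real_normed_vector set"
  assumes "compact A" "compact B" shows "compact (A + B)"
proof -
  have "A + B = {x + y | x y. x \<in> A \<and> y \<in> B}" by (auto simp: set_plus_def)
  then show ?thesis using compact_sums[OF assms] by simp
qed

lemma convex_body_measure_pos: "convex_body K \<Longrightarrow> measure lebesgue K > 0"
  using lmeasurable_open_pos[of "interior K"] measure_interior_convex_body[of K]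
  by (simp add: convex_body_def lmeasurable_interior compact_imp_bounded)

text \<open>The boundary of a convex body is negligible, so its interior can be exhausted by boxes
  up to e in measure; continuity of the root removes e.\<close>

theorem Brunn_Minkowski:
  fixes A B :: "'a::euclidean_space set"
  assumes A: "convex_body A" and B: "convex_body B"
  shows "root DIM('a) (measure lebesgue A) + root DIM('a) (measure lebesgue B)
     \<le> root DIM('a) (measure lebesgue (A + B))"
proof -
  let ?m = "measure lebesgue :: 'a set \<Rightarrow> real" and ?r = "root DIM('a)"
  have bd: "bounded (interior A)" "bounded (interior B)"
    using A B by (auto simp: convex_body_def compact_imp_bounded bounded_subset[OF _ interior_subset])
  have "?r (?m A - e) + ?r (?m B - e) \<le> ?r (?m (A + B))" if e: "0 < e" "e < ?m A" "e < ?m B" for e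
  proof -
    obtain \<A> where D: "disjoint_boxes \<A>" "\<Union>\<A> \<subseteq> interior A" "?m (interior A) - e < ?m (\<Union>\<A>)"
      using open_inner_boxes[OF open_interior bd(1) e(1)] by metis
    obtain \<B> where E: "disjoint_boxes \<B>" "\<Union>\<B> \<subseteq> interior B" "?m (interior B) - e < ?m (\<Union>\<B>)"
      using open_inner_boxes[OF open_interior bd(2) e(1)] by metis
    note m = measure_interior_convex_body[OF A] measure_interior_convex_body[OF B]
    have ne: "\<A> \<noteq> {}" "\<B> \<noteq> {}" using D E e m by force+
    have "?r (?m A - e) + ?r (?m B - e) \<le> ?r (?m (\<Union>\<A>)) + ?r (?m (\<Union>\<B>))"
      using D E m by (intro add_mono real_root_le_mono) auto
    also have "\<dots> \<le> ?r (?m (\<Union>\<A> + \<Union>\<B>))" by (rule Brunn_Minkowski_boxes[OF D(1) E(1) ne])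
    also have "\<dots> \<le> ?r (?m (A + B))"
    proof (intro real_root_le_mono measure_mono_fmeasurable)
      show "\<Union>\<A> + \<Union>\<B> \<subseteq> A + B"
        using D E interior_subset by (intro set_plus_mono2) blast+
      show "\<Union>\<A> + \<Union>\<B> \<in> sets lebesgue"
        using lmeasurable_open_add[OF disjoint_boxes_open disjoint_boxes_bounded disjoint_boxes_bounded] D E by blast
      show "A + B \<in> lmeasurable"
        using A B by (intro lmeasurable_compact compact_set_plus) (auto simp: convex_body_def)
    qed simp
    finally show ?thesis .
  qed
  then have "\<forall>\<^sub>F e in at_right 0. ?r (?m A - e) + ?r (?m B - e) \<le> ?r (?m (A + B))"
    using convex_body_measure_pos[OF A] convex_body_measure_pos[OF B]
    unfolding eventually_at_right_field by (intro exI[of _ "min (?m A) (?m B)"]) auto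
  moreover have "((\<lambda>e. ?r (?m A - e) + ?r (?m B - e)) \<longlongrightarrow> ?r (?m A - 0) + ?r (?m B - 0)) (at_right 0)"
    by (intro tendsto_intros)
  ultimately have "?r (?m A - 0) + ?r (?m B - 0) \<le> ?r (?m (A + B))"
    by (intro tendsto_upperbound) auto
  then show ?thesis by (simp only: diff_zero)
qed


section \<open>Linear images and isotropic constants\<close>

text \<open>The number c is |det T|, characterised by the change of variables formula itself, which
  is the only property of the determinant that is used.\<close>

definition lin_scale :: "('a::euclidean_space \<Rightarrow> 'a) \<Rightarrow> real \<Rightarrow> bool" where
  "lin_scale T c \<longleftrightarrow> c > 0 \<and> lborel = density (distr lborel borel T) (\<lambda>_. ennreal c)"

lemma borel_measurable_linear [measurable_dest]:
  fixes T :: "'a::euclidean_space \<Rightarrow> 'b::euclidean_space"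
  shows "linear T \<Longrightarrow> T \<in> borel_measurable borel"
  by (intro borel_measurable_continuous_onI linear_continuous_on) (simp add: linear_conv_bounded_linear)

lemma nn_integral_lborel_translate:
  fixes f :: "'a::euclidean_space \<Rightarrow> ennreal"
  assumes [measurable]: "f \<in> borel_measurable borel"
  shows "(\<integral>\<^sup>+x. f (a + x) \<partial>lborel) = (\<integral>\<^sup>+x. f x \<partial>lborel)"
proof -
  have "(\<integral>\<^sup>+x. f x \<partial>lborel) = (\<integral>\<^sup>+x. f x \<partial>distr lborel borel ((+) a))" by (simp only: lborel_distr_plus)
  also have "\<dots> = (\<integral>\<^sup>+x. f (a + x) \<partial>lborel)" by (subst nn_integral_distr) auto
  finally show ?thesis ..
qed

text \<open>The image measure is translation invariant, hence proportional to Lebesgue measure: integrate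
  \<open>f (T x) * g (y - T x)\<close> in both orders with \<open>g\<close> the indicator of the unit ball.\<close>

lemma nn_integral_linear_proportional:
  fixes T :: "'a::euclidean_space \<Rightarrow> 'a"
  assumes T: "linear T" "bij T" and f[measurable]: "f \<in> borel_measurable borel"
  shows "(\<integral>\<^sup>+x. f (T x) \<partial>lborel) * emeasure lborel (ball (0::'a) 1)
    = (\<integral>\<^sup>+x. f x \<partial>lborel) * emeasure lborel (T -` ball 0 1)"
proof -
  note [measurable] = borel_measurable_linear[OF T(1)]
  define g :: "'a \<Rightarrow> ennreal" where "g = indicator (ball 0 1)"
  have [measurable]: "g \<in> borel_measurable borel" by (simp add: g_def borel_measurable_indicator)
  have g0: "(\<integral>\<^sup>+x. g x \<partial>lborel) = emeasure lborel (ball (0::'a) 1)" by (simp add: g_def)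
  have "(\<integral>\<^sup>+x. f (T x) \<partial>lborel) * emeasure lborel (ball (0::'a) 1) = (\<integral>\<^sup>+x. f (T x) * (\<integral>\<^sup>+y. g y \<partial>lborel) \<partial>lborel)"
    by (subst nn_integral_multc) (auto simp: g0)
  also have "\<dots> = (\<integral>\<^sup>+x. f (T x) * (\<integral>\<^sup>+y. g (- T x + y) \<partial>lborel) \<partial>lborel)"
    by (subst nn_integral_lborel_translate) auto
  also have "\<dots> = (\<integral>\<^sup>+x. \<integral>\<^sup>+y. f (T x) * g (- T x + y) \<partial>lborel \<partial>lborel)"
    by (subst nn_integral_cmult) auto
  also have "\<dots> = (\<integral>\<^sup>+y. \<integral>\<^sup>+x. f (T x) * g (- T x + y) \<partial>lborel \<partial>lborel)"
    by (rule lborel_pair.Fubini') simp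
  also have "\<dots> = (\<integral>\<^sup>+y. \<integral>\<^sup>+x. f (T x + y) * g (- T x) \<partial>lborel \<partial>lborel)"
  proof (rule nn_integral_cong)
    fix y :: 'a
    obtain z where z: "T z = y" using T(2) by (metis bij_pointE)
    have "(\<integral>\<^sup>+x. f (T x) * g (- T x + y) \<partial>lborel) = (\<integral>\<^sup>+x. f (T (z + x)) * g (- T (z + x) + y) \<partial>lborel)"
      by (subst nn_integral_lborel_translate[symmetric, where a=z]) auto
    also have "\<dots> = (\<integral>\<^sup>+x. f (T x + y) * g (- T x) \<partial>lborel)"
      by (intro nn_integral_cong) (simp add: linear_add[OF T(1)] z add.commute)
    finally show "(\<integral>\<^sup>+x. f (T x) * g (- T x + y) \<partial>lborel) = (\<integral>\<^sup>+x. f (T x + y) * g (- T x) \<partial>lborel)" .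
  qed
  also have "\<dots> = (\<integral>\<^sup>+x. \<integral>\<^sup>+y. f (T x + y) * g (- T x) \<partial>lborel \<partial>lborel)"
    by (rule lborel_pair.Fubini'[symmetric]) simp
  also have "\<dots> = (\<integral>\<^sup>+x. (\<integral>\<^sup>+y. f (T x + y) \<partial>lborel) * g (- T x) \<partial>lborel)"
    by (subst nn_integral_multc) auto
  also have "\<dots> = (\<integral>\<^sup>+x. (\<integral>\<^sup>+y. f y \<partial>lborel) * g (- T x) \<partial>lborel)"
    by (subst nn_integral_lborel_translate) auto
  also have "\<dots> = (\<integral>\<^sup>+y. f y \<partial>lborel) * (\<integral>\<^sup>+x. g (- T x) \<partial>lborel)"
    by (subst nn_integral_cmult) auto
  also have "(\<integral>\<^sup>+x. g (- T x) \<partial>lborel) = (\<integral>\<^sup>+x. indicator (T -` ball 0 1) x \<partial>lborel)"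
    by (intro nn_integral_cong) (auto simp: g_def indicator_def)
  also have "\<dots> = emeasure lborel (T -` ball 0 1)"
    by (rule nn_integral_indicator) (use measurable_sets_borel[OF borel_measurable_linear[OF T(1)]] in auto)
  finally show ?thesis .
qed

text \<open>The factor is the quotient of the volumes of the unit ball and of its preimage under T.
  The preimage is open and contains 0, and it is bounded because T has a linear left inverse; so
  both volumes are finite and positive.\<close>

lemma lin_scale_exists:
  fixes T :: "'a::euclidean_space \<Rightarrow> 'a"
  assumes T: "linear T" "bij T"
  obtains c where "lin_scale T c"
proof -
  note [measurable] = borel_measurable_linear[OF T(1)]
  define V where "V = measure lborel (ball (0::'a) 1)"
  define W where "W = measure lborel (T -` ball (0::'a) 1)"
  have V: "V > 0" by (simp add: V_def content_ball_pos)
  have eV: "emeasure lborel (ball (0::'a) 1) = ennreal V" unfolding V_def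
    using emeasure_bounded_finite[OF bounded_ball, of "0::'a" 1] by (intro emeasure_eq_ennreal_measure) auto
  have cont: "continuous_on UNIV T" using T(1) by (simp add: linear_continuous_on linear_conv_bounded_linear)
  have o: "open (T -` ball 0 1)" using cont by (simp add: open_vimage)
  obtain T' where T': "linear T'" "\<And>x. T' (T x) = x"
    using linear_injective_left_inverse[OF T(1) bij_is_inj[OF T(2)]] by (metis comp_apply id_apply)
  have "T -` ball 0 1 \<subseteq> T' ` ball 0 1"
  proof
    fix x assume "x \<in> T -` ball 0 1"
    then show "x \<in> T' ` ball 0 1" using T'(2)[of x] by (metis imageI vimageE)
  qed
  moreover have "bounded (T' ` ball 0 1)" by (intro bounded_linear_image) (use T' in \<open>auto simp: linear_conv_bounded_linear\<close>)
  ultimately have b: "bounded (T -` ball 0 1)" using bounded_subset by blast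
  have eW: "emeasure lborel (T -` ball 0 1) = ennreal W" unfolding W_def
    using emeasure_bounded_finite[OF b] by (simp add: emeasure_eq_ennreal_measure less_top[symmetric])
  have "measure lebesgue (T -` ball 0 1) > 0"
  proof (rule lmeasurable_open_pos)
    have "0 \<in> T -` ball 0 1" using linear_0[OF T(1)] by simp
    then show "T -` ball 0 1 \<noteq> {}" by blast
  qed (use o b lmeasurable_open in auto)
  then have W: "W > 0" unfolding W_def using o by simp
  have "lborel = density (distr lborel borel T) (\<lambda>_. ennreal (V / W))"
  proof (rule measure_eqI)
    fix A :: "'a set" assume "A \<in> sets lborel"
    then have A[measurable]: "A \<in> sets borel" by simp
    have TA: "T -` A \<in> sets borel" using measurable_sets_borel[OF borel_measurable_linear[OF T(1)] A] by simp
    have "(\<integral>\<^sup>+x. indicator A (T x) \<partial>lborel) = (\<integral>\<^sup>+x. indicator (T -` A) x \<partial>lborel)"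
      by (intro nn_integral_cong) (auto simp: indicator_def)
    then have *: "emeasure lborel (T -` A) * ennreal V = emeasure lborel A * ennreal W"
      using nn_integral_linear_proportional[OF T, of "indicator A"] TA by (simp add: eV eW)
    have "emeasure (density (distr lborel borel T) (\<lambda>_. ennreal (V / W))) A = ennreal (V / W) * emeasure lborel (T -` A)"
      by (subst emeasure_density) (auto simp: nn_integral_cmult emeasure_distr)
    also have "\<dots> = ennreal (1 / W) * (emeasure lborel (T -` A) * ennreal V)"
    proof -
      have "ennreal (V / W) = ennreal (1 / W) * ennreal V" using V W by (subst ennreal_mult[symmetric]) auto
      then show ?thesis by (simp add: mult_ac)
    qed
    also have "\<dots> = (ennreal (1 / W) * ennreal W) * emeasure lborel A" unfolding * by (simp add: mult_ac)
    also have "ennreal (1 / W) * ennreal W = 1" using W by (subst ennreal_mult[symmetric]) auto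
    finally show "emeasure lborel A = emeasure (density (distr lborel borel T) (\<lambda>_. ennreal (V / W))) A" by simp
  qed simp
  then show ?thesis using that[of "V / W"] V W by (simp add: lin_scale_def)
qed

lemma lin_scale_integral:
  fixes T :: "'a::euclidean_space \<Rightarrow> 'a" and f :: "'a \<Rightarrow> 'b::{banach, second_countable_topology}"
  assumes c: "lin_scale T c" and T: "linear T" and f[measurable]: "f \<in> borel_measurable borel"
  shows "(LINT x|lborel. f x) = c *\<^sub>R (LINT x|lborel. f (a + T x))"
proof -
  note [measurable] = borel_measurable_linear[OF T]
  have c': "c > 0" "lborel = density (distr lborel borel T) (\<lambda>_. ennreal c)" using c by (auto simp: lin_scale_def)
  have "(LINT x|lborel. f x) = (LINT x|distr lborel borel ((+) a). f x)" by (simp only: lborel_distr_plus)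
  also have "\<dots> = (LINT x|lborel. f (a + x))" by (subst integral_distr) auto
  also have "\<dots> = (LINT x|density (distr lborel borel T) (\<lambda>_. ennreal c). f (a + x))" by (subst (1) c'(2)) simp
  also have "\<dots> = (LINT x|distr lborel borel T. c *\<^sub>R f (a + x))"
    by (rule integral_density) (use c'(1) in auto)
  also have "\<dots> = c *\<^sub>R (LINT x|distr lborel borel T. f (a + x))" by simp
  also have "(LINT x|distr lborel borel T. f (a + x)) = (LINT x|lborel. f (a + T x))" by (subst integral_distr) auto
  finally show ?thesis .
qed

lemma affine_set_integral:
  fixes T :: "'a::euclidean_space \<Rightarrow> 'a" and f :: "'a \<Rightarrow> 'b::{banach, second_countable_topology}"
  assumes c: "lin_scale T c" and T: "linear T" "bij T" and f[measurable]: "f \<in> borel_measurable borel"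
    and K: "compact K"
  shows "(LINT x:((\<lambda>x. a + T x) ` K)|lebesgue. f x) = c *\<^sub>R (LINT x:K|lebesgue. f (a + T x))"
proof -
  note [measurable] = borel_measurable_linear[OF T(1)]
  have cont: "continuous_on K (\<lambda>x. a + T x)"
    using T by (intro continuous_intros linear_continuous_on) (simp add: linear_conv_bounded_linear)
  have [measurable]: "K \<in> sets borel" "(\<lambda>x. a + T x) ` K \<in> sets borel"
    using K compact_continuous_image[OF cont K] by (auto simp: borel_compact)
  have ind: "indicat_real ((\<lambda>x. a + T x) ` K) (a + T x) = indicat_real K x" for x
  proof -
    have "inj (\<lambda>x. a + T x)" using bij_is_inj[OF T(2)] by (simp add: inj_def)
    then show ?thesis using inj_image_mem_iff[of "\<lambda>x. a + T x" x K] by (simp add: indicator_def)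
  qed
  have "(LINT x:((\<lambda>x. a + T x) ` K)|lebesgue. f x) = (LINT x|lborel. indicat_real ((\<lambda>x. a + T x) ` K) x *\<^sub>R f x)"
    unfolding set_lebesgue_integral_def by (subst integral_completion) auto
  also have "\<dots> = c *\<^sub>R (LINT x|lborel. indicat_real ((\<lambda>x. a + T x) ` K) (a + T x) *\<^sub>R f (a + T x))"
    by (rule lin_scale_integral[OF c T(1)]) simp
  also have "\<dots> = c *\<^sub>R (LINT x:K|lebesgue. f (a + T x))"
    unfolding set_lebesgue_integral_def ind by (subst integral_completion) auto
  finally show ?thesis .
qed

lemma affine_set_measure:
  fixes T :: "'a::euclidean_space \<Rightarrow> 'a"
  assumes c: "lin_scale T c" and T: "linear T" "bij T" and K: "compact K"
  shows "measure lebesgue ((\<lambda>x. a + T x) ` K) = c * measure lebesgue K"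
  using affine_set_integral[OF c T _ K, of "\<lambda>_. 1 :: real" a]
  by (simp add: set_lebesgue_integral_def)

text \<open>T maps the unit ball onto the ball of radius k, whose volume is known.\<close>

lemma lin_scale_conformal:
  fixes T :: "'a::euclidean_space \<Rightarrow> 'a"
  assumes c: "lin_scale T c" and T: "linear T" "bij T" and k: "k > 0" "\<And>x. norm (T x) = k * norm x"
  shows "c = k ^ DIM('a)"
proof -
  have "(\<lambda>x. 0 + T x) ` cball 0 1 = cball 0 k"
  proof (intro equalityI subsetI)
    fix y assume y: "y \<in> cball (0::'a) k"
    obtain x where x: "y = T x" using T(2) by (metis bij_pointE)
    then have "norm x \<le> 1" using y k by simp
    then show "y \<in> (\<lambda>x. 0 + T x) ` cball 0 1" using x by auto
  qed (use k in auto)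
  then have "measure lebesgue (cball (0::'a) k) = c * measure lebesgue (cball (0::'a) 1)"
    using affine_set_measure[OF c T, of "cball 0 1" 0] by simp
  then have "k ^ DIM('a) * measure lborel (cball (0::'a) 1) = c * measure lborel (cball (0::'a) 1)"
    using k by (simp add: content_cball)
  moreover have "measure lborel (cball (0::'a) 1) > 0" by (simp add: content_cball_pos)
  ultimately show ?thesis by simp
qed

text \<open>By polarisation the adjoint multiplies inner products by k^2, so T composed with its
  adjoint is k^2 times the identity. The adjoint is onto, so x may be written as the image of some v
  under it.\<close>

lemma adjoint_conformal:
  fixes T :: "'a::euclidean_space \<Rightarrow> 'a"
  assumes T: "linear T" and k: "k > 0" "\<And>x. norm (adjoint T x) = k * norm x"
  shows "norm (T x) = k * norm x"
proof -
  have la: "linear (adjoint T)" by (rule adjoint_linear[OF T])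
  have "inj (adjoint T)"
    using k by (metis la linear_injective_0 mult_eq_0_iff norm_eq_zero order_less_irrefl)
  then have "surj (adjoint T)" using la linear_injective_imp_surjective by blast
  then obtain v where v: "x = adjoint T v" by (metis surjD)
  have inner: "adjoint T v \<bullet> adjoint T w = k\<^sup>2 * (v \<bullet> w)" for v w
  proof -
    have "(norm (adjoint T (v + w)))\<^sup>2 = k\<^sup>2 * (norm (v + w))\<^sup>2" "(norm (adjoint T v))\<^sup>2 = k\<^sup>2 * (norm v)\<^sup>2"
      "(norm (adjoint T w))\<^sup>2 = k\<^sup>2 * (norm w)\<^sup>2"
      by (simp_all add: k power_mult_distrib)
    then show ?thesis by (simp add: linear_add[OF la] power2_norm_eq_inner algebra_simps inner_commute)
  qed
  have "T (adjoint T v) = k\<^sup>2 *\<^sub>R v"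
  proof (rule euclidean_eqI)
    fix b :: 'a
    show "T (adjoint T v) \<bullet> b = k\<^sup>2 *\<^sub>R v \<bullet> b" using inner[of v b] adjoint_works[OF T, of "adjoint T v" b] by simp
  qed
  then show ?thesis unfolding v using k by (simp add: power2_eq_square)
qed

section \<open>Second moments and the value of the isotropic constant\<close>

lemma integrable_compact:
  fixes f :: "'a::euclidean_space \<Rightarrow> 'b::{banach, second_countable_topology}"
  assumes "compact K" "continuous_on UNIV f"
  shows "set_integrable lebesgue K f"
proof -
  have "integrable lborel (\<lambda>x. indicator K x *\<^sub>R f x)"
    by (rule borel_integrable_compact) (use assms continuous_on_subset in auto)
  then show ?thesis unfolding set_integrable_def by (simp add: integrable_completion)
qed

lemma second_moment_scale:
  fixes K :: "'a::euclidean_space set"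
  assumes "\<And>\<theta>. norm \<theta> = 1 \<Longrightarrow> (LINT x:K|lebesgue. (x \<bullet> \<theta>)\<^sup>2) = l"
  shows "(LINT x:K|lebesgue. (x \<bullet> v)\<^sup>2) = l * (norm v)\<^sup>2"
proof (cases "v = 0")
  case False
  define \<theta> where "\<theta> = v /\<^sub>R norm v"
  have \<theta>: "norm \<theta> = 1" "v = norm v *\<^sub>R \<theta>" using False by (auto simp: \<theta>_def)
  have "(x \<bullet> v)\<^sup>2 = (norm v)\<^sup>2 * (x \<bullet> \<theta>)\<^sup>2" for x
    by (subst \<theta>(2)) (simp add: power_mult_distrib)
  then have "(LINT x:K|lebesgue. (x \<bullet> v)\<^sup>2) = (norm v)\<^sup>2 * (LINT x:K|lebesgue. (x \<bullet> \<theta>)\<^sup>2)" by simp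
  then show ?thesis using assms[OF \<theta>(1)] by simp
qed simp

lemma affine_image_moments:
  fixes K :: "'a::euclidean_space set"
  assumes c: "lin_scale T c" and T: "linear T" "bij T" and K: "compact K"
    and bar: "(LINT x:K|lebesgue. x) = 0"
  shows "(LINT x:((\<lambda>x. a + T x) ` K)|lebesgue. x) = (c * measure lebesgue K) *\<^sub>R a"
    and "(LINT x:(T ` K)|lebesgue. (x \<bullet> \<theta>)\<^sup>2) = c * (LINT x:K|lebesgue. (x \<bullet> adjoint T \<theta>)\<^sup>2)"
proof -
  have bl: "bounded_linear T" using T by (simp add: linear_conv_bounded_linear)
  have "(LINT x:((\<lambda>x. a + T x) ` K)|lebesgue. x) = c *\<^sub>R (LINT x:K|lebesgue. a + T x)"
    by (rule affine_set_integral[OF c T _ K]) simp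
  also have "(LINT x:K|lebesgue. a + T x) = (LINT x:K|lebesgue. a) + (LINT x:K|lebesgue. T x)"
    using K bl by (intro set_integral_add integrable_compact) (auto intro!: continuous_intros linear_continuous_on)
  also have "(LINT x:K|lebesgue. T x) = T (LINT x:K|lebesgue. x)"
  proof -
    have "integrable lebesgue (\<lambda>x. indicat_real K x *\<^sub>R x)"
      using integrable_compact[OF K continuous_on_id] by (simp add: set_integrable_def)
    from integral_bounded_linear[OF bl this] show ?thesis
      unfolding set_lebesgue_integral_def by (simp add: linear_scale[OF T(1)])
  qed
  also have "(LINT x:K|lebesgue. a) = measure lebesgue K *\<^sub>R a"
    using lmeasurable_compact[OF K] unfolding set_lebesgue_integral_def
    by (subst integral_scaleR_left) (auto simp: fmeasurable_def integrable_indicator_iff)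
  finally show "(LINT x:((\<lambda>x. a + T x) ` K)|lebesgue. x) = (c * measure lebesgue K) *\<^sub>R a"
    using bar linear_0[OF T(1)] by simp
  show "(LINT x:(T ` K)|lebesgue. (x \<bullet> \<theta>)\<^sup>2) = c * (LINT x:K|lebesgue. (x \<bullet> adjoint T \<theta>)\<^sup>2)"
    using affine_set_integral[OF c T _ K, of "\<lambda>x. (x \<bullet> \<theta>)\<^sup>2" 0] by (simp add: adjoint_works[OF T(1)])
qed

text \<open>Existence: dilation by k = |M|^(-1/n) produces an isotropic image. Uniqueness: the
  barycentre of an isotropic image forces the translation to vanish, its second moments force the
  adjoint of the linear part to be conformal, and its volume forces the conformal factor to be
  k.\<close>

lemma isotropic_const_eq:
  fixes M :: "'a::euclidean_space set"
  assumes M: "convex_body M" and bar: "(LINT x:M|lebesgue. x) = 0"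
    and mom: "\<And>\<theta>. norm \<theta> = 1 \<Longrightarrow> (LINT x:M|lebesgue. (x \<bullet> \<theta>)\<^sup>2) = l" and l: "l > 0"
  shows "isotropic_const M = sqrt l / measure lebesgue M powr (1/2 + 1 / DIM('a))"
proof -
  let ?m = "measure lebesgue M" and ?n = "DIM('a)"
  have m: "?m > 0" by (rule convex_body_measure_pos[OF M])
  have cM: "compact M" using M by (simp add: convex_body_def)
  have sm: "(LINT x:M|lebesgue. (x \<bullet> v)\<^sup>2) = l * (norm v)\<^sup>2" for v
    by (rule second_moment_scale) (rule mom)
  define k where "k = ?m powr (- 1 / ?n)"
  have k: "k > 0" using m by (simp add: k_def)
  have kn: "k ^ ?n = 1 / ?m"
  proof -
    have "k ^ ?n = k powr real ?n" using k by (simp add: powr_realpow)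
    also have "\<dots> = ?m powr (- 1)" unfolding k_def by (simp add: powr_powr)
    finally show ?thesis using m by (simp add: powr_minus_divide)
  qed
  define L where "L = sqrt l * k powr (real ?n / 2 + 1)"
  have L: "L > 0" using l k by (simp add: L_def)
  have L2: "L\<^sup>2 = k ^ ?n * (l * k\<^sup>2)"
  proof -
    have "(k powr (real ?n / 2 + 1))\<^sup>2 = k powr (real ?n / 2 + 1 + (real ?n / 2 + 1))"
      by (simp only: power2_eq_square powr_add[symmetric])
    also have "\<dots> = k powr real (?n + 2)" by (simp add: add.commute)
    also have "\<dots> = k ^ (?n + 2)" using k by (rule powr_realpow)
    finally have X: "(k powr (real ?n / 2 + 1))\<^sup>2 = k ^ ?n * k\<^sup>2" by (simp only: power_add)
    have "L\<^sup>2 = (sqrt l)\<^sup>2 * (k powr (real ?n / 2 + 1))\<^sup>2" unfolding L_def by (rule power_mult_distrib)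
    then show ?thesis unfolding X using l by simp
  qed
  have Leq: "L = sqrt l / ?m powr (1/2 + 1 / ?n)"
  proof -
    have "k powr (real ?n / 2 + 1) = ?m powr ((- 1 / ?n) * (real ?n / 2 + 1))" unfolding k_def by (rule powr_powr)
    also have "(- 1 / ?n) * (real ?n / 2 + 1) = - (1/2 + 1 / ?n)" by (simp add: field_simps)
    finally have X: "k powr (real ?n / 2 + 1) = ?m powr - (1/2 + 1 / ?n)" .
    show ?thesis unfolding L_def X powr_minus_divide by simp
  qed
  have ex: "\<exists>a (T :: 'a \<Rightarrow> 'a). linear T \<and> bij T \<and> isotropic_with ((\<lambda>x. a + T x) ` M) L"
  proof (intro exI conjI)
    let ?T = "\<lambda>x::'a. k *\<^sub>R x"
    show lT: "linear ?T" by (simp add: linear_iff scaleR_right_distrib)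
    show bT: "bij ?T" by (rule o_bij[where g="\<lambda>x. (1/k) *\<^sub>R x"]) (use k in auto)
    obtain c where c: "lin_scale ?T c" using lin_scale_exists[OF lT bT] .
    have ck: "c = 1 / ?m" using lin_scale_conformal[OF c lT bT k] k kn by simp
    have img: "(\<lambda>x. 0 + ?T x) ` M = ?T ` M" by simp
    have adj: "adjoint ?T \<theta> = k *\<^sub>R \<theta>" for \<theta> :: 'a
    proof (rule euclidean_eqI)
      fix b :: 'a
      show "adjoint ?T \<theta> \<bullet> b = k *\<^sub>R \<theta> \<bullet> b" using adjoint_works[OF lT, of b \<theta>] by (simp add: inner_commute)
    qed
    show "isotropic_with ((\<lambda>x. 0 + ?T x) ` M) L"
      unfolding isotropic_with_def img
    proof (intro conjI ballI)
      show "convex_body (?T ` M)" unfolding convex_body_def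
      proof (intro conjI)
        show "compact (?T ` M)" using cM by (rule compact_scaling)
        show "convex (?T ` M)" using M by (simp add: convex_body_def convex_scaling)
        show "interior (?T ` M) \<noteq> {}" using M k interior_injective_linear_image[OF lT bij_is_inj[OF bT], of M]
          by (simp add: convex_body_def)
      qed
      show "measure lebesgue (?T ` M) = 1" using affine_set_measure[OF c lT bT cM, of 0] ck m by simp
      show "barycenter (?T ` M) = 0" using affine_image_moments(1)[OF c lT bT cM bar, of 0] by (simp add: barycenter_def)
      show "L > 0" by (rule L)
      fix \<theta> :: 'a assume "\<theta> \<in> sphere 0 1"
      then show "(LINT x:?T ` M|lebesgue. (x \<bullet> \<theta>)\<^sup>2) = L\<^sup>2"
        unfolding affine_image_moments(2)[OF c lT bT cM bar] adj sm
        using ck kn L2 k m mom by (simp add: power_mult_distrib)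
    qed
  qed
  have unique: "L' = L" if ex': "\<exists>a (T :: 'a \<Rightarrow> 'a). linear T \<and> bij T \<and> isotropic_with ((\<lambda>x. a + T x) ` M) L'" for L'
  proof -
    obtain a and T :: "'a \<Rightarrow> 'a" where T: "linear T" "bij T" and iso: "isotropic_with ((\<lambda>x. a + T x) ` M) L'" using ex' by blast
    obtain c where c: "lin_scale T c" using lin_scale_exists[OF T] .
    have c0: "c > 0" using c by (simp add: lin_scale_def)
    have L': "L' > 0" using iso by (simp add: isotropic_with_def)
    have cm: "c * ?m = 1" using iso affine_set_measure[OF c T cM, of a] by (simp add: isotropic_with_def)
    \<comment> \<open>The image has volume 1, so its barycentre is a itself.\<close>
    have "a = 0" using iso affine_image_moments(1)[OF c T cM bar, of a] cm
      by (auto simp: isotropic_with_def barycenter_def)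
    then have iso': "isotropic_with (T ` M) L'" using iso by simp
    have mo: "c * (l * (norm (adjoint T \<theta>))\<^sup>2) = L'\<^sup>2" if "norm \<theta> = 1" for \<theta>
      using iso' that unfolding isotropic_with_def affine_image_moments(2)[OF c T cM bar] sm by auto
    \<comment> \<open>The only positive value of the norm of \<open>adjoint T \<theta>\<close> that
      is compatible with \<open>mo\<close>.\<close>
    define \<kappa> where "\<kappa> = L' / sqrt (c * l)"
    have \<kappa>: "\<kappa> > 0" using L' c0 l by (simp add: \<kappa>_def)
    have \<kappa>2: "c * (l * \<kappa>\<^sup>2) = L'\<^sup>2" using c0 l by (simp add: \<kappa>_def power_divide)
    have unit: "norm (adjoint T \<theta>) = \<kappa>" if "norm \<theta> = 1" for \<theta>
    proof -
      have "(norm (adjoint T \<theta>))\<^sup>2 = \<kappa>\<^sup>2"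
        using mo[OF that] \<kappa>2[symmetric] c0 l by (simp only: mult_cancel_left) simp
      then show ?thesis using \<kappa> by (simp add: power2_eq_iff_nonneg)
    qed
    have la: "linear (adjoint T)" by (rule adjoint_linear[OF T(1)])
    have "norm (adjoint T v) = \<kappa> * norm v" for v
    proof (cases "v = 0")
      case False
      have "adjoint T v = norm v *\<^sub>R adjoint T (v /\<^sub>R norm v)" using False by (simp add: linear_scale[OF la])
      then have "norm (adjoint T v) = norm v * norm (adjoint T (v /\<^sub>R norm v))" by simp
      also have "norm (adjoint T (v /\<^sub>R norm v)) = \<kappa>" using False by (intro unit) simp
      finally show ?thesis by simp
    qed (simp add: linear_0[OF la])
    then have "norm (T x) = \<kappa> * norm x" for x using adjoint_conformal[OF T(1) \<kappa>] by blast
    then have "c = \<kappa> ^ ?n" by (rule lin_scale_conformal[OF c T \<kappa>])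
    then have "\<kappa> ^ ?n = 1 / ?m" using cm m by (simp only: eq_divide_eq) simp
    then have "\<kappa> ^ ?n = k ^ ?n" using kn by simp
    then have "\<kappa> = k" by (rule power_eq_imp_eq_base) (use \<kappa> k in auto)
    then have "L'\<^sup>2 = L\<^sup>2" using \<kappa>2 L2 \<open>c = \<kappa> ^ ?n\<close> by simp
    then show "L' = L" using L L' by (simp add: power2_eq_iff_nonneg)
  qed
  have "isotropic_const M = L" unfolding isotropic_const_def
    by (rule the_equality) (use ex unique in blast)+
  then show ?thesis using Leq by simp
qed

lemma isotropic_const_isotropic_with:
  assumes "isotropic_with K L" shows "isotropic_const K = L"
proof -
  have "isotropic_const K = sqrt (L\<^sup>2) / measure lebesgue K powr (1/2 + 1 / DIM('a))"
    by (rule isotropic_const_eq) (use assms in \<open>auto simp: isotropic_with_def barycenter_def\<close>)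
  then show ?thesis using assms by (simp add: isotropic_with_def)
qed

section \<open>Isotropic simplices are regular\<close>

lemma affine_independent_swap:
  fixes V :: "'a::euclidean_space set"
  assumes V: "\<not> affine_dependent V" "card V = DIM('a) + 1" and vw: "v \<in> V" "w \<in> V" "v \<noteq> w"
  obtains T :: "'a \<Rightarrow> 'a" where "linear T" "bij T" "T (w - v) = v - w" "\<And>u. u \<in> V - {v, w} \<Longrightarrow> T (u - v) = u - w"
proof -
  define B where "B = (\<lambda>x. -v + x) ` (V - {v})"
  have iB: "independent B" unfolding B_def using affine_dependent_iff_dependent2[OF vw(1)] V(1) by simp
  have fV: "finite V" using V(2) by (metis card.infinite add_is_0 one_neq_zero)
  have "card B = card (V - {v})" unfolding B_def by (intro card_image) (simp add: inj_on_def)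
  also have "\<dots> = DIM('a)" using V(2) vw fV by simp
  finally have cB: "card B = DIM('a)" .
  have sB: "span B = UNIV" using iB cB by (metis dim_eq_card_independent dim_eq_full)
  \<comment> \<open>The affine involution exchanges v with w and fixes every other vertex u, so its
    linear part must send w - v to v - w and u - v to u - w. These differences form a basis; on it T
    is checked to be its own inverse, which gives bijectivity.\<close>
  obtain T where T: "linear T" "\<And>x. x \<in> B \<Longrightarrow> T x = (if x = w - v then v - w else x + v - w)"
    using linear_independent_extend[OF iB, of "\<lambda>x. if x = w - v then v - w else x + v - w"] by blast
  have Tw: "T (w - v) = v - w" using T(2)[of "w - v"] vw by (auto simp: B_def)
  have Tu: "T (u - v) = u - w" if "u \<in> V - {v, w}" for u
    using T(2)[of "u - v"] that by (auto simp: B_def)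
  have TT: "T (T x) = x" if x: "x \<in> B" for x
  proof -
    obtain u where "u \<in> V - {v}" "x = -v + u" using x unfolding B_def by blast
    then have u: "u \<in> V" "u \<noteq> v" "x = u - v" by simp_all
    show ?thesis
    proof (cases "u = w")
      case True then show ?thesis using u Tw linear_neg[OF T(1), of "w - v"] by simp
    next
      case False
      then have "T (u - w) = T (u - v) - T (w - v)" by (simp flip: linear_diff[OF T(1)])
      then show ?thesis using u False Tu[of u] Tw by simp
    qed
  qed
  have "(T \<circ> T) x = id x" for x
    by (rule linear_eq_on_span[of "T \<circ> T" id B]) (use T(1) TT sB in \<open>auto intro: linear_compose linear_id\<close>)
  then have "bij T" by (intro o_bij[of T T]) auto
  then show ?thesis using that T(1) Tw Tu by blast
qed

text \<open>The swap maps the simplex onto itself. Its volume then forces the factor 1, its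
  barycentre forces the translation to vanish, and its second moments make the adjoint norm
  preserving, so the linear part preserves norms; it carries u - v to u - w.\<close>

lemma isotropic_simplex_dist_eq:
  fixes V :: "'a::euclidean_space set"
  assumes iso: "isotropic_with (convex hull V) L"
    and V: "\<not> affine_dependent V" "card V = DIM('a) + 1" and vw: "v \<in> V" "w \<in> V" "v \<noteq> w"
    and u: "u \<in> V - {v, w}"
  shows "dist u v = dist u w"
proof -
  let ?K = "convex hull V"
  obtain T where T: "linear T" "bij T" "T (w - v) = v - w" "\<And>u. u \<in> V - {v, w} \<Longrightarrow> T (u - v) = u - w"
    using affine_independent_swap[OF V vw] by metis
  define a where "a = w - T v"
  have A: "a + T x = w + T (x - v)" for x by (simp add: a_def linear_diff[OF T(1)])
  have AV: "a + T v = w" "a + T w = v" "\<And>u. u \<in> V - {v, w} \<Longrightarrow> a + T u = u"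
    using T linear_0[OF T(1)] by (simp_all add: A)
  have "(\<lambda>x. a + T x) ` V = V"
  proof (intro equalityI subsetI)
    fix x assume "x \<in> (\<lambda>x. a + T x) ` V"
    then obtain z where "z \<in> V" "x = a + T z" by blast
    then show "x \<in> V" using AV vw by (cases "z = v"; cases "z = w") auto
  next
    fix x assume x: "x \<in> V"
    consider "x = v" | "x = w" | "x \<in> V - {v, w}" using x by blast
    then show "x \<in> (\<lambda>x. a + T x) ` V"
    proof cases
      case 1 then show ?thesis using AV(2) vw by (intro image_eqI[of _ _ w]) auto
    next
      case 2 then show ?thesis using AV(1) vw by (intro image_eqI[of _ _ v]) auto
    next
      case 3 then show ?thesis using AV(3)[OF 3] by (intro image_eqI[of _ _ x]) auto
    qed
  qed
  moreover have "(\<lambda>x. a + T x) ` ?K = convex hull ((\<lambda>x. a + T x) ` V)"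
  proof -
    have "(\<lambda>x. a + T x) ` ?K = (\<lambda>x. a + x) ` (T ` ?K)" by (simp add: image_image)
    also have "T ` ?K = convex hull (T ` V)" by (rule convex_hull_linear_image[OF T(1)])
    also have "(\<lambda>x. a + x) ` (convex hull (T ` V)) = convex hull ((\<lambda>x. a + x) ` T ` V)"
      by (rule convex_hull_translation[symmetric])
    finally show ?thesis by (simp add: image_image)
  qed
  ultimately have AK: "(\<lambda>x. a + T x) ` ?K = ?K" by simp
  have cK: "compact ?K" and mK: "measure lebesgue ?K = 1" and bar: "(LINT x:?K|lebesgue. x) = 0" and L: "L > 0"
    using iso by (auto simp: isotropic_with_def convex_body_def barycenter_def)
  have mom: "(LINT x:?K|lebesgue. (x \<bullet> \<theta>)\<^sup>2) = L\<^sup>2" if "norm \<theta> = 1" for \<theta>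
    using iso that by (auto simp: isotropic_with_def)
  have sm: "(LINT x:?K|lebesgue. (x \<bullet> v)\<^sup>2) = L\<^sup>2 * (norm v)\<^sup>2" for v
    by (rule second_moment_scale) (rule mom)
  obtain c where c: "lin_scale T c" using lin_scale_exists[OF T(1,2)] .
  have c1: "c = 1" using affine_set_measure[OF c T(1,2) cK, of a] AK mK by simp
  have "a = 0" using affine_image_moments(1)[OF c T(1,2) cK bar, of a] AK mK bar c1 by simp
  then have TK: "T ` ?K = ?K" using AK by simp
  have "L\<^sup>2 * (norm \<theta>)\<^sup>2 = L\<^sup>2 * (norm (adjoint T \<theta>))\<^sup>2" for \<theta>
    using affine_image_moments(2)[OF c T(1,2) cK bar, of \<theta>] unfolding TK sm c1 by simp
  then have "norm (adjoint T \<theta>) = 1 * norm \<theta>" for \<theta> using L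
    by (metis mult_cancel_left mult_1 norm_ge_zero power2_eq_iff_nonneg power_not_zero order_less_irrefl)
  then have "norm (T (u - v)) = 1 * norm (u - v)" using adjoint_conformal[OF T(1), of 1] by simp
  then show ?thesis using T(4)[OF u] by (simp add: dist_norm)
qed

lemma isotropic_simplex_imp_regular:
  fixes V :: "'a::euclidean_space set"
  assumes iso: "isotropic (convex hull V)" and V: "\<not> affine_dependent V" "card V = DIM('a) + 1"
  shows "regular_simplex (convex hull V)"
proof -
  obtain L where L: "isotropic_with (convex hull V) L" using iso by (auto simp: isotropic_def)
  note eq = isotropic_simplex_dist_eq[OF L V]
  have "\<exists>d. \<forall>v\<in>V. \<forall>w\<in>V. v \<noteq> w \<longrightarrow> dist v w = d"
  proof (cases "\<exists>v0\<in>V. \<exists>w0\<in>V. v0 \<noteq> w0")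
    case True
    then obtain v0 w0 where 0: "v0 \<in> V" "w0 \<in> V" "v0 \<noteq> w0" by blast
    have one: "dist v0 x = dist v0 w0" if "x \<in> V" "x \<noteq> v0" for x
    proof (cases "x = w0")
      case False then show ?thesis using eq[of x w0 v0] that 0 by auto
    qed simp
    have "dist v w = dist v0 w0" if vw: "v \<in> V" "w \<in> V" "v \<noteq> w" for v w
    proof (cases "v = v0 \<or> w = v0")
      case True then show ?thesis using one vw by (metis dist_commute)
    next
      case False
      then have "dist v w = dist v v0" using eq[of w v0 v] vw 0 by auto
      then show ?thesis using one[of v] vw False by (simp add: dist_commute)
    qed
    then show ?thesis by blast
  qed auto
  then show ?thesis unfolding regular_simplex_def using V by blast
qed


section \<open>Berwald's inequality\<close>

lemma Beta_nat: "Beta (real a + 1) (real b + 1) = fact a * fact b / fact (a + b + 1)"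
proof -
  have "real a + 1 + (real b + 1) = real (a + b + 1) + 1" by simp
  then show ?thesis unfolding Beta_def
    using Gamma_fact[where 'a=real, of a] Gamma_fact[where 'a=real, of b] Gamma_fact[where 'a=real, of "a + b + 1"]
    by (simp only: add.commute[of 1])
qed

lemma has_integral_Beta_nat:
  "((\<lambda>t. t ^ q * (1 - t) ^ n) has_integral (fact q * fact n / fact (q + n + 1) :: real)) {0..1}"
proof -
  have "((\<lambda>t. t powr real q * (1 - t) powr real n) has_integral Beta (real q + 1) (real n + 1)) {0..1}"
    using has_integral_Beta_real[of "real q + 1" "real n + 1"] by simp
  then have "((\<lambda>t. t ^ q * (1 - t) ^ n) has_integral Beta (real q + 1) (real n + 1)) {0..1}"
    by (rule has_integral_spike_finite[of "{0, 1}", rotated 2]) (auto simp: powr_realpow)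
  then show ?thesis by (simp only: Beta_nat)
qed

lemma has_integral_extend_zero:
  fixes f :: "real \<Rightarrow> real"
  assumes f: "(f has_integral I) {0..a}" and a: "0 \<le> a" "a \<le> S" and z: "\<And>t. t \<ge> a \<Longrightarrow> f t = 0"
  shows "(f has_integral I) {0..S}"
proof -
  have "(f has_integral 0) {a..S}" by (rule has_integral_is_0) (use z in auto)
  from has_integral_combine[OF a f this] show ?thesis by simp
qed

lemma has_integral_cone_moment:
  fixes a :: real
  assumes a: "a > 0" and S: "a \<le> S" and n: "n > 0"
  shows "((\<lambda>t. t ^ q * max 0 (1 - t / a) ^ n) has_integral (a ^ (q + 1) * (fact q * fact n / fact (q + n + 1)))) {0..S}"
proof -
  have "((\<lambda>t. (t / a) ^ q * (1 - t / a) ^ n) has_integral (a * (fact q * fact n / fact (q + n + 1)))) {0..a}"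
  proof -
    have "(\<lambda>x. x * a) ` {0..1} = {0..a}" using a image_mult_atLeastAtMost[of a 0 1] by (simp add: mult.commute)
    then show ?thesis
      using has_integral_stretch_real[OF has_integral_Beta_nat[of q n], of "1 / a"] a
      by (simp add: field_simps)
  qed
  then have "((\<lambda>t. a ^ q * ((t / a) ^ q * (1 - t / a) ^ n)) has_integral a ^ q * (a * (fact q * fact n / fact (q + n + 1)))) {0..a}"
    by (rule has_integral_mult_right)
  then have "((\<lambda>t. t ^ q * (1 - t / a) ^ n) has_integral a ^ (q + 1) * (fact q * fact n / fact (q + n + 1))) {0..a}"
    using a by (simp add: power_divide mult.assoc mult.left_commute[of a])
  then have "((\<lambda>t. t ^ q * max 0 (1 - t / a) ^ n) has_integral a ^ (q + 1) * (fact q * fact n / fact (q + n + 1))) {0..a}"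
    by (rule has_integral_eq[rotated]) (use a in auto)
  then show ?thesis
    by (rule has_integral_extend_zero) (use S a n in \<open>auto simp: zero_power max_def\<close>)
qed

lemma real_choose_fact: "k \<le> m \<Longrightarrow> real (m choose k) = fact m / (fact k * fact (m - k))"
  using binomial_fact[of k m, where 'a=real] by simp

text \<open>The factor is chosen so that the affine profile vanishing from a onwards returns exactly
  a^n, and a^(n+2) in \<open>cone_moment_upper\<close>; general profiles are compared through this
  a.\<close>

lemma cone_moment_lower:
  fixes a :: real
  assumes a: "a > 0" and S: "a \<le> S" and n: "n > 0"
  shows "real ((2*n) choose n) * (real n * integral {0..S} (\<lambda>t. t ^ (n - 1) * max 0 (1 - t / a) ^ n)) = a ^ n"
proof -
  obtain m where m: "n = Suc m" using n gr0_implies_Suc by blast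
  have "integral {0..S} (\<lambda>t. t ^ (n - 1) * max 0 (1 - t / a) ^ n) = a ^ (n - 1 + 1) * (fact (n - 1) * fact n / fact (n - 1 + n + 1))"
    by (rule integral_unique[OF has_integral_cone_moment[OF a S n]])
  also have "\<dots> = a ^ n * (fact (n - 1) * fact n / fact (2 * n))" using m by (simp add: mult_2 del: fact_Suc)
  finally have e: "integral {0..S} (\<lambda>t. t ^ (n - 1) * max 0 (1 - t / a) ^ n) = a ^ n * (fact (n - 1) * fact n / fact (2 * n))" .
  have f: "real n * fact (n - 1) = fact n" unfolding m by simp
  have c: "real ((2*n) choose n) = fact (2*n) / (fact n * fact n)" by (subst real_choose_fact) (auto simp: mult_2)
  have "real ((2*n) choose n) * (real n * (a ^ n * (fact (n - 1) * fact n / fact (2 * n))))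
     = (fact (2*n) / (fact n * fact n)) * (a ^ n * ((real n * fact (n - 1)) * fact n / fact (2 * n)))"
    unfolding c by simp
  also have "\<dots> = a ^ n" unfolding f by simp
  finally show ?thesis unfolding e .
qed

lemma cone_moment_upper:
  fixes a :: real
  assumes a: "a > 0" and S: "a \<le> S" and n: "n > 0"
  shows "real ((2*n+2) choose n) * ((real n + 2) * integral {0..S} (\<lambda>t. t ^ (n + 1) * max 0 (1 - t / a) ^ n)) = a ^ (n + 2)"
proof -
  have "integral {0..S} (\<lambda>t. t ^ (n + 1) * max 0 (1 - t / a) ^ n) = a ^ (n + 1 + 1) * (fact (n + 1) * fact n / fact (n + 1 + n + 1))"
    by (rule integral_unique[OF has_integral_cone_moment[OF a S n]])
  moreover have "n + 1 + n + 1 = 2 * n + 2" "n + 1 + 1 = n + 2" by simp_all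
  ultimately have e: "integral {0..S} (\<lambda>t. t ^ (n + 1) * max 0 (1 - t / a) ^ n) = a ^ (n + 2) * (fact (n + 1) * fact n / fact (2 * n + 2))" by (simp only:)
  have f: "(real n + 2) * fact (n + 1) = fact (n + 2)" by simp
  have "2 * n + 2 - n = n + 2" by simp
  then have c: "real ((2*n+2) choose n) = fact (2*n+2) / (fact n * fact (n + 2))"
    using real_choose_fact[of n "2*n+2"] by (simp only: trans_le_add1 mult_2 le_add1)
  have "real ((2*n+2) choose n) * ((real n + 2) * (a ^ (n + 2) * (fact (n + 1) * fact n / fact (2 * n + 2))))
     = (fact (2*n+2) / (fact n * fact (n + 2))) * (a ^ (n + 2) * (((real n + 2) * fact (n + 1)) * fact n / fact (2 * n + 2)))"
    unfolding c by (simp only: mult_ac times_divide_eq_right times_divide_eq_left)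
  also have "\<dots> = a ^ (n + 2)"
  proof -
    have ratio: "(F / (fact n * H)) * (a ^ (n + 2) * (H * fact n / F)) = a ^ (n + 2)" if "F > 0" "H > 0" for F H :: real
      using that by simp
    show ?thesis unfolding f by (rule ratio) (rule fact_gt_zero)+
  qed
  finally show ?thesis unfolding e .
qed

lemma single_crossing:
  fixes k :: "real \<Rightarrow> real"
  assumes nn: "\<And>t. t \<ge> 0 \<Longrightarrow> k t \<ge> 0" and k0: "k 0 = 1"
    and conc: "\<And>s t. \<lbrakk>0 \<le> s; s \<le> t; k t > 0\<rbrakk> \<Longrightarrow> k s \<ge> 1 - (s / t) * (1 - k t)"
    and zero: "\<And>t. t \<ge> S \<Longrightarrow> k t = 0" and a: "a > 0"
  obtains t0 where "\<And>s. \<lbrakk>0 \<le> s; s < t0\<rbrakk> \<Longrightarrow> k s \<ge> max 0 (1 - s / a)"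
    "\<And>s. \<lbrakk>0 \<le> s; t0 < s\<rbrakk> \<Longrightarrow> k s \<le> max 0 (1 - s / a)"
    "t0 \<ge> 0"
proof -
  \<comment> \<open>Positivity of k keeps P bounded: beyond both supports the two profiles agree,
    being zero.\<close>
  define P where "P = {t. 0 \<le> t \<and> k t > 0 \<and> k t \<ge> max 0 (1 - t / a)}"
  have P0: "0 \<in> P" using k0 by (simp add: P_def)
  have "t \<le> S" if "t \<in> P" for t
  proof (rule ccontr)
    assume "\<not> t \<le> S" then have "k t = 0" using zero[of t] by simp
    then show False using that by (simp add: P_def)
  qed
  then have bdd: "bdd_above P" by (intro bdd_aboveI) auto
  show ?thesis
  proof (rule that[of "Sup P"])
    fix s assume s: "0 \<le> s" "s < Sup P"
    then obtain t where t: "t \<in> P" "s < t" using less_cSup_iff[of P s] P0 bdd by blast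
    have "1 - k t \<le> t / a" using t by (simp add: P_def)
    then have "(s / t) * (1 - k t) \<le> (s / t) * (t / a)" using s t by (intro mult_left_mono) auto
    also have "\<dots> = s / a" using s t by simp
    finally show "k s \<ge> max 0 (1 - s / a)" using conc[of s t] s t nn[of s] by (simp add: P_def)
  next
    fix s assume s: "0 \<le> s" "Sup P < s"
    then have "s \<notin> P" using cSup_upper[OF _ bdd, of s] by force
    then show "k s \<le> max 0 (1 - s / a)" using s nn[of s] by (auto simp: P_def)
  next
    show "Sup P \<ge> 0" using cSup_upper[OF P0 bdd] .
  qed
qed

text \<open>Berwald's inequality between the moments of order \<open>n\<close> and \<open>n + 2\<close>: compare \<open>k\<close> with the affine
  profile having the same lower moment; the difference changes sign only once.\<close>

lemma Berwald:
  fixes k :: "real \<Rightarrow> real"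
  assumes n: "n > 0" and S: "S > 0" and cont: "continuous_on {0..} k"
    and nn: "\<And>t. t \<ge> 0 \<Longrightarrow> k t \<ge> 0" and k0: "k 0 = 1"
    and conc: "\<And>s t. \<lbrakk>0 \<le> s; s \<le> t; k t > 0\<rbrakk> \<Longrightarrow> k s \<ge> 1 - (s / t) * (1 - k t)"
    and zero: "\<And>t. t \<ge> S \<Longrightarrow> k t = 0"
  defines "A \<equiv> real ((2*n) choose n) * (real n * integral {0..S} (\<lambda>t. t ^ (n - 1) * k t ^ n))"
    and "B \<equiv> real ((2*n+2) choose n) * ((real n + 2) * integral {0..S} (\<lambda>t. t ^ (n + 1) * k t ^ n))"
  obtains a where "a > 0" "a ^ n = A" "B \<le> a ^ (n + 2)" "B = a ^ (n + 2) \<Longrightarrow> \<forall>t\<ge>0. k t = max 0 (1 - t / a)"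
proof -
  have ck: "continuous_on {0..b} k" for b using cont by (rule continuous_on_subset) auto
  have cm: "continuous_on {0..b} (\<lambda>t. t ^ q * k t ^ n)" for b q by (intro continuous_intros ck)
  have im: "(\<lambda>t. t ^ q * k t ^ n) integrable_on {0..b}" for b q by (rule integrable_continuous_interval[OF cm])
  have Apos: "A > 0"
  proof -
    have ge: "integral {0..S} (\<lambda>t. t ^ (n - 1) * k t ^ n) \<ge> 0" using nn by (intro integral_nonneg im) auto
    have "integral {0..S} (\<lambda>t. t ^ (n - 1) * k t ^ n) \<noteq> 0"
    proof
      assume "integral {0..S} (\<lambda>t. t ^ (n - 1) * k t ^ n) = 0"
      then have z: "\<forall>t\<in>{0..S}. t ^ (n - 1) * k t ^ n = 0"
        using nn by (subst (asm) integral_eq_0_iff[OF cm]) (use S in auto)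
      \<comment> \<open>At t = 0 the weight t^(n-1) may vanish and gives no information, so k is
        first seen to vanish on (0, S]; the integral of k without weight then reaches t = 0, where k
        is 1.\<close>
      have kz: "k t = 0" if t: "0 < t" "t \<le> S" for t
        using bspec[OF z, of t] t by simp
      then have "integral {0..S} k = integral {0..S} (\<lambda>_. 0)"
        by (intro integral_spike[of "{0}"]) (auto simp: kz)
      then have "\<forall>t\<in>{0..S}. k t = 0"
        using integral_eq_0_iff[OF ck, of S] S nn by auto
      then show False using k0 S by auto
    qed
    then show ?thesis using ge n unfolding A_def by simp
  qed
  define a where "a = root n A"
  have a: "a > 0" "a ^ n = A" using Apos n by (simp_all add: a_def real_root_pow_pos)
  \<comment> \<open>Both profiles vanish from \<open>S'\<close> on, so all moments can be taken over
    one interval.\<close>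
  define S' where "S' = max S a"
  have S': "a \<le> S'" "S \<le> S'" "S' > 0" using S by (auto simp: S'_def)
  have ext: "integral {0..S'} (\<lambda>t. t ^ q * k t ^ n) = integral {0..S} (\<lambda>t. t ^ q * k t ^ n)" for q
    by (rule integral_unique, rule has_integral_extend_zero, rule integrable_integral[OF im])
      (use zero n S S' in \<open>auto simp: zero_power\<close>)
  define k' where "k' t = max 0 (1 - t / a)" for t
  have ck': "continuous_on {0..b} k'" for b unfolding k'_def using a by (intro continuous_intros) auto
  have cm': "continuous_on {0..b} (\<lambda>t. t ^ q * k' t ^ n)" for b q by (intro continuous_intros ck')
  have im': "(\<lambda>t. t ^ q * k' t ^ n) integrable_on {0..b}" for b q by (rule integrable_continuous_interval[OF cm'])
  have eqA: "integral {0..S'} (\<lambda>t. t ^ (n - 1) * k t ^ n) = integral {0..S'} (\<lambda>t. t ^ (n - 1) * k' t ^ n)"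
  proof -
    have "real ((2*n) choose n) * (real n * integral {0..S'} (\<lambda>t. t ^ (n - 1) * k' t ^ n)) = A"
      unfolding k'_def a(2)[symmetric] by (rule cone_moment_lower[OF a(1) S'(1) n])
    then show ?thesis unfolding ext A_def using n by simp
  qed
  have eqB: "real ((2*n+2) choose n) * ((real n + 2) * integral {0..S'} (\<lambda>t. t ^ (n + 1) * k' t ^ n)) = a ^ (n + 2)"
    unfolding k'_def by (rule cone_moment_upper[OF a(1) S'(1) n])
  have Beq: "B = real ((2*n+2) choose n) * ((real n + 2) * integral {0..S'} (\<lambda>t. t ^ (n + 1) * k t ^ n))"
    unfolding B_def ext ..
  obtain t0 where t0: "\<And>s. \<lbrakk>0 \<le> s; s < t0\<rbrakk> \<Longrightarrow> k s \<ge> k' s" "\<And>s. \<lbrakk>0 \<le> s; t0 < s\<rbrakk> \<Longrightarrow> k s \<le> k' s" "t0 \<ge> 0"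
    unfolding k'_def by (rule single_crossing[of k S a]) (use nn k0 conc zero a(1) in blast)+
  \<comment> \<open>The factor t0^2 - t^2 changes sign together with k - k', so the product is
    nonnegative. Its t0^2 part integrates to zero, as the lower moments agree, and the rest is the
    difference of the upper moments.\<close>
  define \<phi> where "\<phi> t = (t0\<^sup>2 - t\<^sup>2) * (t ^ (n - 1) * (k t ^ n - k' t ^ n))" for t
  have \<phi>c: "continuous_on {0..S'} \<phi>" unfolding \<phi>_def by (intro continuous_intros ck ck')
  have k'nn: "k' t \<ge> 0" for t by (simp add: k'_def)
  have \<phi>nn: "\<phi> t \<ge> 0" if t: "t \<ge> 0" for t
  proof -
    consider "t < t0" | "t = t0" | "t0 < t" by linarith
    then show ?thesis
    proof cases
      case 1
      then have "k t ^ n \<ge> k' t ^ n" using t0(1)[OF t] k'nn by (intro power_mono)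
      moreover have "t\<^sup>2 \<le> t0\<^sup>2" using 1 t by (intro power_mono) auto
      ultimately show ?thesis unfolding \<phi>_def using t by (intro mult_nonneg_nonneg) auto
    next
      case 2 then show ?thesis by (simp add: \<phi>_def)
    next
      case 3
      then have "k t ^ n \<le> k' t ^ n" using t0(2)[OF t] nn[OF t] by (intro power_mono)
      moreover have "t0\<^sup>2 \<le> t\<^sup>2" using 3 t0(3) by (intro power_mono) auto
      ultimately show ?thesis unfolding \<phi>_def using t
        by (intro mult_nonpos_nonpos mult_nonneg_nonpos) auto
    qed
  qed
  have "t\<^sup>2 * t ^ (n - 1) = t ^ (n + 1)" for t :: real using n by (simp flip: power_add)
  then have \<phi>eq: "\<phi> = (\<lambda>t. t0\<^sup>2 * (t ^ (n - 1) * k t ^ n) - t0\<^sup>2 * (t ^ (n - 1) * k' t ^ n) - (t ^ (n + 1) * k t ^ n) + (t ^ (n + 1) * k' t ^ n))"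
    unfolding \<phi>_def by (auto simp: fun_eq_iff algebra_simps)
  have int\<phi>: "integral {0..S'} \<phi> = integral {0..S'} (\<lambda>t. t ^ (n + 1) * k' t ^ n) - integral {0..S'} (\<lambda>t. t ^ (n + 1) * k t ^ n)"
  proof -
    have "(\<phi> has_integral t0\<^sup>2 * integral {0..S'} (\<lambda>t. t ^ (n - 1) * k t ^ n) - t0\<^sup>2 * integral {0..S'} (\<lambda>t. t ^ (n - 1) * k' t ^ n)
       - integral {0..S'} (\<lambda>t. t ^ (n + 1) * k t ^ n) + integral {0..S'} (\<lambda>t. t ^ (n + 1) * k' t ^ n)) {0..S'}"
      unfolding \<phi>eq by (intro has_integral_add has_integral_diff has_integral_mult_right integrable_integral im im')
    then show ?thesis using eqA by (simp add: integral_unique)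
  qed
  have "integral {0..S'} \<phi> \<ge> 0" by (rule integral_nonneg[OF integrable_continuous_interval[OF \<phi>c]]) (use \<phi>nn in auto)
  then have le: "integral {0..S'} (\<lambda>t. t ^ (n + 1) * k t ^ n) \<le> integral {0..S'} (\<lambda>t. t ^ (n + 1) * k' t ^ n)"
    using int\<phi> by simp
  show ?thesis
  proof (rule that[OF a])
    show "B \<le> a ^ (n + 2)" unfolding Beq eqB[symmetric] by (intro mult_left_mono le) auto
    assume "B = a ^ (n + 2)"
    then have "integral {0..S'} \<phi> = 0" unfolding int\<phi> Beq eqB[symmetric] by simp
    then have z: "\<phi> t = 0" if "t \<in> {0..S'}" for t
      using integral_eq_0_iff[OF \<phi>c] S' \<phi>nn that by auto
    have e: "k t = k' t" if "t \<in> {0..S'} - {0, t0}" for t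
    proof -
      have "t0\<^sup>2 \<noteq> t\<^sup>2" using that t0(3) by (auto simp: power2_eq_iff)
      then have "k t ^ n = k' t ^ n" using z[of t] that by (auto simp: \<phi>_def)
      then show ?thesis using nn[of t] k'nn[of t] n that by (intro power_eq_imp_eq_base[of "k t" n "k' t"]) auto
    qed
    \<comment> \<open>The exceptional points 0 and t0 do not affect the integral of the distance,
      and continuity then gives equality there too.\<close>
    have cd: "continuous_on {0..S'} (\<lambda>t. \<bar>k t - k' t\<bar>)" by (intro continuous_intros ck ck')
    have "integral {0..S'} (\<lambda>t. \<bar>k t - k' t\<bar>) = integral {0..S'} (\<lambda>_. 0)"
      by (rule integral_spike[of "{0, t0}"]) (use e in auto)
    then have e': "k t = k' t" if "t \<in> {0..S'}" for t
      using integral_eq_0_iff[OF cd] S' that by auto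
    show "\<forall>t\<ge>0. k t = max 0 (1 - t / a)"
    proof (intro allI impI)
      fix t :: real assume t: "t \<ge> 0"
      show "k t = max 0 (1 - t / a)"
      proof (cases "t \<le> S'")
        case True then show ?thesis using e'[of t] t by (simp add: k'_def)
      next
        case False then show ?thesis using zero[of t] S' a by (simp add: field_simps)
      qed
    qed
  qed
qed


section \<open>Convexity of Ball bodies\<close>

lemma ln_weighted_le:
  fixes a b \<theta> :: real
  assumes "a > 0" "b > 0" "0 \<le> \<theta>" "\<theta> \<le> 1"
  shows "\<theta> * ln a + (1 - \<theta>) * ln b \<le> ln (\<theta> * a + (1 - \<theta>) * b)"
proof -
  define m where "m = \<theta> * a + (1 - \<theta>) * b"
  have m: "m > 0" unfolding m_def using assms
    by (cases "\<theta> = 0") (auto intro: add_pos_nonneg)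
  have le: "ln z \<le> ln m + (z / m - 1)" if "z > 0" for z
    using ln_le_minus_one[of "z / m"] that m by (simp add: ln_div)
  have "\<theta> * ln a + (1 - \<theta>) * ln b \<le> \<theta> * (ln m + (a / m - 1)) + (1 - \<theta>) * (ln m + (b / m - 1))"
    using assms le by (intro add_mono mult_left_mono) auto
  also have "\<dots> = ln m + (\<theta> * a + (1 - \<theta>) * b) / m - 1"
    by (simp add: algebra_simps add_divide_distrib diff_divide_distrib)
  also have "\<dots> = ln m" using m by (simp add: m_def)
  finally show ?thesis by (simp add: m_def)
qed

text \<open>Supporting line of z^(-p) at the mean m. With q = m / z Bernoulli's inequality bounds
  q^p from below by 1 + p (q - 1), and q + 1/q \<ge> 2 replaces q - 1 by 1 - 1/q, which is affine in
  z.\<close>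

lemma inverse_power_convex:
  fixes a b l :: real
  assumes a: "a > 0" and b: "b > 0" and l: "0 \<le> l" "l \<le> 1"
  shows "1 / (l * a + (1 - l) * b) ^ p \<le> l * (1 / a ^ p) + (1 - l) * (1 / b ^ p)"
proof -
  define m where "m = l * a + (1 - l) * b"
  have m: "m > 0" unfolding m_def using assms
    by (cases "l = 0") (auto intro: add_pos_nonneg)
  have tangent: "(1 - real p * (z / m - 1)) / m ^ p \<le> 1 / z ^ p" if z: "z > 0" for z
  proof -
    define q where "q = m / z"
    have q: "q > 0" using z m by (simp add: q_def)
    have q2: "2 \<le> q + 1 / q"
    proof -
      have "0 \<le> (q - 1)\<^sup>2 / q" using q by simp
      also have "\<dots> = q + 1 / q - 2" using q by (simp add: power2_eq_square field_simps)
      finally show ?thesis by simp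
    qed
    have "1 - real p * (1 / q - 1) \<le> 1 + real p * (q - 1)"
    proof -
      have "real p * (- (1 / q - 1)) \<le> real p * (q - 1)" using q2 by (intro mult_left_mono) auto
      then show ?thesis by (simp add: algebra_simps)
    qed
    also have "\<dots> \<le> (1 + (q - 1)) ^ p" by (rule Bernoulli_inequality) (use q in simp)
    finally have "1 - real p * (z / m - 1) \<le> m ^ p / z ^ p" by (simp add: q_def power_divide)
    then have "(1 - real p * (z / m - 1)) / m ^ p \<le> (m ^ p / z ^ p) / m ^ p" using m by (intro divide_right_mono) auto
    then show ?thesis using m by simp
  qed
  have "1 / m ^ p = (1 - real p * ((l * a + (1 - l) * b) / m - 1)) / m ^ p" using m by (simp add: m_def)
  also have "\<dots> = l * ((1 - real p * (a / m - 1)) / m ^ p) + (1 - l) * ((1 - real p * (b / m - 1)) / m ^ p)"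
    by (simp add: algebra_simps add_divide_distrib diff_divide_distrib)
  also have "\<dots> \<le> l * (1 / a ^ p) + (1 - l) * (1 / b ^ p)"
    using l tangent[OF a] tangent[OF b] by (intro add_mono mult_left_mono) auto
  finally show ?thesis by (simp add: m_def)
qed

lemma open_convex_real_interval:
  fixes S :: "real set"
  assumes S: "open S" "S \<noteq> {}" "bdd_below S" "bdd_above S"
    and conv: "\<And>a b t. \<lbrakk>a \<in> S; b \<in> S; a \<le> t; t \<le> b\<rbrakk> \<Longrightarrow> t \<in> S"
  shows "S = {Inf S<..<Sup S}"
proof (intro equalityI subsetI)
  fix t assume t: "t \<in> S"
  then obtain e where e: "e > 0" "ball t e \<subseteq> S" using S(1) open_contains_ball by blast
  have "t - e/2 \<in> S" "t + e/2 \<in> S" using e by (auto intro!: subsetD[OF e(2)] simp: dist_real_def)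
  then show "t \<in> {Inf S<..<Sup S}"
    using cInf_lower[OF _ S(3), of "t - e/2"] cSup_upper[OF _ S(4), of "t + e/2"] e by auto
next
  fix t assume "t \<in> {Inf S<..<Sup S}"
  then obtain a b where "a \<in> S" "a < t" "b \<in> S" "t < b"
    using cInf_less_iff[OF S(2,3), of t] less_cSup_iff[OF S(2,4), of t] by auto
  then show "t \<in> S" using conv[of a b t] by simp
qed

lemma nn_integral_inverse_square:
  assumes "0 < \<alpha>" "\<alpha> < \<beta>"
  shows "(\<integral>\<^sup>+t. ennreal (1 / t\<^sup>2) * indicator {\<alpha><..<\<beta>} t \<partial>lborel) = ennreal (1 / \<alpha> - 1 / \<beta>)"
proof -
  have "(\<integral>\<^sup>+t. ennreal (1 / t\<^sup>2) * indicator {\<alpha><..<\<beta>} t \<partial>lborel) = (\<integral>\<^sup>+t. ennreal (1 / t\<^sup>2) * indicator {\<alpha>..\<beta>} t \<partial>lborel)"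
  proof (rule nn_integral_cong_AE)
    show "AE t in lborel. ennreal (1 / t\<^sup>2) * indicator {\<alpha><..<\<beta>} t = ennreal (1 / t\<^sup>2) * indicator {\<alpha>..\<beta>} t"
      using AE_lborel_singleton[of \<alpha>] AE_lborel_singleton[of \<beta>]
      by eventually_elim (auto simp: indicator_def)
  qed
  also have "\<dots> = ennreal (- (1 / \<beta>) - (- (1 / \<alpha>)))"
    by (rule nn_integral_FTC_Icc)
      (use assms in \<open>auto intro!: derivative_eq_intros simp: power2_eq_square\<close>)
  finally show ?thesis by simp
qed

section \<open>Concave profiles and their moments along rays\<close>

locale concave_profile =
  fixes h :: "'a::euclidean_space \<Rightarrow> real" and R :: real and n :: nat
  assumes n: "n > 0" and nonneg: "h x \<ge> 0" and cont: "continuous_on UNIV h" and one: "h 0 = 1"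
    and concave: "\<lbrakk>h x > 0; h y > 0; 0 \<le> l; l \<le> 1\<rbrakk> \<Longrightarrow> l * h x + (1 - l) * h y \<le> h (l *\<^sub>R x + (1 - l) *\<^sub>R y)"
    and R: "R > 0" and supp: "norm x \<ge> R \<Longrightarrow> h x = 0"
begin

text \<open>Beyond R / norm x the profile vanishes on the ray, so this is the moment over the whole
  half-line. At x = 0 division by zero collapses the interval to a point and the value is 0.\<close>

definition mom :: "nat \<Rightarrow> 'a \<Rightarrow> real" where
  "mom q x = integral {0..R / norm x} (\<lambda>t. t ^ q * h (t *\<^sub>R x) ^ n)"

lemma mom_0 [simp]: "mom q 0 = 0"
  by (simp add: mom_def)

lemma cont_ray: "continuous_on A (\<lambda>t. h (t *\<^sub>R x))"
  by (intro continuous_on_compose2[OF cont] continuous_intros) auto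

lemma ray_zero: "x \<noteq> 0 \<Longrightarrow> t \<ge> R / norm x \<Longrightarrow> h (t *\<^sub>R x) = 0"
proof -
  assume x: "x \<noteq> 0" and t: "t \<ge> R / norm x"
  then have "t * norm x \<ge> R" by (simp add: divide_le_eq)
  moreover have "t \<ge> 0" using t R x by (meson divide_nonneg_nonneg less_imp_le norm_ge_zero order_trans)
  ultimately show ?thesis by (intro supp) simp
qed

lemma h_measurable [measurable]: "h \<in> borel_measurable borel"
  by (rule borel_measurable_continuous_onI[OF cont])

lemma mom_nn:
  assumes x: "x \<noteq> 0"
  shows "(\<integral>\<^sup>+t. ennreal (t ^ q * h (t *\<^sub>R x) ^ n) * indicator {0..} t \<partial>lborel) = ennreal (mom q x)"
proof -
  have c: "continuous_on {0..R / norm x} (\<lambda>t. t ^ q * h (t *\<^sub>R x) ^ n)" by (intro continuous_intros cont_ray)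
  have "((\<lambda>t. t ^ q * h (t *\<^sub>R x) ^ n) has_integral mom q x) {0..R / norm x}"
    unfolding mom_def by (rule integrable_integral[OF integrable_continuous_interval[OF c]])
  moreover have "(\<lambda>t. indicator {0..R / norm x} t * (t ^ q * h (t *\<^sub>R x) ^ n))
      = (\<lambda>t. if t \<in> {0..R / norm x} then t ^ q * h (t *\<^sub>R x) ^ n else 0)" by (auto simp: indicator_def)
  ultimately have "((\<lambda>t. indicator {0..R / norm x} t * (t ^ q * h (t *\<^sub>R x) ^ n)) has_integral mom q x) UNIV"
    by (simp only: has_integral_restrict_UNIV)
  then have "(\<integral>\<^sup>+t. ennreal (indicator {0..R / norm x} t * (t ^ q * h (t *\<^sub>R x) ^ n)) \<partial>lborel) = ennreal (mom q x)"
    by (intro nn_integral_has_integral_lborel) (auto simp: indicator_def nonneg)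
  moreover have "ennreal (t ^ q * h (t *\<^sub>R x) ^ n) * indicator {0..} t = ennreal (indicator {0..R / norm x} t * (t ^ q * h (t *\<^sub>R x) ^ n))" for t
    using ray_zero[OF x, of t] n by (auto simp: indicator_def zero_power)
  ultimately show ?thesis by simp
qed

lemma ray_positive: "\<exists>d>0. \<forall>t. 0 \<le> t \<and> t < d \<longrightarrow> h (t *\<^sub>R x) > 0"
proof -
  have "((\<lambda>t. h (t *\<^sub>R x)) \<longlongrightarrow> h (0 *\<^sub>R x)) (at 0)"
    using cont_ray[of UNIV x] unfolding continuous_on_def by (rule bspec) simp
  then have "\<forall>\<^sub>F t in at 0. h (t *\<^sub>R x) > 0" by (rule order_tendstoD) (simp add: one)
  then obtain d where d: "d > 0" "\<And>t. t \<noteq> 0 \<Longrightarrow> dist t 0 < d \<Longrightarrow> h (t *\<^sub>R x) > 0"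
    unfolding eventually_at by blast
  have "h (t *\<^sub>R x) > 0" if "0 \<le> t" "t < d" for t
    using d(2)[of t] that one by (cases "t = 0") (auto simp: dist_real_def)
  then show ?thesis using d(1) by blast
qed

lemma mom_pos:
  assumes x: "x \<noteq> 0" shows "mom q x > 0"
proof -
  have c: "continuous_on {0..R / norm x} (\<lambda>t. t ^ q * h (t *\<^sub>R x) ^ n)" by (intro continuous_intros cont_ray)
  have S: "R / norm x > 0" using R x by simp
  have "mom q x \<ge> 0" unfolding mom_def
    by (rule integral_nonneg[OF integrable_continuous_interval[OF c]]) (auto simp: nonneg)
  moreover have "mom q x \<noteq> 0"
  proof
    assume "mom q x = 0"
    then have z: "t ^ q * h (t *\<^sub>R x) ^ n = 0" if "t \<in> {0..R / norm x}" for t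
      using integral_eq_0_iff[OF c] S that unfolding mom_def by (auto simp: nonneg)
    obtain d where d: "d > 0" "\<And>t. 0 \<le> t \<Longrightarrow> t < d \<Longrightarrow> h (t *\<^sub>R x) > 0" using ray_positive by blast
    define t where "t = min (d/2) (R / norm x)"
    have "t \<le> d/2" unfolding t_def by (rule min.cobounded1)
    then have "t > 0" "t < d" "t \<in> {0..R / norm x}" using d S by (auto simp: t_def)
    then show False using z[of t] d(2)[of t] by auto
  qed
  ultimately show ?thesis by simp
qed

lemma mom_nonneg: "mom q x \<ge> 0"
  using mom_pos[of x q] by (cases "x = 0") auto

lemma mom_scale:
  assumes r: "r > 0" shows "mom q (r *\<^sub>R x) = mom q x / r ^ (q + 1)"
proof (cases "x = 0")
  case False
  then have x: "x \<noteq> 0" "r *\<^sub>R x \<noteq> 0" using r by auto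
  have "ennreal (mom q x) = (\<integral>\<^sup>+t. ennreal (t ^ q * h (t *\<^sub>R x) ^ n) * indicator {0..} t \<partial>lborel)"
    using mom_nn[OF x(1)] by simp
  also have "\<dots> = ennreal \<bar>r\<bar> * (\<integral>\<^sup>+t. ennreal ((0 + r * t) ^ q * h ((0 + r * t) *\<^sub>R x) ^ n) * indicator {0..} (0 + r * t) \<partial>lborel)"
    by (rule nn_integral_real_affine) (use r in auto)
  also have "(\<integral>\<^sup>+t. ennreal ((0 + r * t) ^ q * h ((0 + r * t) *\<^sub>R x) ^ n) * indicator {0..} (0 + r * t) \<partial>lborel)
     = (\<integral>\<^sup>+t. ennreal (r ^ q) * (ennreal (t ^ q * h (t *\<^sub>R r *\<^sub>R x) ^ n) * indicator {0..} t) \<partial>lborel)"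
    by (intro nn_integral_cong)
      (use r in \<open>auto simp: indicator_def power_mult_distrib ennreal_mult'[symmetric] zero_le_mult_iff mult_ac\<close>)
  also have "\<dots> = ennreal (r ^ q) * ennreal (mom q (r *\<^sub>R x))"
    unfolding mom_nn[OF x(2), symmetric] by (rule nn_integral_cmult) simp
  also have "ennreal \<bar>r\<bar> * (ennreal (r ^ q) * ennreal (mom q (r *\<^sub>R x))) = ennreal (r ^ (q + 1) * mom q (r *\<^sub>R x))"
    using r by (simp add: ennreal_mult'[symmetric] mult.assoc)
  finally have "mom q x = r ^ (q + 1) * mom q (r *\<^sub>R x)"
    using r mom_nonneg by (simp add: ennreal_inj)
  then show ?thesis using r by simp
qed simp

text \<open>The exponent is two more than in the weight t^(n+1), so the moment is the integral of
  this function against dt / t^2, which is Lebesgue measure in the variable 1/t.\<close>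

definition \<phi> :: "'a \<Rightarrow> real \<Rightarrow> real" where
  "\<phi> x t = t ^ (n + 3) * h (t *\<^sub>R x) ^ n"

definition L :: "'a \<Rightarrow> real \<Rightarrow> real set" where
  "L x c = {t. t > 0 \<and> \<phi> x t > c}"

text \<open>Exactly the nonnegative levels below the peak have nonempty level sets. It is
  homogeneous of degree -(n+3), so two directions can be rescaled to share it.\<close>

definition peak :: "'a \<Rightarrow> real" where
  "peak x = (SUP t\<in>{0..}. \<phi> x t)"

lemma cont_\<phi>: "continuous_on A (\<phi> x)"
  unfolding \<phi>_def by (intro continuous_intros cont_ray)

lemma \<phi>_measurable [measurable]: "\<phi> x \<in> borel_measurable borel"
  by (rule borel_measurable_continuous_onI[OF cont_\<phi>])

lemma \<phi>_nonneg: "t \<ge> 0 \<Longrightarrow> \<phi> x t \<ge> 0"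
  by (simp add: \<phi>_def nonneg)

lemma \<phi>_0: "\<phi> x 0 = 0"
  by (simp add: \<phi>_def)

lemma \<phi>_bdd: assumes x: "x \<noteq> 0" shows "bdd_above (\<phi> x ` {0..})"
proof -
  have "compact (\<phi> x ` {0..R / norm x})" by (intro compact_continuous_image cont_\<phi> compact_Icc)
  then obtain B where B: "\<And>t. t \<in> {0..R / norm x} \<Longrightarrow> \<phi> x t \<le> B"
    using compact_imp_bounded bounded_imp_bdd_above unfolding bdd_above_def by (metis image_eqI)
  have "\<phi> x t \<le> max B 0" if "t \<ge> 0" for t
  proof (cases "t \<le> R / norm x")
    case True then show ?thesis using B[of t] that by auto
  next
    case False then show ?thesis using ray_zero[OF x, of t] n by (simp add: \<phi>_def zero_power)
  qed
  then show ?thesis by (intro bdd_aboveI[of _ "max B 0"]) auto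
qed

lemma L_nonempty_iff:
  assumes x: "x \<noteq> 0" and c: "c \<ge> 0" shows "L x c \<noteq> {} \<longleftrightarrow> c < peak x"
proof -
  have "c < peak x \<longleftrightarrow> (\<exists>t\<in>{0..}. c < \<phi> x t)" unfolding peak_def
    by (rule less_cSUP_iff[OF _ \<phi>_bdd[OF x]]) auto
  also have "\<dots> \<longleftrightarrow> L x c \<noteq> {}" using c \<phi>_0[of x] unfolding L_def
    by (auto, metis less_eq_real_def not_less)
  finally show ?thesis by simp
qed

lemma peak_pos: assumes x: "x \<noteq> 0" shows "peak x > 0"
proof -
  obtain d where d: "d > 0" "\<And>t. 0 \<le> t \<Longrightarrow> t < d \<Longrightarrow> h (t *\<^sub>R x) > 0" using ray_positive by blast
  then have "d/2 \<in> L x 0" by (simp add: L_def \<phi>_def)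
  then show ?thesis using L_nonempty_iff[OF x, of 0] by auto
qed

lemma \<phi>_scale: "r > 0 \<Longrightarrow> \<phi> (r *\<^sub>R x) t = \<phi> x (r * t) / r ^ (n + 3)"
  by (simp add: \<phi>_def power_mult_distrib mult.commute)

lemma peak_scale:
  assumes r: "r > 0" and x: "x \<noteq> 0" shows "peak (r *\<^sub>R x) = peak x / r ^ (n + 3)"
proof -
  have le: "peak (r *\<^sub>R x) \<le> peak x / r ^ (n + 3)" if r: "r > 0" and x: "x \<noteq> 0" for r x
    unfolding peak_def
  proof (rule cSUP_least)
    fix t :: real assume t: "t \<in> {0..}"
    have "\<phi> x (r * t) \<le> (SUP t\<in>{0..}. \<phi> x t)" by (rule cSUP_upper[OF _ \<phi>_bdd[OF x]]) (use r t in auto)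
    then show "\<phi> (r *\<^sub>R x) t \<le> (SUP t\<in>{0..}. \<phi> x t) / r ^ (n + 3)"
      using r by (simp add: \<phi>_scale divide_right_mono)
  qed simp
  have "peak ((1 / r) *\<^sub>R (r *\<^sub>R x)) \<le> peak (r *\<^sub>R x) / (1 / r) ^ (n + 3)"
    by (rule le) (use r x in auto)
  then have "peak x \<le> peak (r *\<^sub>R x) * r ^ (n + 3)" using r by (simp add: power_one_over)
  then show ?thesis using le[OF r x] r by (intro antisym) (simp_all add: pos_divide_le_eq)
qed

text \<open>In the variable \<open>1 / t\<close> the super level sets combine convexly, because \<open>h\<close> and the logarithm
  are concave.\<close>

lemma L_harmonic:
  assumes t: "t1 \<in> L x c" "t2 \<in> L y c" and c: "c > 0" and l: "0 \<le> l" "l \<le> 1"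
  shows "1 / (l / t1 + (1 - l) / t2) \<in> L (l *\<^sub>R x + (1 - l) *\<^sub>R y) c"
proof -
  have t0: "t1 > 0" "t2 > 0" "\<phi> x t1 > c" "\<phi> y t2 > c" using t by (auto simp: L_def)
  define A where "A = h (t1 *\<^sub>R x)"
  define B where "B = h (t2 *\<^sub>R y)"
  have AB: "A > 0" "B > 0"
    using t0 c n nonneg[of "t1 *\<^sub>R x"] nonneg[of "t2 *\<^sub>R y"] unfolding A_def B_def \<phi>_def
    by (metis less_eq_real_def mult_zero_right order_less_irrefl order_less_trans power_eq_0_iff)+
  define t where "t = 1 / (l / t1 + (1 - l) / t2)"
  have den: "l / t1 + (1 - l) / t2 > 0" using l t0
    by (cases "l = 0") (auto intro: add_pos_nonneg)
  have tpos: "t > 0" using den by (simp add: t_def)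
  \<comment> \<open>With this weight t is the \<theta>-combination of t1 and t2, and at the same
    time t (l x + (1 - l) y) is the \<theta>-combination of t1 x and t2 y.\<close>
  define \<theta> where "\<theta> = l * t / t1"
  have \<theta>1: "1 - \<theta> = (1 - l) * t / t2"
  proof -
    have "t * (l / t1 + (1 - l) / t2) = 1" using den by (simp add: t_def)
    then show ?thesis by (simp add: \<theta>_def algebra_simps)
  qed
  have \<theta>: "0 \<le> \<theta>" "\<theta> \<le> 1"
  proof -
    show "0 \<le> \<theta>" using l tpos t0 by (simp add: \<theta>_def)
    have "0 \<le> 1 - \<theta>" unfolding \<theta>1 using l tpos t0 by simp
    then show "\<theta> \<le> 1" by simp
  qed
  have e: "\<theta> * t1 = l * t" "(1 - \<theta>) * t2 = (1 - l) * t" unfolding \<theta>1 using t0 by (simp_all add: \<theta>_def)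
  have teq: "t = \<theta> * t1 + (1 - \<theta>) * t2" unfolding e by (simp add: algebra_simps)
  have veq: "t *\<^sub>R (l *\<^sub>R x + (1 - l) *\<^sub>R y) = \<theta> *\<^sub>R (t1 *\<^sub>R x) + (1 - \<theta>) *\<^sub>R (t2 *\<^sub>R y)"
    unfolding scaleR_scaleR e by (simp add: scaleR_add_right mult.commute)
  define H where "H = h (t *\<^sub>R (l *\<^sub>R x + (1 - l) *\<^sub>R y))"
  have HAB: "\<theta> * A + (1 - \<theta>) * B \<le> H" unfolding H_def veq A_def B_def
    by (rule concave) (use AB \<theta> in \<open>auto simp: A_def B_def\<close>)
  have posAB: "\<theta> * A + (1 - \<theta>) * B > 0" using AB \<theta> by (cases "\<theta> = 0") (auto intro: add_pos_nonneg)
  then have H: "H > 0" using HAB by simp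
  have lnt: "\<theta> * ln t1 + (1 - \<theta>) * ln t2 \<le> ln t" unfolding teq using t0 \<theta> by (intro ln_weighted_le)
  have lnH: "\<theta> * ln A + (1 - \<theta>) * ln B \<le> ln H"
    using ln_weighted_le[OF AB \<theta>] HAB posAB H by (meson ln_le_cancel_iff order_trans)
  have ln\<phi>: "ln (s ^ (n + 3) * z ^ n) = (real n + 3) * ln s + real n * ln z" if "s > 0" "z > 0" for s z :: real
    using that by (simp add: ln_mult ln_realpow)
  have "ln c < ln (\<phi> x t1)" "ln c < ln (\<phi> y t2)" using c t0 by auto
  then have "ln c < \<theta> * ln (\<phi> x t1) + (1 - \<theta>) * ln (\<phi> y t2)"
  proof (cases "\<theta> = 0")
    case False
    then have "\<theta> * ln c < \<theta> * ln (\<phi> x t1)" using \<theta> \<open>ln c < ln (\<phi> x t1)\<close> by (intro mult_strict_left_mono) auto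
    moreover have "(1 - \<theta>) * ln c \<le> (1 - \<theta>) * ln (\<phi> y t2)" using \<theta> \<open>ln c < ln (\<phi> y t2)\<close> by (intro mult_left_mono) auto
    ultimately show ?thesis by (simp add: algebra_simps)
  qed simp
  also have "\<dots> = (real n + 3) * (\<theta> * ln t1 + (1 - \<theta>) * ln t2) + real n * (\<theta> * ln A + (1 - \<theta>) * ln B)"
    unfolding \<phi>_def A_def[symmetric] B_def[symmetric] ln\<phi>[OF t0(1) AB(1)] ln\<phi>[OF t0(2) AB(2)] by (simp add: algebra_simps)
  also have "\<dots> \<le> (real n + 3) * ln t + real n * ln H" by (intro add_mono mult_left_mono lnt lnH) auto
  also have "\<dots> = ln (t ^ (n + 3) * H ^ n)" using ln\<phi>[OF tpos H] by simp
  finally have "c < t ^ (n + 3) * H ^ n" using c tpos H by (subst (asm) ln_less_cancel_iff) auto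
  then have "t \<in> L (l *\<^sub>R x + (1 - l) *\<^sub>R y) c" using tpos unfolding H_def L_def \<phi>_def by simp
  then show ?thesis by (simp only: t_def)
qed

text \<open>\<open>L_harmonic\<close> with both points equal shows that every number between two
  members is a member. The set keeps away from 0 because the function vanishes there, and from
  infinity because the profile has bounded support.\<close>

lemma L_interval:
  assumes x: "x \<noteq> 0" and c: "c > 0" and ne: "L x c \<noteq> {}"
  obtains \<alpha> \<beta> where "0 < \<alpha>" "\<alpha> < \<beta>" "L x c = {\<alpha><..<\<beta>}"
proof -
  have eqL: "L x c = {0<..} \<inter> {t. c < \<phi> x t}" by (auto simp: L_def)
  have o: "open (L x c)" unfolding eqL by (intro open_Int open_greaterThan open_Collect_less cont_\<phi> continuous_intros)
  have "((\<phi> x) \<longlongrightarrow> \<phi> x 0) (at 0)" using cont_\<phi>[of UNIV x] unfolding continuous_on_def by (rule bspec) simp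
  then have "\<forall>\<^sub>F t in at 0. \<phi> x t < c" by (rule order_tendstoD) (use c \<phi>_0 in simp)
  then obtain d where d: "d > 0" "\<And>t. t \<noteq> 0 \<Longrightarrow> dist t 0 < d \<Longrightarrow> \<phi> x t < c"
    unfolding eventually_at by blast
  have lb: "d \<le> t" if "t \<in> L x c" for t
    using that d(2)[of t] unfolding L_def by (force simp: dist_real_def)
  have ub: "t \<le> R / norm x" if t: "t \<in> L x c" for t
  proof (rule ccontr)
    assume "\<not> t \<le> R / norm x"
    then have "h (t *\<^sub>R x) = 0" using ray_zero[OF x, of t] by simp
    then show False using t c n by (simp add: L_def \<phi>_def zero_power)
  qed
  have conv: "t \<in> L x c" if ab: "a \<in> L x c" "b \<in> L x c" and t: "a \<le> t" "t \<le> b" for a b t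
  proof (cases "a = b")
    case False
    have a0: "a > 0" "b > 0" "t > 0" using ab t by (auto simp: L_def)
    have "a < b" using False t by simp
    then have iv: "1 / b \<le> 1 / t" "1 / t \<le> 1 / a" "1 / b < 1 / a"
      using a0 t frac_less2[of 1 1 a b] by (auto simp: frac_le)
    \<comment> \<open>The solution of l/a + (1 - l)/b = 1/t.\<close>
    define l where "l = (1 / t - 1 / b) / (1 / a - 1 / b)"
    have l: "0 \<le> l" using iv by (simp add: l_def)
    have l1: "l \<le> 1" unfolding l_def by (subst pos_divide_le_eq) (use iv in auto)
    have "N / D * D = N" if "0 < D" for N D :: real using that by simp
    from this[of "1 / a - 1 / b" "1 / t - 1 / b"] have "l * (1 / a - 1 / b) = 1 / t - 1 / b"
      unfolding l_def using iv(3) by (simp only: diff_gt_0_iff_gt)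
    then have "l / a + (1 - l) / b = 1 / t" by (simp add: algebra_simps diff_divide_distrib)
    then have "1 / (l / a + (1 - l) / b) = t" by simp
    moreover have "l *\<^sub>R x + (1 - l) *\<^sub>R x = x" by (simp add: scaleR_left_distrib[symmetric])
    ultimately show ?thesis using L_harmonic[OF ab c l l1] by simp
  qed (use that in auto)
  have bb: "bdd_below (L x c)" "bdd_above (L x c)" by (rule bdd_belowI, erule lb) (rule bdd_aboveI, erule ub)
  have eq: "L x c = {Inf (L x c)<..<Sup (L x c)}"
    by (rule open_convex_real_interval[OF o ne bb]) (use conv in blast)
  have "d \<le> Inf (L x c)" using ne lb by (intro cInf_greatest) auto
  then have "0 < Inf (L x c)" using d by simp
  moreover have "Inf (L x c) < Sup (L x c)" using eq ne by auto
  ultimately show ?thesis using that eq by blast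
qed

text \<open>The length of the level set in the variable 1/t.\<close>

definition \<nu> :: "'a \<Rightarrow> real \<Rightarrow> ennreal" where
  "\<nu> x c = (\<integral>\<^sup>+t. ennreal (1 / t\<^sup>2) * indicator (L x c) t \<partial>lborel)"

lemma mom_layer_cake:
  assumes x: "x \<noteq> 0"
  shows "ennreal (mom (n + 1) x) = (\<integral>\<^sup>+c. \<nu> x c * indicator {0<..} c \<partial>lborel)"
proof -
  have "ennreal (mom (n + 1) x) = (\<integral>\<^sup>+t. ennreal (t ^ (n + 1) * h (t *\<^sub>R x) ^ n) * indicator {0..} t \<partial>lborel)"
    by (rule mom_nn[OF x, symmetric])
  also have "\<dots> = (\<integral>\<^sup>+t. (\<integral>\<^sup>+c. (if 0 < t \<and> 0 < c \<and> c < \<phi> x t then ennreal (1 / t\<^sup>2) else 0) \<partial>lborel) \<partial>lborel)"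
  proof (rule nn_integral_cong)
    fix t :: real
    show "ennreal (t ^ (n + 1) * h (t *\<^sub>R x) ^ n) * indicator {0..} t = (\<integral>\<^sup>+c. (if 0 < t \<and> 0 < c \<and> c < \<phi> x t then ennreal (1 / t\<^sup>2) else 0) \<partial>lborel)"
    proof (cases "t > 0")
      case True
      have "(\<integral>\<^sup>+c. (if 0 < t \<and> 0 < c \<and> c < \<phi> x t then ennreal (1 / t\<^sup>2) else 0) \<partial>lborel)
         = (\<integral>\<^sup>+c. ennreal (1 / t\<^sup>2) * indicator {0<..<\<phi> x t} c \<partial>lborel)"
        by (intro nn_integral_cong) (use True in \<open>auto simp: indicator_def\<close>)
      also have "\<dots> = ennreal (1 / t\<^sup>2) * ennreal (\<phi> x t)"
        using \<phi>_nonneg[of t x] True by (subst nn_integral_cmult_indicator) auto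
      also have "\<dots> = ennreal (1 / t\<^sup>2 * \<phi> x t)" using \<phi>_nonneg[of t x] True by (intro ennreal_mult[symmetric]) auto
      also have "1 / t\<^sup>2 * \<phi> x t = t ^ (n + 1) * h (t *\<^sub>R x) ^ n"
        using True by (simp add: \<phi>_def power2_eq_square numeral_3_eq_3)
      finally show ?thesis using True by simp
    next
      case False
      then show ?thesis by (cases "t = 0") auto
    qed
  qed
  also have "\<dots> = (\<integral>\<^sup>+c. (\<integral>\<^sup>+t. (if 0 < t \<and> 0 < c \<and> c < \<phi> x t then ennreal (1 / t\<^sup>2) else 0) \<partial>lborel) \<partial>lborel)"
    by (rule lborel_pair.Fubini'[symmetric]) simp
  also have "\<dots> = (\<integral>\<^sup>+c. \<nu> x c * indicator {0<..} c \<partial>lborel)"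
  proof (rule nn_integral_cong)
    fix c :: real
    show "(\<integral>\<^sup>+t. (if 0 < t \<and> 0 < c \<and> c < \<phi> x t then ennreal (1 / t\<^sup>2) else 0) \<partial>lborel) = \<nu> x c * indicator {0<..} c"
    proof (cases "c > 0")
      case True
      have "(\<integral>\<^sup>+t. (if 0 < t \<and> 0 < c \<and> c < \<phi> x t then ennreal (1 / t\<^sup>2) else 0) \<partial>lborel) = \<nu> x c"
        unfolding \<nu>_def by (intro nn_integral_cong) (use True in \<open>auto simp: L_def indicator_def\<close>)
      then show ?thesis using True by simp
    qed simp
  qed
  finally show ?thesis .
qed

text \<open>In the variable 1/t, \<open>L_harmonic\<close> says that the level set at the mean point
  contains the convex combination of the other two; these are intervals, so lengths combine. Equal
  peaks make the two level sets empty at the same levels, as the combination needs a point of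
  each.\<close>

lemma \<nu>_concave:
  assumes x: "x \<noteq> 0" "y \<noteq> 0" and l: "0 \<le> l" "l \<le> 1" and m: "l *\<^sub>R x + (1 - l) *\<^sub>R y \<noteq> 0"
    and c: "c > 0" and peak: "peak x = peak y"
  shows "ennreal l * \<nu> x c + ennreal (1 - l) * \<nu> y c \<le> \<nu> (l *\<^sub>R x + (1 - l) *\<^sub>R y) c"
proof (cases "c < peak x")
  case False
  then have "L x c = {}" "L y c = {}" using L_nonempty_iff[OF x(1), of c] L_nonempty_iff[OF x(2), of c] c peak by auto
  then show ?thesis by (simp add: \<nu>_def)
next
  case True
  let ?m = "l *\<^sub>R x + (1 - l) *\<^sub>R y"
  have ne: "L x c \<noteq> {}" "L y c \<noteq> {}" using True L_nonempty_iff[OF x(1), of c] L_nonempty_iff[OF x(2), of c] c peak by auto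
  obtain a b where ab: "0 < a" "a < b" "L x c = {a<..<b}" by (rule L_interval[OF x(1) c ne(1)])
  obtain a' b' where ab': "0 < a'" "a' < b'" "L y c = {a'<..<b'}" by (rule L_interval[OF x(2) c ne(2)])
  have "L ?m c \<noteq> {}" using ne L_harmonic[OF _ _ c l] by blast
  then obtain \<alpha> \<beta> where \<alpha>\<beta>: "0 < \<alpha>" "\<alpha> < \<beta>" "L ?m c = {\<alpha><..<\<beta>}" by (rule L_interval[OF m c])
  have inm: "1 / \<beta> \<le> l / t1 + (1 - l) / t2" "l / t1 + (1 - l) / t2 \<le> 1 / \<alpha>" if t: "t1 \<in> {a<..<b}" "t2 \<in> {a'<..<b'}" for t1 t2
  proof -
    have q: "1 / (l / t1 + (1 - l) / t2) \<in> {\<alpha><..<\<beta>}" using L_harmonic[of t1 x c t2 y, OF _ _ c l] t ab(3) ab'(3) \<alpha>\<beta>(3) by simp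
    then have "l / t1 + (1 - l) / t2 > 0" using \<alpha>\<beta>(1) by (metis greaterThanLessThan_iff order_less_trans zero_less_divide_1_iff)
    then show "1 / \<beta> \<le> l / t1 + (1 - l) / t2" "l / t1 + (1 - l) / t2 \<le> 1 / \<alpha>"
      using q \<alpha>\<beta> by (auto simp: field_simps)
  qed
  \<comment> \<open>The intervals are open, so the inequality between their ends is the limit of
    inequalities between interior points.\<close>
  have up: "l / a + (1 - l) / a' \<le> 1 / \<alpha>"
  proof (rule tendsto_upperbound)
    show "((\<lambda>e. l / (a + e) + (1 - l) / (a' + e)) \<longlongrightarrow> l / a + (1 - l) / a') (at_right 0)"
      using ab ab' by (auto intro!: tendsto_eq_intros)
    show "\<forall>\<^sub>F e in at_right 0. l / (a + e) + (1 - l) / (a' + e) \<le> 1 / \<alpha>"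
      unfolding eventually_at_right_field by (rule exI[of _ "min (b - a) (b' - a')"]) (use ab ab' in \<open>auto intro!: inm\<close>)
  qed simp
  have low: "1 / \<beta> \<le> l / b + (1 - l) / b'"
  proof (rule tendsto_lowerbound)
    show "((\<lambda>e. l / (b - e) + (1 - l) / (b' - e)) \<longlongrightarrow> l / b + (1 - l) / b') (at_right 0)"
      using ab ab' by (auto intro!: tendsto_eq_intros)
    show "\<forall>\<^sub>F e in at_right 0. 1 / \<beta> \<le> l / (b - e) + (1 - l) / (b' - e)"
      unfolding eventually_at_right_field by (rule exI[of _ "min (b - a) (b' - a')"]) (use ab ab' in \<open>auto intro!: inm\<close>)
  qed simp
  have pos: "1 / a - 1 / b \<ge> 0" "1 / a' - 1 / b' \<ge> 0" using ab ab' by (auto simp: frac_le)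
  have "ennreal l * \<nu> x c + ennreal (1 - l) * \<nu> y c = ennreal (l * (1 / a - 1 / b) + (1 - l) * (1 / a' - 1 / b'))"
    unfolding \<nu>_def ab(3) ab'(3) nn_integral_inverse_square[OF ab(1,2)] nn_integral_inverse_square[OF ab'(1,2)]
    using l pos by (simp add: ennreal_mult'[symmetric] ennreal_plus[symmetric] del: ennreal_plus)
  also have "\<dots> \<le> ennreal (1 / \<alpha> - 1 / \<beta>)" using up low by (intro ennreal_leI) (simp add: algebra_simps)
  also have "\<dots> = \<nu> ?m c" unfolding \<nu>_def \<alpha>\<beta>(3) nn_integral_inverse_square[OF \<alpha>\<beta>(1,2)] ..
  finally show ?thesis .
qed

lemma mom_concave:
  assumes x: "x \<noteq> 0" "y \<noteq> 0" and l: "0 \<le> l" "l \<le> 1" and m: "l *\<^sub>R x + (1 - l) *\<^sub>R y \<noteq> 0"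
    and peak: "peak x = peak y"
  shows "l * mom (n + 1) x + (1 - l) * mom (n + 1) y \<le> mom (n + 1) (l *\<^sub>R x + (1 - l) *\<^sub>R y)"
proof -
  have meas: "(\<lambda>c. \<nu> z c * indicator {0<..} c) \<in> borel_measurable lborel" for z
  proof -
    have "(\<lambda>c. (\<integral>\<^sup>+t. (if 0 < t \<and> c < \<phi> z t then ennreal (1 / t\<^sup>2) else 0) \<partial>lborel) * indicator {0<..} c) \<in> borel_measurable lborel"
      by measurable
    moreover have "\<nu> z c = (\<integral>\<^sup>+t. (if 0 < t \<and> c < \<phi> z t then ennreal (1 / t\<^sup>2) else 0) \<partial>lborel)" for c
      unfolding \<nu>_def by (intro nn_integral_cong) (auto simp: L_def indicator_def)
    ultimately show ?thesis by simp
  qed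
  have "ennreal (l * mom (n + 1) x + (1 - l) * mom (n + 1) y) = ennreal l * ennreal (mom (n + 1) x) + ennreal (1 - l) * ennreal (mom (n + 1) y)"
    using l mom_nonneg by (simp add: ennreal_mult' ennreal_plus)
  also have "\<dots> = (\<integral>\<^sup>+c. ennreal l * (\<nu> x c * indicator {0<..} c) + ennreal (1 - l) * (\<nu> y c * indicator {0<..} c) \<partial>lborel)"
    unfolding mom_layer_cake[OF x(1)] mom_layer_cake[OF x(2)] using meas
    by (subst nn_integral_add) (auto simp: nn_integral_cmult)
  also have "\<dots> \<le> (\<integral>\<^sup>+c. \<nu> (l *\<^sub>R x + (1 - l) *\<^sub>R y) c * indicator {0<..} c \<partial>lborel)"
    by (intro nn_integral_mono) (use \<nu>_concave[OF x l m _ peak] in \<open>auto simp: indicator_def\<close>)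
  also have "\<dots> = ennreal (mom (n + 1) (l *\<^sub>R x + (1 - l) *\<^sub>R y))" by (rule mom_layer_cake[OF m, symmetric])
  finally show ?thesis using mom_nonneg by (subst (asm) ennreal_le_iff) auto
qed

section \<open>The Minkowski gauge of the Ball body\<close>

definition ball_gauge :: "'a \<Rightarrow> real" where
  "ball_gauge x = 1 / root (n + 2) ((real n + 2) * mom (n + 1) x)"

lemma ball_gauge_0 [simp]: "ball_gauge 0 = 0"
  by (simp add: ball_gauge_def)

lemma ball_gauge_pos: "x \<noteq> 0 \<Longrightarrow> ball_gauge x > 0"
  using mom_pos[of x "n + 1"] by (simp add: ball_gauge_def)

lemma ball_gauge_nonneg: "ball_gauge x \<ge> 0"
  using ball_gauge_pos[of x] by (cases "x = 0") auto

lemma ball_gauge_power: "1 / ball_gauge x ^ (n + 2) = (real n + 2) * mom (n + 1) x"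
  using mom_nonneg[of "n + 1" x] unfolding ball_gauge_def power_divide
  by (subst real_root_pow_pos2) auto

lemma ball_gauge_scale: "r \<ge> 0 \<Longrightarrow> ball_gauge (r *\<^sub>R x) = r * ball_gauge x"
proof (cases "r = 0")
  case False
  assume "r \<ge> 0"
  with False have r: "r > 0" by simp
  have "mom (n + 1) (r *\<^sub>R x) = mom (n + 1) x / r ^ (n + 2)" using mom_scale[OF r, of "n + 1" x] by simp
  then have e: "(real n + 2) * mom (n + 1) (r *\<^sub>R x) = ((real n + 2) * mom (n + 1) x) / r ^ (n + 2)" by simp
  have "root (n + 2) (r ^ (n + 2)) = r" by (rule real_root_power_cancel) (use r in auto)
  then show ?thesis unfolding ball_gauge_def e real_root_divide by simp
qed simp

text \<open>Up to a constant the moment is the power -(n+2) of the gauge. Convexity of z^(-(n+2))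
  bounds the value at the averaged gauge by the averaged moments, and these lie below the moment at
  the mean point.\<close>

lemma ball_gauge_triangle_normalized:
  assumes x: "x \<noteq> 0" "y \<noteq> 0" and l: "0 \<le> l" "l \<le> 1" and peak: "peak x = peak y"
  shows "ball_gauge (l *\<^sub>R x + (1 - l) *\<^sub>R y) \<le> l * ball_gauge x + (1 - l) * ball_gauge y"
proof (cases "l *\<^sub>R x + (1 - l) *\<^sub>R y = 0")
  case True
  then show ?thesis using l ball_gauge_nonneg by simp
next
  case False
  let ?m = "l *\<^sub>R x + (1 - l) *\<^sub>R y"
  have "1 / (l * ball_gauge x + (1 - l) * ball_gauge y) ^ (n + 2) \<le> l * (1 / ball_gauge x ^ (n + 2)) + (1 - l) * (1 / ball_gauge y ^ (n + 2))"
    by (rule inverse_power_convex) (use ball_gauge_pos x l in auto)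
  also have "\<dots> = (real n + 2) * (l * mom (n + 1) x + (1 - l) * mom (n + 1) y)" unfolding ball_gauge_power by (simp add: algebra_simps)
  also have "\<dots> \<le> (real n + 2) * mom (n + 1) ?m" by (intro mult_left_mono mom_concave x l False peak) simp
  also have "\<dots> = 1 / ball_gauge ?m ^ (n + 2)" by (rule ball_gauge_power[symmetric])
  finally have le: "1 / (l * ball_gauge x + (1 - l) * ball_gauge y) ^ (n + 2) \<le> 1 / ball_gauge ?m ^ (n + 2)" .
  have pos: "l * ball_gauge x + (1 - l) * ball_gauge y > 0"
    using ball_gauge_pos[OF x(1)] ball_gauge_pos[OF x(2)] l by (cases "l = 0") (auto intro: add_pos_nonneg)
  have "ball_gauge ?m ^ (n + 2) \<le> (l * ball_gauge x + (1 - l) * ball_gauge y) ^ (n + 2)"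
    using le pos ball_gauge_pos[OF False] by (simp add: divide_le_eq pos_le_divide_eq field_simps del: power_Suc)
  then have "ball_gauge ?m ^ Suc (n + 1) \<le> (l * ball_gauge x + (1 - l) * ball_gauge y) ^ Suc (n + 1)" by simp
  then show ?thesis by (rule power_le_imp_le_base) (use pos in simp)
qed

text \<open>The factors a and b rescale both vectors to peak 1, where the normalised case applies.
  The gauge is positively homogeneous, so the weights l and 1 - l together with s can be chosen to
  undo the rescaling.\<close>

lemma ball_gauge_triangle: "ball_gauge (x + y) \<le> ball_gauge x + ball_gauge y"
proof (cases "x = 0 \<or> y = 0")
  case False
  then have x: "x \<noteq> 0" "y \<noteq> 0" by auto
  define a where "a = root (n + 3) (peak x)"
  define b where "b = root (n + 3) (peak y)"
  have ab: "a > 0" "b > 0" using peak_pos[OF x(1)] peak_pos[OF x(2)] by (auto simp: a_def b_def)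
  have pa: "a ^ (n + 3) = peak x" "b ^ (n + 3) = peak y"
    unfolding a_def b_def using peak_pos[OF x(1)] peak_pos[OF x(2)] by (auto intro!: real_root_pow_pos2)
  have p1: "peak (a *\<^sub>R x) = peak (b *\<^sub>R y)"
    unfolding peak_scale[OF ab(1) x(1)] peak_scale[OF ab(2) x(2)] pa using peak_pos x by force
  define s where "s = 1 / a + 1 / b"
  have s: "s > 0" using ab by (simp add: s_def add_pos_pos)
  define l where "l = (1 / a) / s"
  have "1 / a \<le> s" using ab by (simp add: s_def)
  then have "1 / a / s \<le> 1" by (subst pos_divide_le_eq) (use s in auto)
  then have l: "0 \<le> l" "l \<le> 1" using ab s by (auto simp: l_def)
  have sl1: "s * l = 1 / a" using s by (simp add: l_def)
  moreover have "s * (1 - l) = 1 / b" unfolding right_diff_distrib sl1 by (simp add: s_def)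
  ultimately have sl: "s * l = 1 / a" "s * (1 - l) = 1 / b" .
  have "s *\<^sub>R (l *\<^sub>R (a *\<^sub>R x) + (1 - l) *\<^sub>R (b *\<^sub>R y)) = (s * l * a) *\<^sub>R x + (s * (1 - l) * b) *\<^sub>R y"
    by (simp add: scaleR_add_right mult.assoc)
  also have "\<dots> = x + y" unfolding sl using ab by simp
  finally have "ball_gauge (x + y) = s * ball_gauge (l *\<^sub>R (a *\<^sub>R x) + (1 - l) *\<^sub>R (b *\<^sub>R y))"
    using ball_gauge_scale[of s] s by (metis less_imp_le)
  also have "\<dots> \<le> s * (l * ball_gauge (a *\<^sub>R x) + (1 - l) * ball_gauge (b *\<^sub>R y))"
    using s by (intro mult_left_mono ball_gauge_triangle_normalized l p1) (use x ab in auto)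
  also have "\<dots> = (s * l * a) * ball_gauge x + (s * (1 - l) * b) * ball_gauge y"
    using ab by (simp add: ball_gauge_scale algebra_simps)
  also have "\<dots> = ball_gauge x + ball_gauge y" unfolding sl using ab by simp
  finally show ?thesis .
qed auto

lemma ball_gauge_convex: "convex_on UNIV ball_gauge"
  by (rule convex_onI) (use ball_gauge_triangle in \<open>auto simp flip: ball_gauge_scale\<close>)

lemma ball_gauge_continuous: "continuous_on UNIV ball_gauge"
  by (rule convex_on_continuous[OF open_UNIV ball_gauge_convex])

lemma ball_gauge_lower_bound: "\<exists>d>0. \<forall>x. d * norm x \<le> ball_gauge x"
proof -
  have "compact (sphere (0::'a) 1)" "sphere (0::'a) 1 \<noteq> {}" by auto
  then obtain x0 where x0: "x0 \<in> sphere (0::'a) 1" "\<And>x. x \<in> sphere 0 1 \<Longrightarrow> ball_gauge x0 \<le> ball_gauge x"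
    using continuous_attains_inf[of "sphere 0 1" ball_gauge] continuous_on_subset[OF ball_gauge_continuous] by (metis subset_UNIV)
  have "ball_gauge x0 * norm x \<le> ball_gauge x" for x
  proof (cases "x = 0")
    case False
    have "ball_gauge x = norm x * ball_gauge (x /\<^sub>R norm x)" using False by (simp flip: ball_gauge_scale)
    moreover have "ball_gauge x0 \<le> ball_gauge (x /\<^sub>R norm x)" using False by (intro x0(2)) simp
    ultimately show ?thesis by (simp add: mult.commute mult_left_mono)
  qed simp
  moreover have "x0 \<noteq> 0" using x0(1) by auto
  ultimately show ?thesis using ball_gauge_pos[of x0] by (intro exI[of _ "ball_gauge x0"]) auto
qed

lemma convex_body_ball_gauge: "convex_body {x. ball_gauge x \<le> 1}"
  unfolding convex_body_def
proof (intro conjI)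
  obtain d where d: "d > 0" "\<And>x. d * norm x \<le> ball_gauge x" using ball_gauge_lower_bound by blast
  have "norm x \<le> 1 / d" if "ball_gauge x \<le> 1" for x
  proof -
    have "d * norm x \<le> 1" using d(2)[of x] that by simp
    then show ?thesis using d(1) by (simp add: pos_le_divide_eq mult.commute)
  qed
  then have "bounded {x. ball_gauge x \<le> 1}" by (intro boundedI[of _ "1 / d"]) auto
  moreover have "closed {x. ball_gauge x \<le> 1}" by (intro closed_Collect_le ball_gauge_continuous continuous_intros)
  ultimately show "compact {x. ball_gauge x \<le> 1}" by (simp add: compact_eq_bounded_closed)
  have "convex {x. ball_gauge x \<le> 1}"
  proof (rule convexI)
    fix x y :: 'a and u v :: real
    assume *: "x \<in> {x. ball_gauge x \<le> 1}" "y \<in> {x. ball_gauge x \<le> 1}" "0 \<le> u" "0 \<le> v" "u + v = 1"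
    have "ball_gauge (u *\<^sub>R x + v *\<^sub>R y) \<le> u * ball_gauge x + v * ball_gauge y"
      using ball_gauge_triangle[of "u *\<^sub>R x" "v *\<^sub>R y"] * by (simp add: ball_gauge_scale)
    also have "\<dots> \<le> u * 1 + v * 1" using * by (intro add_mono mult_left_mono) auto
    finally show "u *\<^sub>R x + v *\<^sub>R y \<in> {x. ball_gauge x \<le> 1}" using * by simp
  qed
  then show "convex {x. ball_gauge x \<le> 1}" .
  have "open {x. ball_gauge x < 1}" by (intro open_Collect_less ball_gauge_continuous continuous_intros)
  then have "{x. ball_gauge x < 1} \<subseteq> interior {x. ball_gauge x \<le> 1}" by (intro interior_maximal) auto
  then show "interior {x. ball_gauge x \<le> 1} \<noteq> {}" using ball_gauge_0 by (metis (mono_tags) empty_subsetI equalityI mem_Collect_eq empty_iff zero_less_one)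
qed

lemma ball_gauge_le_1_iff: "x \<noteq> 0 \<Longrightarrow> ball_gauge x \<le> 1 \<longleftrightarrow> 1 \<le> (real n + 2) * mom (n + 1) x"
proof -
  assume "x \<noteq> 0"
  then have "0 < (real n + 2) * mom (n + 1) x" using mom_pos by (intro mult_pos_pos) auto
  then show ?thesis by (auto simp: ball_gauge_def divide_le_eq_1)
qed

lemma ball_body_eq_ball_gauge: "ball_body (real n + 2) (\<lambda>x. h x ^ n) = {x. ball_gauge x \<le> 1}"
proof (intro set_eqI)
  fix x :: 'a
  have e: "(\<integral>\<^sup>+t\<in>{0..}. ennreal ((real n + 2) * t powr (real n + 2 - 1) * h (t *\<^sub>R x) ^ n) \<partial>lebesgue)
      = (\<integral>\<^sup>+t. ennreal (real n + 2) * (ennreal (t ^ (n + 1) * h (t *\<^sub>R x) ^ n) * indicator {0..} t) \<partial>lborel)"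
    unfolding nn_integral_completion
  proof (rule nn_integral_cong)
    fix t :: real
    have p: "t powr (real n + 1) = t ^ (n + 1)" if "t \<ge> 0"
    proof (cases "t = 0")
      case False
      then have "t powr real (n + 1) = t ^ (n + 1)" using that by (intro powr_realpow) auto
      then show ?thesis by (simp add: add.commute)
    qed simp
    show "ennreal ((real n + 2) * t powr (real n + 2 - 1) * h (t *\<^sub>R x) ^ n) * indicator {0..} t
      = ennreal (real n + 2) * (ennreal (t ^ (n + 1) * h (t *\<^sub>R x) ^ n) * indicator {0..} t)"
    proof (cases "t \<ge> 0")
      case True
      have "real n + 2 - 1 = real n + 1" by simp
      moreover have "ennreal (real n + 2) * ennreal (t ^ (n + 1) * h (t *\<^sub>R x) ^ n) = ennreal ((real n + 2) * (t ^ (n + 1) * h (t *\<^sub>R x) ^ n))"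
        by (rule ennreal_mult[symmetric]) (use True nonneg in auto)
      ultimately show ?thesis using True p[OF True] by (simp only: indicator_simps mult.assoc atLeast_iff) simp
    qed simp
  qed
  have "x \<in> ball_body (real n + 2) (\<lambda>x. h x ^ n) \<longleftrightarrow>
     1 \<le> (\<integral>\<^sup>+t. ennreal (real n + 2) * (ennreal (t ^ (n + 1) * h (t *\<^sub>R x) ^ n) * indicator {0..} t) \<partial>lborel)"
    unfolding ball_body_def mem_Collect_eq e by (simp add: one)
  also have "\<dots> \<longleftrightarrow> ball_gauge x \<le> 1"
  proof (cases "x = 0")
    case False
    have "(\<integral>\<^sup>+t. ennreal (real n + 2) * (ennreal (t ^ (n + 1) * h (t *\<^sub>R x) ^ n) * indicator {0..} t) \<partial>lborel)
       = ennreal (real n + 2) * ennreal (mom (n + 1) x)"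
      unfolding mom_nn[OF False, symmetric] by (rule nn_integral_cmult) simp
    also have "\<dots> = ennreal ((real n + 2) * mom (n + 1) x)"
      by (rule ennreal_mult[symmetric]) (use mom_nonneg in auto)
    finally have *: "(\<integral>\<^sup>+t. ennreal (real n + 2) * (ennreal (t ^ (n + 1) * h (t *\<^sub>R x) ^ n) * indicator {0..} t) \<partial>lborel)
       = ennreal ((real n + 2) * mom (n + 1) x)" .
    show ?thesis unfolding * ball_gauge_le_1_iff[OF False] ennreal_1[symmetric]
      using mom_nonneg by (intro ennreal_le_iff) auto
  next
    \<comment> \<open>The gauge is 0 at the origin, so membership must hold: the integrand is at
      least 1 on [1, 2], which already gives the required value 1.\<close>
    case True
    have "(\<integral>\<^sup>+t. indicator {1..2::real} t \<partial>lborel) \<le>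
      (\<integral>\<^sup>+t. ennreal (real n + 2) * (ennreal (t ^ (n + 1) * h (t *\<^sub>R x) ^ n) * indicator {0..} t) \<partial>lborel)"
    proof (rule nn_integral_mono)
      fix t :: real
      show "indicator {1..2} t \<le> ennreal (real n + 2) * (ennreal (t ^ (n + 1) * h (t *\<^sub>R x) ^ n) * indicator {0..} t)"
      proof (cases "t \<in> {1..2}")
        case t: True
        have "1 * 1 \<le> (real n + 2) * t ^ (n + 1)" using t by (intro mult_mono one_le_power) auto
        then have "1 \<le> ennreal ((real n + 2) * t ^ (n + 1))" using t by (subst ennreal_1[symmetric], intro ennreal_leI) simp
        also have "\<dots> = ennreal (real n + 2) * ennreal (t ^ (n + 1))" by (rule ennreal_mult) (use t in auto)
        finally show ?thesis using t True one by simp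
      qed simp
    qed
    then show ?thesis using True by simp
  qed
  finally show "x \<in> ball_body (real n + 2) (\<lambda>x. h x ^ n) \<longleftrightarrow> x \<in> {x. ball_gauge x \<le> 1}" by simp
qed

end


section \<open>Bodies whose intersections with translates are homothetic\<close>

lemma homothety_measure:
  fixes K :: "'a::euclidean_space set"
  assumes K: "compact K" and \<sigma>: "\<sigma> \<ge> 0"
  shows "measure lebesgue ((\<lambda>z. p + \<sigma> *\<^sub>R z) ` K) = \<sigma> ^ DIM('a) * measure lebesgue K"
proof (cases "\<sigma> = 0")
  case True
  then have "(\<lambda>z. p + \<sigma> *\<^sub>R z) ` K \<subseteq> {p}" by auto
  then have "negligible ((\<lambda>z. p + \<sigma> *\<^sub>R z) ` K)" using negligible_subset negligible_sing by blast
  then show ?thesis using True by (simp add: negligible_imp_measure0 zero_power)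
next
  case False
  then have s: "\<sigma> > 0" using \<sigma> by simp
  let ?T = "\<lambda>x::'a. \<sigma> *\<^sub>R x"
  have lT: "linear ?T" by (simp add: linear_iff scaleR_right_distrib)
  have bT: "bij ?T" by (rule o_bij[where g="\<lambda>x. (1/\<sigma>) *\<^sub>R x"]) (use s in auto)
  obtain c where c: "lin_scale ?T c" using lin_scale_exists[OF lT bT] .
  have "c = \<sigma> ^ DIM('a)" by (rule lin_scale_conformal[OF c lT bT s]) (use s in simp)
  then show ?thesis using affine_set_measure[OF c lT bT K, of p] by simp
qed

text \<open>\<open>cone_over K s y\<close> says that \<open>(s, y)\<close> lies in the convex cone generated by \<open>{1} \<times> K\<close>; this cone
  orders \<open>\<real> \<times> 'a\<close>.\<close>

definition cone_over :: "'a::real_vector set \<Rightarrow> real \<Rightarrow> 'a \<Rightarrow> bool" where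
  "cone_over K s y \<longleftrightarrow> s \<ge> 0 \<and> (\<exists>k\<in>K. y = s *\<^sub>R k)"

lemma cone_overI: "s \<ge> 0 \<Longrightarrow> k \<in> K \<Longrightarrow> y = s *\<^sub>R k \<Longrightarrow> cone_over K s y"
  by (auto simp: cone_over_def)

lemma cone_over_add:
  assumes K: "convex K" and C: "cone_over K s x" "cone_over K t y"
  shows "cone_over K (s + t) (x + y)"
proof -
  obtain k1 k2 where k: "k1 \<in> K" "k2 \<in> K" "x = s *\<^sub>R k1" "y = t *\<^sub>R k2" and st: "s \<ge> 0" "t \<ge> 0"
    using C by (auto simp: cone_over_def)
  show ?thesis
  proof (cases "s + t = 0")
    case True
    then have "s = 0" "t = 0" using st by auto
    then show ?thesis using k by (intro cone_overI[of _ k1]) auto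
  next
    case False
    then have p: "s + t > 0" using st by simp
    have "(s / (s + t)) *\<^sub>R k1 + (t / (s + t)) *\<^sub>R k2 \<in> K"
      by (rule convexD[OF K k(1,2)]) (use p st in \<open>auto simp: add_divide_distrib[symmetric]\<close>)
    moreover have "x + y = (s + t) *\<^sub>R ((s / (s + t)) *\<^sub>R k1 + (t / (s + t)) *\<^sub>R k2)"
      using p k by (simp add: scaleR_add_right)
    ultimately show ?thesis using p by (intro cone_overI) auto
  qed
qed

text \<open>If c were outside B, some linear functional would be smaller at c than everywhere on B.
  At its minimiser on A the decomposition a + c = a' + b would then be impossible.\<close>

lemma minkowski_cancel:
  fixes A B :: "'a::euclidean_space set"
  assumes A: "compact A" "A \<noteq> {}" and B: "convex B" "closed B"
    and sub: "\<And>a. a \<in> A \<Longrightarrow> \<exists>a'\<in>A. \<exists>b\<in>B. a + c = a' + b"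
  shows "c \<in> B"
proof (rule ccontr)
  assume c: "c \<notin> B"
  then obtain f \<gamma> where f: "f \<bullet> c < \<gamma>" "\<And>x. x \<in> B \<Longrightarrow> f \<bullet> x > \<gamma>"
    using separating_hyperplane_closed_point[OF B c] by blast
  have "continuous_on A (\<lambda>x. f \<bullet> x)" by (intro continuous_intros)
  then obtain x0 where x0: "x0 \<in> A" "\<And>x. x \<in> A \<Longrightarrow> f \<bullet> x0 \<le> f \<bullet> x"
    using continuous_attains_inf[OF A] by blast
  obtain a' b where "a' \<in> A" "b \<in> B" "x0 + c = a' + b" using sub[OF x0(1)] by blast
  moreover from this have "f \<bullet> x0 + f \<bullet> c = f \<bullet> a' + f \<bullet> b" by (simp flip: inner_add_right)
  ultimately show False using f x0(2) by fastforce
qed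

text \<open>Since t K is contained in s K + (t - s) K, the summand s K can be cancelled from c + s K
  \<subseteq> t K. This turns an inclusion of homothets into a comparison in the order of the
  cone.\<close>

lemma scaled_subset_cancel:
  fixes K :: "'a::euclidean_space set"
  assumes K: "compact K" "convex K" "K \<noteq> {}" and s: "0 \<le> s" "s \<le> t"
    and sub: "\<And>k. k \<in> K \<Longrightarrow> \<exists>k'\<in>K. c + s *\<^sub>R k = t *\<^sub>R k'"
  shows "cone_over K (t - s) c"
proof -
  let ?B = "(\<lambda>k. (t - s) *\<^sub>R k) ` K"
  have "c \<in> ?B"
  proof (rule minkowski_cancel[of "(\<lambda>k. s *\<^sub>R k) ` K"])
    show "compact ((\<lambda>k. s *\<^sub>R k) ` K)" using K by (intro compact_scaling)
    show "convex ?B" using K by (intro convex_scaling)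
    show "closed ?B" using K by (intro compact_imp_closed compact_scaling)
    fix a assume "a \<in> (\<lambda>k. s *\<^sub>R k) ` K"
    then obtain k where k: "k \<in> K" "a = s *\<^sub>R k" by blast
    obtain k' where "k' \<in> K" "c + s *\<^sub>R k = t *\<^sub>R k'" using sub[OF k(1)] by blast
    then have "a + c = s *\<^sub>R k' + (t - s) *\<^sub>R k'" using k by (simp add: scaleR_left_diff_distrib add.commute)
    then show "\<exists>a'\<in>(\<lambda>k. s *\<^sub>R k) ` K. \<exists>b\<in>?B. a + c = a' + b" using \<open>k' \<in> K\<close> by blast
  qed (use K in auto)
  then show ?thesis using s by (auto intro: cone_overI)
qed

text \<open>If s > t, convexity makes c + (s - t) k0 + t K a subset of t K for each k0 in K, and
  cancellation gives c = - (s - t) k0; this cannot hold for two different points.\<close>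

lemma scaled_subset_le:
  fixes K :: "'a::euclidean_space set"
  assumes K: "compact K" "convex K" and vw: "v \<in> K" "w \<in> K" "v \<noteq> w" and s: "0 \<le> s" "0 \<le> t"
    and sub: "\<And>k. k \<in> K \<Longrightarrow> \<exists>k'\<in>K. c + s *\<^sub>R k = t *\<^sub>R k'"
  shows "s \<le> t"
proof (rule ccontr)
  assume ts: "\<not> s \<le> t"
  have "c + (s - t) *\<^sub>R k0 = 0" if k0: "k0 \<in> K" for k0
  proof -
    have "cone_over K (t - t) (c + (s - t) *\<^sub>R k0)"
    proof (rule scaled_subset_cancel)
      fix k assume k: "k \<in> K"
      have "((s - t) / s) *\<^sub>R k0 + (t / s) *\<^sub>R k \<in> K"
        by (rule convexD[OF K(2) k0 k]) (use ts s in \<open>auto simp: add_divide_distrib[symmetric]\<close>)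
      moreover have "s *\<^sub>R (((s - t) / s) *\<^sub>R k0 + (t / s) *\<^sub>R k) = (s - t) *\<^sub>R k0 + t *\<^sub>R k"
        using ts s by (simp add: scaleR_add_right)
      ultimately show "\<exists>k'\<in>K. c + (s - t) *\<^sub>R k0 + t *\<^sub>R k = t *\<^sub>R k'"
        using sub by (metis add.assoc)
    qed (use K vw s in auto)
    then show ?thesis by (auto simp: cone_over_def)
  qed
  from this[OF vw(1)] this[OF vw(2)] have "(s - t) *\<^sub>R v = (s - t) *\<^sub>R w" by (metis add_left_cancel)
  then show False using ts vw by simp
qed

text \<open>An extreme point of K spans an extreme ray of the cone: \<epsilon> (1, w) decomposes in
  it only along its own ray.\<close>

lemma extreme_point_split:
  assumes w: "w extreme_point_of K" and k: "k1 \<in> K" "k2 \<in> K"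
    and d: "0 < \<delta>" "\<delta> \<le> \<epsilon>" and eq: "\<epsilon> *\<^sub>R w = (\<epsilon> - \<delta>) *\<^sub>R k2 + \<delta> *\<^sub>R k1"
  shows "k1 = w"
proof (cases "\<delta> = \<epsilon>")
  case True then show ?thesis using eq d by simp
next
  case False
  then have dl: "\<delta> < \<epsilon>" using d by simp
  define u where "u = \<delta> / \<epsilon>"
  have u: "0 < u" "u < 1" using d dl by (auto simp: u_def)
  have "w = (1 / \<epsilon>) *\<^sub>R (\<epsilon> *\<^sub>R w)" using d by simp
  also have "\<dots> = (1 - u) *\<^sub>R k2 + u *\<^sub>R k1" unfolding eq using d by (simp add: u_def scaleR_add_right diff_divide_distrib)
  finally have weq: "w = (1 - u) *\<^sub>R k2 + u *\<^sub>R k1" .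
  show ?thesis
  proof (cases "k1 = k2")
    case True then show ?thesis using weq by (simp add: scaleR_left_distrib[symmetric])
  next
    case neq: False
    then have "w \<in> open_segment k2 k1" using u weq by (auto simp: in_segment)
    then show ?thesis using w k unfolding extreme_point_of_def by blast
  qed
qed

text \<open>At height s the common upper bounds of \<epsilon> (1, v) and \<epsilon> (1, w) form a
  shifted and scaled intersection of K with a translate, hence a homothet u + \<sigma> K, so they
  are the elements above (s - \<sigma>, u). The sum \<epsilon> (1, v) + \<epsilon> (1, w) is an
  upper bound too and exceeds (s - \<sigma>, u) by \<delta> (1, k1). If \<delta> > 0, both extreme
  rays would have to contain (1, k1), so \<delta> = 0.\<close>

lemma homothetic_intersections_lattice_aux:
  fixes K :: "'a::euclidean_space set"
  assumes K: "compact K" "convex K"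
    and H: "\<And>x. K \<inter> (+) x ` K \<noteq> {} \<Longrightarrow> \<exists>\<sigma> p. 0 \<le> \<sigma> \<and> \<sigma> \<le> 1 \<and> K \<inter> (+) x ` K = (\<lambda>z. p + \<sigma> *\<^sub>R z) ` K"
    and vw: "v extreme_point_of K" "w extreme_point_of K" "v \<noteq> w" and e: "\<epsilon> > 0" "s \<ge> 2 * \<epsilon>"
    and C: "cone_over K (s - \<epsilon>) (y - \<epsilon> *\<^sub>R v)" "cone_over K (s - \<epsilon>) (y - \<epsilon> *\<^sub>R w)"
  shows "cone_over K (s - 2 * \<epsilon>) (y - \<epsilon> *\<^sub>R v - \<epsilon> *\<^sub>R w)"
proof -
  define r where "r = s - \<epsilon>"
  have r: "r > 0" "r \<ge> \<epsilon>" using e by (auto simp: r_def)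
  have vK: "v \<in> K" "w \<in> K" using vw by (auto simp: extreme_point_of_def)
  define x where "x = (\<epsilon> / r) *\<^sub>R (w - v)"
  have rx: "r *\<^sub>R x = \<epsilon> *\<^sub>R (w - v)" using r by (simp add: x_def)
  have I: "cone_over K r (z - \<epsilon> *\<^sub>R v) \<and> cone_over K r (z - \<epsilon> *\<^sub>R w) \<longleftrightarrow> (\<exists>k\<in>K \<inter> (+) x ` K. z = \<epsilon> *\<^sub>R v + r *\<^sub>R k)" for z
  proof (intro iffI)
    assume "cone_over K r (z - \<epsilon> *\<^sub>R v) \<and> cone_over K r (z - \<epsilon> *\<^sub>R w)"
    then obtain k k' where k: "k \<in> K" "k' \<in> K" "z - \<epsilon> *\<^sub>R v = r *\<^sub>R k" "z - \<epsilon> *\<^sub>R w = r *\<^sub>R k'"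
      by (auto simp: cone_over_def)
    then have "r *\<^sub>R k = r *\<^sub>R (x + k')" by (simp add: scaleR_add_right rx algebra_simps)
    then have "k = x + k'" using r by simp
    then show "\<exists>k\<in>K \<inter> (+) x ` K. z = \<epsilon> *\<^sub>R v + r *\<^sub>R k" using k by (intro bexI[of _ k]) (auto simp: algebra_simps)
  next
    assume "\<exists>k\<in>K \<inter> (+) x ` K. z = \<epsilon> *\<^sub>R v + r *\<^sub>R k"
    then obtain k k' where k: "k \<in> K" "k' \<in> K" "k = x + k'" "z = \<epsilon> *\<^sub>R v + r *\<^sub>R k" by auto
    have "z - \<epsilon> *\<^sub>R v = r *\<^sub>R k" using k by simp
    moreover have "z - \<epsilon> *\<^sub>R w = r *\<^sub>R k'" using k(3,4) by (simp add: scaleR_add_right rx scaleR_diff_right)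
    ultimately show "cone_over K r (z - \<epsilon> *\<^sub>R v) \<and> cone_over K r (z - \<epsilon> *\<^sub>R w)"
      using k r by (auto intro: cone_overI)
  qed
  have "K \<inter> (+) x ` K \<noteq> {}" using I[of y] C by (auto simp: r_def)
  then obtain \<sigma>0 p where \<sigma>0: "0 \<le> \<sigma>0" "\<sigma>0 \<le> 1" "K \<inter> (+) x ` K = (\<lambda>z. p + \<sigma>0 *\<^sub>R z) ` K" using H by blast
  define \<sigma> where "\<sigma> = r * \<sigma>0"
  define u where "u = \<epsilon> *\<^sub>R v + r *\<^sub>R p"
  have \<sigma>: "0 \<le> \<sigma>" "\<sigma> \<le> r" using r \<sigma>0 by (auto simp: \<sigma>_def mult_left_le)
  have I': "cone_over K r (z - \<epsilon> *\<^sub>R v) \<and> cone_over K r (z - \<epsilon> *\<^sub>R w) \<longleftrightarrow> (\<exists>k\<in>K. z = u + \<sigma> *\<^sub>R k)" for z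
    unfolding I \<sigma>0(3) by (auto simp: u_def \<sigma>_def scaleR_add_right)
  define \<delta> where "\<delta> = \<sigma> - (r - \<epsilon>)"
  have sub: "\<exists>k'\<in>K. (\<epsilon> *\<^sub>R v + \<epsilon> *\<^sub>R w - u) + (r - \<epsilon>) *\<^sub>R k = \<sigma> *\<^sub>R k'" if k: "k \<in> K" for k
  proof -
    let ?z = "\<epsilon> *\<^sub>R v + \<epsilon> *\<^sub>R w + (r - \<epsilon>) *\<^sub>R k"
    have c: "cone_over K \<epsilon> (\<epsilon> *\<^sub>R v)" "cone_over K \<epsilon> (\<epsilon> *\<^sub>R w)" "cone_over K (r - \<epsilon>) ((r - \<epsilon>) *\<^sub>R k)"
      using vK k e r by (auto intro: cone_overI)
    have "cone_over K r (?z - \<epsilon> *\<^sub>R v)" "cone_over K r (?z - \<epsilon> *\<^sub>R w)"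
      using cone_over_add[OF K(2) c(2,3)] cone_over_add[OF K(2) c(1,3)] by (simp_all add: algebra_simps)
    then obtain k' where "k' \<in> K" "?z = u + \<sigma> *\<^sub>R k'" using I'[of ?z] by blast
    then show ?thesis by (intro bexI[of _ k']) (auto simp: algebra_simps)
  qed
  have "r - \<epsilon> \<le> \<sigma>" by (rule scaled_subset_le[OF K vK vw(3) _ _ sub]) (use r \<sigma> in auto)
  then have \<delta>: "\<delta> \<ge> 0" "\<delta> \<le> \<epsilon>" using \<sigma> by (auto simp: \<delta>_def)
  have "cone_over K (\<sigma> - (r - \<epsilon>)) (\<epsilon> *\<^sub>R v + \<epsilon> *\<^sub>R w - u)"
    by (rule scaled_subset_cancel[OF K _ _ _ sub]) (use vK r \<delta> in \<open>auto simp: \<delta>_def\<close>)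
  then obtain k1 where k1: "k1 \<in> K" "\<epsilon> *\<^sub>R v + \<epsilon> *\<^sub>R w - u = \<delta> *\<^sub>R k1" by (auto simp: cone_over_def \<delta>_def)
  have above: "cone_over K (r - \<sigma>) (u - \<epsilon> *\<^sub>R a)" if a: "a = v \<or> a = w" for a
  proof (rule scaled_subset_cancel[OF K _ \<sigma>])
    fix k assume "k \<in> K"
    then have "cone_over K r (u + \<sigma> *\<^sub>R k - \<epsilon> *\<^sub>R a)" using I'[of "u + \<sigma> *\<^sub>R k"] a by blast
    then show "\<exists>k'\<in>K. u - \<epsilon> *\<^sub>R a + \<sigma> *\<^sub>R k = r *\<^sub>R k'" by (auto simp: cone_over_def algebra_simps)
  qed (use vK in auto)
  have rs: "r - \<sigma> = \<epsilon> - \<delta>" by (simp add: \<delta>_def)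
  have "\<delta> = 0"
  proof (rule ccontr)
    assume "\<delta> \<noteq> 0"
    then have d: "0 < \<delta>" using \<delta> by simp
    obtain k2 where k2: "k2 \<in> K" "u - \<epsilon> *\<^sub>R v = (\<epsilon> - \<delta>) *\<^sub>R k2" using above[of v] rs by (auto simp: cone_over_def)
    obtain k3 where k3: "k3 \<in> K" "u - \<epsilon> *\<^sub>R w = (\<epsilon> - \<delta>) *\<^sub>R k3" using above[of w] rs by (auto simp: cone_over_def)
    have "\<epsilon> *\<^sub>R w = (\<epsilon> - \<delta>) *\<^sub>R k2 + \<delta> *\<^sub>R k1" unfolding k2(2)[symmetric] k1(2)[symmetric] by simp
    then have "k1 = w" by (rule extreme_point_split[OF vw(2) k1(1) k2(1) d \<delta>(2)])
    moreover have "\<epsilon> *\<^sub>R v = (\<epsilon> - \<delta>) *\<^sub>R k3 + \<delta> *\<^sub>R k1" unfolding k3(2)[symmetric] k1(2)[symmetric] by simp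
    then have "k1 = v" by (rule extreme_point_split[OF vw(1) k1(1) k3(1) d \<delta>(2)])
    ultimately show False using vw(3) by simp
  qed
  then have u: "u = \<epsilon> *\<^sub>R v + \<epsilon> *\<^sub>R w" and \<sigma>eq: "\<sigma> = s - 2 * \<epsilon>" using k1(2) by (auto simp: \<delta>_def r_def)
  obtain k where "k \<in> K" "y = u + \<sigma> *\<^sub>R k" using I'[of y] C by (auto simp: r_def)
  then show ?thesis unfolding u \<sigma>eq using e by (intro cone_overI[of _ k]) (auto simp: algebra_simps)
qed

text \<open>In the order of the cone, the supremum of \<open>\<epsilon> (1, v)\<close> and \<open>\<epsilon> (1, w)\<close> is their sum.\<close>

lemma homothetic_intersections_lattice:
  fixes K :: "'a::euclidean_space set"
  assumes K: "compact K" "convex K"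
    and H: "\<And>x. K \<inter> (+) x ` K \<noteq> {} \<Longrightarrow> \<exists>\<sigma> p. 0 \<le> \<sigma> \<and> \<sigma> \<le> 1 \<and> K \<inter> (+) x ` K = (\<lambda>z. p + \<sigma> *\<^sub>R z) ` K"
    and vw: "v extreme_point_of K" "w extreme_point_of K" "v \<noteq> w" and e: "\<epsilon> > 0"
    and C: "cone_over K (s - \<epsilon>) (y - \<epsilon> *\<^sub>R v)" "cone_over K (s - \<epsilon>) (y - \<epsilon> *\<^sub>R w)"
  shows "cone_over K (s - 2 * \<epsilon>) (y - \<epsilon> *\<^sub>R v - \<epsilon> *\<^sub>R w)"
proof (cases "s \<ge> 2 * \<epsilon>")
  case True
  then show ?thesis using homothetic_intersections_lattice_aux[OF K H vw e _ C] by blast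
next
  case False
  \<comment> \<open>Adding t (1, k) to the upper bound lifts it to height 2 \<epsilon>, where it
    must equal the sum. As k ranges over K this pins y + t k to one value, although K has two
    points.\<close>
  define t where "t = 2 * \<epsilon> - s"
  have t: "t > 0" using False by (simp add: t_def)
  have "y + t *\<^sub>R k = \<epsilon> *\<^sub>R v + \<epsilon> *\<^sub>R w" if k: "k \<in> K" for k
  proof -
    have ck: "cone_over K t (t *\<^sub>R k)" using k t by (auto intro: cone_overI)
    have "cone_over K (2 * \<epsilon> - 2 * \<epsilon>) ((y + t *\<^sub>R k) - \<epsilon> *\<^sub>R v - \<epsilon> *\<^sub>R w)"
      by (rule homothetic_intersections_lattice_aux[OF K H vw e])
        (use cone_over_add[OF K(2) C(1) ck] cone_over_add[OF K(2) C(2) ck] in \<open>auto simp: t_def algebra_simps\<close>)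
    then show ?thesis by (auto simp: cone_over_def algebra_simps)
  qed
  from this[of v] this[of w] have "t *\<^sub>R v = t *\<^sub>R w" using vw by (metis add_left_cancel extreme_point_of_def)
  then show ?thesis using t vw by simp
qed

section \<open>Affine independence of the extreme points\<close>

locale homothetic_intersections =
  fixes K :: "'a::euclidean_space set"
  assumes K: "compact K" "convex K"
    and H: "\<And>x. K \<inter> (+) x ` K \<noteq> {} \<Longrightarrow> \<exists>\<sigma> p. 0 \<le> \<sigma> \<and> \<sigma> \<le> 1 \<and> K \<inter> (+) x ` K = (\<lambda>z. p + \<sigma> *\<^sub>R z) ` K"
begin

text \<open>The lattice lemma treats equal multiples of v and w only, so b is cut into N equal
  portions \<open>\<eta>\<close> not exceeding \<epsilon>. Each application removes one portion of w
  while keeping \<open>\<eta>\<close> (1, v) below; the price is that \<epsilon> shrinks to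
  \<open>\<eta>\<close>.\<close>

lemma eliminate_extreme_point:
  assumes vw: "v extreme_point_of K" "w extreme_point_of K" "v \<noteq> w" and e: "\<epsilon> > 0" and b: "b \<ge> 0"
    and C0: "cone_over K s y" and C: "cone_over K (s + b - \<epsilon>) (y + b *\<^sub>R w - \<epsilon> *\<^sub>R v)"
  shows "\<exists>\<epsilon>'>0. cone_over K (s - \<epsilon>') (y - \<epsilon>' *\<^sub>R v)"
proof (cases "b = 0")
  case True then show ?thesis using C e by auto
next
  case False
  obtain N :: nat where N: "b / \<epsilon> < real N" using reals_Archimedean2 by blast
  have N0: "N > 0" using N b e by (metis divide_nonneg_pos gr0I not_less of_nat_0)
  define \<eta> where "\<eta> = b / N"
  have \<eta>: "\<eta> > 0" "\<eta> \<le> \<epsilon>" "b = N * \<eta>" using b False N N0 e by (auto simp: \<eta>_def field_simps)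
  have vK: "v \<in> K" "w \<in> K" using vw by (auto simp: extreme_point_of_def)
  have step: "cone_over K (s + real m * \<eta> - \<eta>) (y + (real m * \<eta>) *\<^sub>R w - \<eta> *\<^sub>R v) \<Longrightarrow> cone_over K (s - \<eta>) (y - \<eta> *\<^sub>R v)" for m
  proof (induction m)
    case (Suc m)
    have w: "cone_over K (s + real m * \<eta>) (y + (real m * \<eta>) *\<^sub>R w)"
      by (rule cone_over_add[OF K(2) C0]) (use vK \<eta> in \<open>auto intro: cone_overI\<close>)
    have "cone_over K ((s + real (Suc m) * \<eta>) - 2 * \<eta>) ((y + (real (Suc m) * \<eta>) *\<^sub>R w) - \<eta> *\<^sub>R v - \<eta> *\<^sub>R w)"
      by (rule homothetic_intersections_lattice[OF K H vw \<eta>(1) Suc.prems]) (use w in \<open>auto simp: algebra_simps\<close>)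
    then show ?case by (intro Suc.IH) (simp add: algebra_simps)
  qed simp
  have "cone_over K (\<epsilon> - \<eta>) ((\<epsilon> - \<eta>) *\<^sub>R v)" using vK \<eta> by (intro cone_overI) auto
  from cone_over_add[OF K(2) C this] have "cone_over K (s + real N * \<eta> - \<eta>) (y + (real N * \<eta>) *\<^sub>R w - \<eta> *\<^sub>R v)"
    by (simp add: \<eta>(3) algebra_simps)
  then show ?thesis using step \<eta>(1) by blast
qed

lemma cone_over_sum:
  assumes "finite B" "B \<subseteq> K" "K \<noteq> {}" "\<And>w. w \<in> B \<Longrightarrow> b w \<ge> 0"
  shows "cone_over K (\<Sum>w\<in>B. b w) (\<Sum>w\<in>B. b w *\<^sub>R w)"
  using assms
proof (induction B rule: finite_induct)
  case empty then show ?case by (auto simp: cone_over_def)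
next
  case (insert w B)
  have "cone_over K (b w + (\<Sum>w\<in>B. b w)) (b w *\<^sub>R w + (\<Sum>w\<in>B. b w *\<^sub>R w))"
    using insert by (intro cone_over_add[OF K(2)]) (auto intro: cone_overI)
  then show ?case using insert by simp
qed

text \<open>Removing the points of B one after another leaves a positive multiple of (1, v) below 0,
  but the cone has no element of negative height.\<close>

lemma extreme_point_not_below_sum:
  assumes "finite B" "\<And>w. w \<in> B \<Longrightarrow> w extreme_point_of K" "\<And>w. w \<in> B \<Longrightarrow> b w \<ge> 0"
    and v: "v extreme_point_of K" "v \<notin> B" and e: "\<epsilon> > 0"
    and C: "cone_over K ((\<Sum>w\<in>B. b w) - \<epsilon>) ((\<Sum>w\<in>B. b w *\<^sub>R w) - \<epsilon> *\<^sub>R v)"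
  shows False
  using assms
proof (induction B arbitrary: \<epsilon> rule: finite_induct)
  case empty then show ?case by (auto simp: cone_over_def)
next
  case (insert w B)
  have BK: "B \<subseteq> K" "K \<noteq> {}" using insert.prems(1) v(1) by (auto simp: extreme_point_of_def)
  have C0: "cone_over K (\<Sum>w\<in>B. b w) (\<Sum>w\<in>B. b w *\<^sub>R w)"
    by (rule cone_over_sum) (use insert BK in auto)
  have "\<exists>\<epsilon>'>0. cone_over K ((\<Sum>w\<in>B. b w) - \<epsilon>') ((\<Sum>w\<in>B. b w *\<^sub>R w) - \<epsilon>' *\<^sub>R v)"
    by (rule eliminate_extreme_point[OF v(1) _ _ _ _ C0, of w \<epsilon> "b w"])
      (use insert in \<open>auto simp: algebra_simps\<close>)
  then obtain \<epsilon>' where "\<epsilon>' > 0" "cone_over K ((\<Sum>w\<in>B. b w) - \<epsilon>') ((\<Sum>w\<in>B. b w *\<^sub>R w) - \<epsilon>' *\<^sub>R v)" by blast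
  then show ?case using insert by auto
qed

text \<open>The positive and nonpositive coefficients of an affine relation give two equal elements
  of the cone. Keeping one v from the positive side places U v (1, v) below a combination of other
  extreme points.\<close>

lemma extreme_points_affine_independent: "\<not> affine_dependent {x. x extreme_point_of K}"
proof
  let ?E = "{x. x extreme_point_of K}"
  assume "affine_dependent ?E"
  then obtain S U where S: "finite S" "S \<subseteq> ?E" "sum U S = 0" "\<exists>v\<in>S. U v \<noteq> 0" "(\<Sum>v\<in>S. U v *\<^sub>R v) = 0"
    unfolding affine_dependent_explicit by blast
  define P where "P = {v\<in>S. U v > 0}"
  define N where "N = {v\<in>S. \<not> U v > 0}"
  have fin: "finite P" "finite N" using S by (auto simp: P_def N_def)
  have SPN: "S = P \<union> N" "P \<inter> N = {}" by (auto simp: P_def N_def)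
  have "P \<noteq> {}"
  proof
    assume "P = {}"
    then have "\<forall>v\<in>S. U v \<le> 0" by (auto simp: P_def)
    then have "\<forall>v\<in>S. - U v = 0" using S(1,3) sum_nonneg_eq_0_iff[of S "\<lambda>v. - U v"] by (simp add: sum_negf)
    then show False using S(4) by auto
  qed
  then obtain v where v: "v \<in> P" by blast
  have s1: "(\<Sum>w\<in>N. - U w) = (\<Sum>w\<in>P. U w)"
    using S(3) sum.union_disjoint[OF fin SPN(2), of U] SPN(1) by (simp add: sum_negf)
  have s2: "(\<Sum>w\<in>N. (- U w) *\<^sub>R w) = (\<Sum>w\<in>P. U w *\<^sub>R w)"
    using S(5) sum.union_disjoint[OF fin SPN(2), of "\<lambda>w. U w *\<^sub>R w"] SPN(1) by (simp add: sum_negf neg_eq_iff_add_eq_0 add.commute)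
  have EK: "S \<subseteq> K" using S(2) by (auto simp: extreme_point_of_def)
  have "cone_over K (\<Sum>w\<in>P - {v}. U w) (\<Sum>w\<in>P - {v}. U w *\<^sub>R w)"
    by (rule cone_over_sum) (use fin EK v in \<open>auto simp: P_def\<close>)
  then have C: "cone_over K ((\<Sum>w\<in>N. - U w) - U v) ((\<Sum>w\<in>N. (- U w) *\<^sub>R w) - U v *\<^sub>R v)"
    unfolding s1 s2 using sum.remove[OF fin(1) v, of U] sum.remove[OF fin(1) v, of "\<lambda>w. U w *\<^sub>R w"] by simp
  show False
    by (rule extreme_point_not_below_sum[OF fin(2) _ _ _ _ _ C]) (use S(2) v in \<open>auto simp: P_def N_def\<close>)
qed

lemma is_simplex:
  assumes int: "interior K \<noteq> {}"
  shows "\<exists>V. \<not> affine_dependent V \<and> card V = DIM('a) + 1 \<and> K = convex hull V"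
proof (intro exI conjI)
  let ?E = "{x. x extreme_point_of K}"
  show KE: "K = convex hull ?E" by (rule Krein_Milman_Minkowski[OF K])
  show ind: "\<not> affine_dependent ?E" by (rule extreme_points_affine_independent)
  have "aff_dim K = DIM('a)" by (rule aff_dim_nonempty_interior[OF int])
  then have "aff_dim ?E = DIM('a)" using KE aff_dim_convex_hull[of ?E] by simp
  then show "card ?E = DIM('a) + 1" using aff_dim_affine_independent[OF ind] by simp
qed

end

section \<open>The covariogram of a simplex\<close>

lemma simplex_coordinates:
  fixes V :: "'a::euclidean_space set"
  assumes V: "\<not> affine_dependent V" "card V = DIM('a) + 1"
  obtains \<mu> where "sum \<mu> V = 0" "(\<Sum>v\<in>V. \<mu> v *\<^sub>R v) = x"
proof -
  have fin: "finite V" by (rule aff_independent_finite[OF V(1)])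
  have "aff_dim V = DIM('a)" using aff_dim_affine_independent[OF V(1)] V(2) by simp
  then have "affine hull V = UNIV" by (simp add: aff_dim_eq_full)
  then have all: "\<exists>u. sum u V = 1 \<and> (\<Sum>v\<in>V. u v *\<^sub>R v) = z" for z using affine_hull_finite[OF fin] by auto
  obtain u where u: "sum u V = 1" "(\<Sum>v\<in>V. u v *\<^sub>R v) = x" using all by blast
  obtain u0 where u0: "sum u0 V = 1" "(\<Sum>v\<in>V. u0 v *\<^sub>R v) = 0" using all by blast
  show ?thesis by (rule that[of "\<lambda>v. u v - u0 v"]) (use u u0 in \<open>auto simp: sum_subtractf scaleR_left_diff_distrib\<close>)
qed

lemma simplex_coordinates_unique:
  assumes V: "\<not> affine_dependent V" "finite V"
    and eq: "sum u V = sum u' V" "(\<Sum>v\<in>V. u v *\<^sub>R v) = (\<Sum>v\<in>V. u' v *\<^sub>R v)" and v: "v \<in> V"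
  shows "u v = u' v"
proof (rule ccontr)
  assume ne: "u v \<noteq> u' v"
  have "affine_dependent V" unfolding affine_dependent_explicit_finite[OF V(2)]
    by (rule exI[of _ "\<lambda>v. u v - u' v"]) (use eq v ne in \<open>auto simp: sum_subtractf scaleR_left_diff_distrib\<close>)
  then show False using V by simp
qed

text \<open>In barycentric coordinates the vector x has coordinates \<mu> of sum zero, and for t
  \<ge> 0 the conditions u \<ge> 0 and u - t \<mu> \<ge> 0 merge into u \<ge> t m with m the
  positive part of \<mu>. What remains to distribute is 1 - t s, where s is the sum of m, so the
  intersection is a homothet with that ratio, and empty when it is negative.\<close>

lemma simplex_covariogram_ray:
  fixes V :: "'a::euclidean_space set"
  assumes V: "\<not> affine_dependent V" "card V = DIM('a) + 1"
  obtains s where "s \<ge> 0" "\<And>t. t \<ge> 0 \<Longrightarrow> covariogram (convex hull V) (t *\<^sub>R x) = max 0 (1 - t * s) ^ DIM('a) * measure lebesgue (convex hull V)"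
proof -
  let ?K = "convex hull V"
  have fin: "finite V" by (rule aff_independent_finite[OF V(1)])
  obtain \<mu> where \<mu>: "sum \<mu> V = 0" "(\<Sum>v\<in>V. \<mu> v *\<^sub>R v) = x" using simplex_coordinates[OF V] by blast
  define m where "m v = max (\<mu> v) 0" for v
  define s where "s = sum m V"
  have s: "s \<ge> 0" unfolding s_def m_def by (intro sum_nonneg) auto
  have Kc: "compact ?K" using fin by (simp add: finite_imp_compact compact_convex_hull)
  have K: "?K = {y. \<exists>u. (\<forall>v\<in>V. 0 \<le> u v) \<and> sum u V = 1 \<and> (\<Sum>v\<in>V. u v *\<^sub>R v) = y}" by (rule convex_hull_finite[OF fin])
  have inter: "z \<in> ?K \<inter> (+) (t *\<^sub>R x) ` ?K \<longleftrightarrow> (\<exists>u. (\<forall>v\<in>V. t * m v \<le> u v) \<and> sum u V = 1 \<and> (\<Sum>v\<in>V. u v *\<^sub>R v) = z)"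
    if t: "t \<ge> 0" for z t
  proof
    assume "z \<in> ?K \<inter> (+) (t *\<^sub>R x) ` ?K"
    then obtain u u' where u: "\<forall>v\<in>V. 0 \<le> u v" "sum u V = 1" "(\<Sum>v\<in>V. u v *\<^sub>R v) = z"
      and u': "\<forall>v\<in>V. 0 \<le> u' v" "sum u' V = 1" "z = t *\<^sub>R x + (\<Sum>v\<in>V. u' v *\<^sub>R v)" unfolding K by blast
    have "u v = t * \<mu> v + u' v" if v: "v \<in> V" for v
    proof (rule simplex_coordinates_unique[OF V(1) fin _ _ v])
      show "sum u V = (\<Sum>v\<in>V. t * \<mu> v + u' v)" using u u' \<mu> by (simp add: sum.distrib sum_distrib_left[symmetric])
      show "(\<Sum>v\<in>V. u v *\<^sub>R v) = (\<Sum>v\<in>V. (t * \<mu> v + u' v) *\<^sub>R v)"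
        unfolding u(3) u'(3) \<mu>(2)[symmetric] by (simp add: scaleR_left_distrib sum.distrib scaleR_sum_right)
    qed
    then have "\<forall>v\<in>V. t * m v \<le> u v" using u(1) u'(1) t by (auto simp: m_def max_def)
    then show "\<exists>u. (\<forall>v\<in>V. t * m v \<le> u v) \<and> sum u V = 1 \<and> (\<Sum>v\<in>V. u v *\<^sub>R v) = z" using u by blast
  next
    assume "\<exists>u. (\<forall>v\<in>V. t * m v \<le> u v) \<and> sum u V = 1 \<and> (\<Sum>v\<in>V. u v *\<^sub>R v) = z"
    then obtain u where u: "\<forall>v\<in>V. t * m v \<le> u v" "sum u V = 1" "(\<Sum>v\<in>V. u v *\<^sub>R v) = z" by blast
    have tm: "0 \<le> t * m v" "t * \<mu> v \<le> t * m v" for v using t by (auto simp: m_def mult_left_mono)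
    have nn: "\<forall>v\<in>V. 0 \<le> u v" "\<forall>v\<in>V. 0 \<le> u v - t * \<mu> v" using u(1) tm by (force intro: order_trans)+
    have "sum (\<lambda>v. u v - t * \<mu> v) V = 1" using u \<mu> by (simp add: sum_subtractf sum_distrib_left[symmetric])
    moreover have "(\<Sum>v\<in>V. (u v - t * \<mu> v) *\<^sub>R v) = z - t *\<^sub>R x"
      unfolding u(3)[symmetric] \<mu>(2)[symmetric] by (simp add: scaleR_left_diff_distrib sum_subtractf scaleR_sum_right)
    ultimately have "z - t *\<^sub>R x \<in> ?K" unfolding K
      by (intro CollectI exI[of _ "\<lambda>v. u v - t * \<mu> v"] conjI nn(2))
    moreover have "z \<in> ?K" unfolding K by (intro CollectI exI[of _ u] conjI nn(1) u(2,3))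
    ultimately have "z \<in> ?K" "z - t *\<^sub>R x \<in> ?K" by simp_all
    then show "z \<in> ?K \<inter> (+) (t *\<^sub>R x) ` ?K" by (auto intro: image_eqI[of _ _ "z - t *\<^sub>R x"])
  qed
  have "covariogram ?K (t *\<^sub>R x) = max 0 (1 - t * s) ^ DIM('a) * measure lebesgue ?K" if t: "t \<ge> 0" for t
  proof (cases "t * s \<le> 1")
    case True
    define p where "p = (\<Sum>v\<in>V. (t * m v) *\<^sub>R v)"
    have sm: "(\<Sum>v\<in>V. t * m v) = t * s" by (simp add: s_def sum_distrib_left)
    have "?K \<inter> (+) (t *\<^sub>R x) ` ?K = (\<lambda>z. p + (1 - t * s) *\<^sub>R z) ` ?K"
    proof (intro equalityI subsetI)
      fix z assume "z \<in> ?K \<inter> (+) (t *\<^sub>R x) ` ?K"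
      then obtain u where u: "\<forall>v\<in>V. t * m v \<le> u v" "sum u V = 1" "(\<Sum>v\<in>V. u v *\<^sub>R v) = z" using inter[OF t] by blast
      have z: "z = p + (\<Sum>v\<in>V. (u v - t * m v) *\<^sub>R v)"
        unfolding p_def u(3)[symmetric] by (simp add: scaleR_left_diff_distrib sum_subtractf)
      have sd: "(\<Sum>v\<in>V. u v - t * m v) = 1 - t * s" using u sm by (simp add: sum_subtractf)
      show "z \<in> (\<lambda>z. p + (1 - t * s) *\<^sub>R z) ` ?K"
      proof (cases "t * s = 1")
        case one: True
        have "\<forall>v\<in>V. u v - t * m v = 0" using sum_nonneg_eq_0_iff[OF fin, of "\<lambda>v. u v - t * m v"] sd one u(1) by auto
        then have "z = p" using z by simp
        moreover obtain k where "k \<in> V" using V(2) by (metis add_is_0 card.empty ex_in_conv one_neq_zero)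
        then have "k \<in> ?K" by (rule hull_inc)
        ultimately show ?thesis using one by (intro image_eqI[of _ _ k]) auto
      next
        case False
        then have d: "1 - t * s > 0" using True by simp
        let ?w = "\<lambda>v. (u v - t * m v) / (1 - t * s)"
        have "(\<Sum>v\<in>V. ?w v *\<^sub>R v) \<in> ?K" unfolding K
          using u(1) d sd by (auto intro!: exI[of _ ?w] simp: sum_divide_distrib[symmetric])
        moreover have "z = p + (1 - t * s) *\<^sub>R (\<Sum>v\<in>V. ?w v *\<^sub>R v)" unfolding z using d by (simp add: scaleR_sum_right)
        ultimately show ?thesis by blast
      qed
    next
      fix z assume "z \<in> (\<lambda>z. p + (1 - t * s) *\<^sub>R z) ` ?K"
      then obtain w where w: "\<forall>v\<in>V. 0 \<le> w v" "sum w V = 1" "z = p + (1 - t * s) *\<^sub>R (\<Sum>v\<in>V. w v *\<^sub>R v)" unfolding K by blast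
      have "z = (\<Sum>v\<in>V. (t * m v + (1 - t * s) * w v) *\<^sub>R v)"
        unfolding w(3) p_def by (simp add: scaleR_left_distrib sum.distrib scaleR_sum_right)
      moreover have "(\<Sum>v\<in>V. t * m v + (1 - t * s) * w v) = 1" using w(2) sm by (simp add: sum.distrib sum_distrib_left[symmetric])
      moreover have "\<forall>v\<in>V. t * m v \<le> t * m v + (1 - t * s) * w v" using w(1) True by simp
      ultimately show "z \<in> ?K \<inter> (+) (t *\<^sub>R x) ` ?K" unfolding inter[OF t]
        by (intro exI[of _ "\<lambda>v. t * m v + (1 - t * s) * w v"]) simp
    qed
    then show ?thesis unfolding covariogram_def using homothety_measure[OF Kc, of "1 - t * s" p] True by (simp add: max_def)
  next
    case False
    have "?K \<inter> (+) (t *\<^sub>R x) ` ?K = {}"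
    proof (rule ccontr)
      assume "?K \<inter> (+) (t *\<^sub>R x) ` ?K \<noteq> {}"
      then obtain z u where "\<forall>v\<in>V. t * m v \<le> u v" "sum u V = 1" using inter[OF t] by blast
      then have "(\<Sum>v\<in>V. t * m v) \<le> 1" using sum_mono[of V "\<lambda>v. t * m v" u] by auto
      then show False using False by (simp add: s_def sum_distrib_left)
    qed
    then show ?thesis unfolding covariogram_def using False by (simp add: max_def zero_power)
  qed
  then show ?thesis using that[OF s] by blast
qed


section \<open>Polar integration\<close>

lemma nn_integral_lborel_scale:
  fixes f :: "'a::euclidean_space \<Rightarrow> ennreal"
  assumes r: "r > 0" and [measurable]: "f \<in> borel_measurable borel"
  shows "(\<integral>\<^sup>+x. f x \<partial>lborel) = ennreal (r ^ DIM('a)) * (\<integral>\<^sup>+x. f (r *\<^sub>R x) \<partial>lborel)"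
proof -
  let ?T = "\<lambda>x::'a. r *\<^sub>R x"
  have lT: "linear ?T" by (simp add: linear_iff scaleR_right_distrib)
  have bT: "bij ?T" by (rule o_bij[where g="\<lambda>x. (1/r) *\<^sub>R x"]) (use r in auto)
  obtain c where c: "lin_scale ?T c" using lin_scale_exists[OF lT bT] .
  have ceq: "c = r ^ DIM('a)" by (rule lin_scale_conformal[OF c lT bT r]) (use r in simp)
  have "(\<integral>\<^sup>+x. f x \<partial>lborel) = (\<integral>\<^sup>+x. f x \<partial>density (distr lborel borel ?T) (\<lambda>_. ennreal c))"
    using c unfolding lin_scale_def by metis
  also have "\<dots> = ennreal c * (\<integral>\<^sup>+x. f (r *\<^sub>R x) \<partial>lborel)"
    by (subst nn_integral_density) (auto simp: nn_integral_distr nn_integral_cmult)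
  finally show ?thesis by (simp add: ceq)
qed

definition annulus :: "'a::euclidean_space set" where
  "annulus = {y. 1 \<le> norm y \<and> norm y < exp 1}"

lemma annulus_measurable [measurable]: "annulus \<in> sets borel"
  unfolding annulus_def by measurable

lemma annulus_nonzero: "y \<in> annulus \<Longrightarrow> y \<noteq> 0"
  by (auto simp: annulus_def)

lemma nn_integral_reciprocal:
  assumes "a > 0"
  shows "(\<integral>\<^sup>+t. ennreal (1 / t) * indicator {a / exp 1<..a} t \<partial>lborel) = 1"
proof -
  have le: "a / exp 1 \<le> a" using assms by (simp add: divide_le_eq)
  have p: "0 < a / exp 1" using assms by simp
  have "(\<integral>\<^sup>+t. ennreal (1 / t) * indicator {a / exp 1<..a} t \<partial>lborel) = (\<integral>\<^sup>+t. ennreal (1 / t) * indicator {a / exp 1..a} t \<partial>lborel)"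
  proof (rule nn_integral_cong_AE)
    show "AE t in lborel. ennreal (1 / t) * indicator {a / exp 1<..a} t = ennreal (1 / t) * indicator {a / exp 1..a} t"
      using AE_lborel_singleton[of "a / exp 1"] by eventually_elim (auto simp: indicator_def)
  qed
  also have "\<dots> = ennreal (ln a - ln (a / exp 1))"
  proof (rule nn_integral_FTC_Icc[where F=ln])
    fix t assume "t \<in> {a / exp 1..a}"
    then have "t > 0" using p by (meson atLeastAtMost_iff order_less_le_trans)
    then show "(ln has_real_derivative 1 / t) (at t)" by (auto intro!: derivative_eq_intros)
  next
    fix t assume "t \<in> {a / exp 1..a}"
    then have "t > 0" using p by (meson atLeastAtMost_iff order_less_le_trans)
    then show "0 \<le> 1 / t" by simp
  qed (use le in auto)
  also have "ln a - ln (a / exp 1) = 1" using assms by (simp add: ln_div)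
  finally show ?thesis by simp
qed

text \<open>Polar coordinates without a surface measure: the sphere is replaced by an annulus that meets
  every ray in a set of \<open>dt / t\<close>-measure one.\<close>

lemma nn_integral_annulus_polar:
  fixes f :: "'a::euclidean_space \<Rightarrow> ennreal"
  assumes f[measurable]: "f \<in> borel_measurable borel"
  shows "(\<integral>\<^sup>+x. f x \<partial>lborel) =
    (\<integral>\<^sup>+y. (\<integral>\<^sup>+t. ennreal (t ^ (DIM('a) - 1)) * f (t *\<^sub>R y) * indicator {0<..} t \<partial>lborel) * indicator annulus y \<partial>lborel)"
proof -
  let ?n = "DIM('a)"
  have "(\<integral>\<^sup>+y. (\<integral>\<^sup>+t. ennreal (t ^ (?n - 1)) * f (t *\<^sub>R y) * indicator {0<..} t \<partial>lborel) * indicator annulus y \<partial>lborel)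
     = (\<integral>\<^sup>+y. (\<integral>\<^sup>+t. ennreal (t ^ (?n - 1)) * f (t *\<^sub>R y) * indicator {0<..} t * indicator annulus y \<partial>lborel) \<partial>(lborel :: 'a measure))"
    by (subst nn_integral_multc) auto
  also have "\<dots> = (\<integral>\<^sup>+t. (\<integral>\<^sup>+y. ennreal (t ^ (?n - 1)) * f (t *\<^sub>R y) * indicator {0<..} t * indicator annulus y \<partial>(lborel :: 'a measure)) \<partial>lborel)"
    by (rule lborel_pair.Fubini') simp
  \<comment> \<open>With z = t y the condition that y lies in the annulus becomes norm z / exp 1 < t
    \<le> norm z, a set of dt/t-measure 1; the Jacobian leaves one factor 1/t.\<close>
  also have "\<dots> = (\<integral>\<^sup>+t. (\<integral>\<^sup>+z. f z * (ennreal (1 / t) * indicator {norm z / exp 1<..norm z} t * indicator {0<..} t) \<partial>lborel) \<partial>lborel)"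
  proof (rule nn_integral_cong)
    fix t :: real
    show "(\<integral>\<^sup>+y. ennreal (t ^ (?n - 1)) * f (t *\<^sub>R y) * indicator {0<..} t * indicator annulus y \<partial>(lborel :: 'a measure))
       = (\<integral>\<^sup>+z. f z * (ennreal (1 / t) * indicator {norm z / exp 1<..norm z} t * indicator {0<..} t) \<partial>lborel)"
    proof (cases "t > 0")
      case t: True
      have "(\<integral>\<^sup>+z. f z * (ennreal (1 / t) * indicator {norm z / exp 1<..norm z} t * indicator {0<..} t) \<partial>lborel)
         = ennreal (t ^ ?n) * (\<integral>\<^sup>+y. f (t *\<^sub>R y) * (ennreal (1 / t) * indicator {norm (t *\<^sub>R y) / exp 1<..norm (t *\<^sub>R y)} t * indicator {0<..} t) \<partial>lborel)"
      proof (rule nn_integral_lborel_scale[OF t])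
        have "(\<lambda>z. f z * (ennreal (1 / t) * (if norm z / exp 1 < t \<and> t \<le> norm z then 1 else 0) * (if 0 < t then 1 else 0)))
          \<in> borel_measurable borel" by measurable
        moreover have "(\<lambda>z. f z * (ennreal (1 / t) * indicator {norm z / exp 1<..norm z} t * indicator {0<..} t))
          = (\<lambda>z. f z * (ennreal (1 / t) * (if norm z / exp 1 < t \<and> t \<le> norm z then 1 else 0) * (if 0 < t then 1 else 0)))"
          by (auto simp: indicator_def fun_eq_iff)
        ultimately show "(\<lambda>z. f z * (ennreal (1 / t) * indicator {norm z / exp 1<..norm z} t * indicator {0<..} t))
          \<in> borel_measurable borel" by simp
      qed
      also have "\<dots> = ennreal (t ^ ?n) * (\<integral>\<^sup>+y. f (t *\<^sub>R y) * (ennreal (1 / t) * indicator annulus y * indicator {0<..} t) \<partial>lborel)"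
      proof -
        have ind: "indicator {norm (t *\<^sub>R y) / exp 1<..norm (t *\<^sub>R y)} t = (indicator annulus y :: ennreal)" for y :: 'a
          using t by (auto simp: indicator_def annulus_def pos_divide_less_eq)
        show ?thesis unfolding ind ..
      qed
      also have "\<dots> = (\<integral>\<^sup>+y. ennreal (t ^ ?n) * (f (t *\<^sub>R y) * (ennreal (1 / t) * indicator annulus y * indicator {0<..} t)) \<partial>lborel)"
        by (rule nn_integral_cmult[symmetric]) simp
      also have "\<dots> = (\<integral>\<^sup>+y. ennreal (t ^ (?n - 1)) * f (t *\<^sub>R y) * indicator {0<..} t * indicator annulus y \<partial>lborel)"
      proof (rule nn_integral_cong)
        fix y :: 'a
        have "t ^ ?n * (1 / t) = t ^ (?n - 1)" using t power_minus_mult[of ?n t] by (simp add: field_simps)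
        then have pw: "ennreal (t ^ ?n) * ennreal (1 / t) = ennreal (t ^ (?n - 1))" using t by (simp add: ennreal_mult[symmetric])
        show "ennreal (t ^ ?n) * (f (t *\<^sub>R y) * (ennreal (1 / t) * indicator annulus y * indicator {0<..} t))
          = ennreal (t ^ (?n - 1)) * f (t *\<^sub>R y) * indicator {0<..} t * indicator annulus y"
          unfolding pw[symmetric] by (simp only: mult_ac)
      qed
      finally show ?thesis by simp
    qed simp
  qed
  also have "\<dots> = (\<integral>\<^sup>+z. (\<integral>\<^sup>+t. f z * (ennreal (1 / t) * indicator {norm z / exp 1<..norm z} t * indicator {0<..} t) \<partial>lborel) \<partial>lborel)"
  proof (rule lborel_pair.Fubini')
    have "(\<lambda>(z, t). f z * (ennreal (1 / t) * (if norm z / exp 1 < t \<and> t \<le> norm z then 1 else 0) * (if 0 < t then 1 else 0)))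
      \<in> borel_measurable (lborel \<Otimes>\<^sub>M (lborel :: real measure))" by measurable
    moreover have "(\<lambda>(z, t). f z * (ennreal (1 / t) * indicator {norm z / exp 1<..norm z} t * indicator {0<..} t))
      = (\<lambda>(z, t). f z * (ennreal (1 / t) * (if norm z / exp 1 < t \<and> t \<le> norm z then 1 else 0) * (if 0 < t then 1 else 0)))"
      by (auto simp: indicator_def fun_eq_iff)
    ultimately show "(\<lambda>(z, t). f z * (ennreal (1 / t) * indicator {norm z / exp 1<..norm z} t * indicator {0<..} t))
      \<in> borel_measurable (lborel \<Otimes>\<^sub>M lborel)" by simp
  qed
  also have "\<dots> = (\<integral>\<^sup>+z. f z \<partial>lborel)"
  proof (rule nn_integral_cong_AE)
    have "(\<integral>\<^sup>+t. f z * (ennreal (1 / t) * indicator {norm z / exp 1<..norm z} t * indicator {0<..} t) \<partial>lborel) = f z" if z: "z \<noteq> 0" for z :: 'a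
    proof -
      have "(\<integral>\<^sup>+t. f z * (ennreal (1 / t) * indicator {norm z / exp 1<..norm z} t * indicator {0<..} t) \<partial>lborel)
         = (\<integral>\<^sup>+t. f z * (ennreal (1 / t) * indicator {norm z / exp 1<..norm z} t) \<partial>lborel)"
      proof (rule nn_integral_cong)
        fix t :: real
        have "\<not> norm z / exp 1 < t" if "\<not> 0 < t"
          using that by (meson divide_nonneg_pos exp_gt_zero norm_ge_zero order_le_less_trans)
        then show "f z * (ennreal (1 / t) * indicator {norm z / exp 1<..norm z} t * indicator {0<..} t)
          = f z * (ennreal (1 / t) * indicator {norm z / exp 1<..norm z} t)"
          by (cases "0 < t") (auto simp: indicator_def)
      qed
      also have "\<dots> = f z * 1" using z by (subst nn_integral_cmult) (auto simp: nn_integral_reciprocal)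
      finally show ?thesis by simp
    qed
    then show "AE z in lborel. (\<integral>\<^sup>+t. f z * (ennreal (1 / t) * indicator {norm z / exp 1<..norm z} t * indicator {0<..} t) \<partial>lborel) = f z"
      using AE_lborel_singleton[of "0::'a"] by (auto elim: eventually_mono)
  qed
  finally show ?thesis by simp
qed

lemma nn_integral_power_interval:
  assumes b: "b \<ge> 0"
  shows "(\<integral>\<^sup>+t. ennreal (t ^ q) * indicator {0<..b} t \<partial>lborel) = ennreal (b ^ (q + 1) / (real q + 1))"
proof -
  have "(\<integral>\<^sup>+t. ennreal (t ^ q) * indicator {0<..b} t \<partial>lborel) = (\<integral>\<^sup>+t. ennreal (t ^ q) * indicator {0..b} t \<partial>lborel)"
  proof (rule nn_integral_cong_AE)
    show "AE t in lborel. ennreal (t ^ q) * indicator {0<..b} t = ennreal (t ^ q) * indicator {0..b} t"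
      using AE_lborel_singleton[of "0::real"] by eventually_elim (auto simp: indicator_def)
  qed
  also have "\<dots> = ennreal (b ^ (q + 1) / (real q + 1) - 0 ^ (q + 1) / (real q + 1))"
  proof (rule nn_integral_FTC_Icc)
    fix x :: real
    show "((\<lambda>t. t ^ (q + 1) / (real q + 1)) has_real_derivative x ^ q) (at x)"
      using DERIV_cdivide[OF DERIV_pow[of "q + 1" x UNIV], of "real q + 1"] by (simp add: add.commute)
  qed (use b in auto)
  finally show ?thesis by simp
qed

section \<open>Volume and second moments in polar form\<close>

locale concave_profile_dim = concave_profile h R "DIM('a)" for h :: "'a::euclidean_space \<Rightarrow> real" and R :: real
begin

lemma mom_nn_pos:
  assumes x: "x \<noteq> 0"
  shows "(\<integral>\<^sup>+t. ennreal (t ^ q * h (t *\<^sub>R x) ^ DIM('a)) * indicator {0<..} t \<partial>lborel) = ennreal (mom q x)"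
  unfolding mom_nn[OF x, symmetric]
proof (rule nn_integral_cong_AE)
  show "AE t in lborel. ennreal (t ^ q * h (t *\<^sub>R x) ^ DIM('a)) * indicator {0<..} t = ennreal (t ^ q * h (t *\<^sub>R x) ^ DIM('a)) * indicator {0..} t"
    using AE_lborel_singleton[of "0::real"] by eventually_elim (auto simp: indicator_def)
qed

lemma power_DIM_Suc: "t ^ (DIM('a) - 1) * t = (t::real) ^ DIM('a)"
  by (rule power_minus_mult) simp

lemma integral_profile_polar:
  "(\<integral>\<^sup>+x. ennreal (h x ^ DIM('a)) \<partial>lborel) = (\<integral>\<^sup>+y. ennreal (mom (DIM('a) - 1) y) * indicator annulus y \<partial>lborel)"
proof (subst nn_integral_annulus_polar, simp, rule nn_integral_cong)
  fix y :: 'a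
  have "(\<integral>\<^sup>+t. ennreal (t ^ (DIM('a) - 1)) * ennreal (h (t *\<^sub>R y) ^ DIM('a)) * indicator {0<..} t \<partial>lborel) = ennreal (mom (DIM('a) - 1) y)" if "y \<in> annulus"
    unfolding mom_nn_pos[OF annulus_nonzero[OF that], symmetric]
    by (intro nn_integral_cong) (auto simp: indicator_def nonneg ennreal_mult)
  then show "(\<integral>\<^sup>+t. ennreal (t ^ (DIM('a) - 1)) * ennreal (h (t *\<^sub>R y) ^ DIM('a)) * indicator {0<..} t \<partial>lborel) * indicator annulus y = ennreal (mom (DIM('a) - 1) y) * indicator annulus y"
    by (auto simp: indicator_def)
qed

lemma integral_profile_second_moment_polar:
  "(\<integral>\<^sup>+x. ennreal ((x \<bullet> \<theta>)\<^sup>2 * h x ^ DIM('a)) \<partial>lborel) = (\<integral>\<^sup>+y. ennreal ((y \<bullet> \<theta>)\<^sup>2 * mom (DIM('a) + 1) y) * indicator annulus y \<partial>lborel)"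
proof (subst nn_integral_annulus_polar, simp, rule nn_integral_cong)
  fix y :: 'a
  have "(\<integral>\<^sup>+t. ennreal (t ^ (DIM('a) - 1)) * ennreal ((t *\<^sub>R y \<bullet> \<theta>)\<^sup>2 * h (t *\<^sub>R y) ^ DIM('a)) * indicator {0<..} t \<partial>lborel) = ennreal ((y \<bullet> \<theta>)\<^sup>2 * mom (DIM('a) + 1) y)" if "y \<in> annulus"
  proof -
    have "(\<integral>\<^sup>+t. ennreal (t ^ (DIM('a) - 1)) * ennreal ((t *\<^sub>R y \<bullet> \<theta>)\<^sup>2 * h (t *\<^sub>R y) ^ DIM('a)) * indicator {0<..} t \<partial>lborel)
      = (\<integral>\<^sup>+t. ennreal ((y \<bullet> \<theta>)\<^sup>2) * (ennreal (t ^ (DIM('a) + 1) * h (t *\<^sub>R y) ^ DIM('a)) * indicator {0<..} t) \<partial>lborel)"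
    proof (rule nn_integral_cong)
      fix t :: real
      have "t ^ (DIM('a) - 1) * ((t *\<^sub>R y \<bullet> \<theta>)\<^sup>2 * z) = (y \<bullet> \<theta>)\<^sup>2 * (t ^ (DIM('a) + 1) * z)" for z
      proof -
        have "t ^ (DIM('a) + 1) = t ^ (DIM('a) - 1) * t\<^sup>2"
          using power_DIM_Suc[of t] by (simp add: power2_eq_square flip: mult.assoc)
        then show ?thesis by (simp add: power_mult_distrib mult_ac)
      qed
      then show "ennreal (t ^ (DIM('a) - 1)) * ennreal ((t *\<^sub>R y \<bullet> \<theta>)\<^sup>2 * h (t *\<^sub>R y) ^ DIM('a)) * indicator {0<..} t
        = ennreal ((y \<bullet> \<theta>)\<^sup>2) * (ennreal (t ^ (DIM('a) + 1) * h (t *\<^sub>R y) ^ DIM('a)) * indicator {0<..} t)"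
        by (auto simp: indicator_def nonneg ennreal_mult[symmetric] simp del: power_Suc inner_scaleR_left)
    qed
    also have "\<dots> = ennreal ((y \<bullet> \<theta>)\<^sup>2) * ennreal (mom (DIM('a) + 1) y)"
      unfolding mom_nn_pos[OF annulus_nonzero[OF that], symmetric] by (rule nn_integral_cmult) simp
    finally show ?thesis using mom_nonneg by (simp add: ennreal_mult)
  qed
  then show "(\<integral>\<^sup>+t. ennreal (t ^ (DIM('a) - 1)) * ennreal ((t *\<^sub>R y \<bullet> \<theta>)\<^sup>2 * h (t *\<^sub>R y) ^ DIM('a)) * indicator {0<..} t \<partial>lborel) * indicator annulus y = ennreal ((y \<bullet> \<theta>)\<^sup>2 * mom (DIM('a) + 1) y) * indicator annulus y"
    by (auto simp: indicator_def)
qed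

lemma ball_gauge_measurable [measurable]: "ball_gauge \<in> borel_measurable borel"
  by (rule borel_measurable_continuous_onI[OF ball_gauge_continuous])

lemma ball_gauge_ray: "y \<noteq> 0 \<Longrightarrow> t > 0 \<Longrightarrow> ball_gauge (t *\<^sub>R y) \<le> 1 \<longleftrightarrow> t \<le> 1 / ball_gauge y"
  using ball_gauge_pos[of y] by (simp add: ball_gauge_scale pos_le_divide_eq)

lemma volume_gauge_body_polar:
  "emeasure lborel {x. ball_gauge x \<le> 1} = (\<integral>\<^sup>+y. ennreal ((1 / ball_gauge y) ^ DIM('a) / DIM('a)) * indicator annulus y \<partial>lborel)"
proof -
  have "emeasure lborel {x. ball_gauge x \<le> 1} = (\<integral>\<^sup>+x. indicator {x. ball_gauge x \<le> 1} x \<partial>lborel)"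
    by (rule nn_integral_indicator[symmetric]) simp
  also have "\<dots> = (\<integral>\<^sup>+y. ennreal ((1 / ball_gauge y) ^ DIM('a) / DIM('a)) * indicator annulus y \<partial>lborel)"
  proof (subst nn_integral_annulus_polar, simp, rule nn_integral_cong)
    fix y :: 'a
    have "(\<integral>\<^sup>+t. ennreal (t ^ (DIM('a) - 1)) * indicator {x. ball_gauge x \<le> 1} (t *\<^sub>R y) * indicator {0<..} t \<partial>lborel) = ennreal ((1 / ball_gauge y) ^ DIM('a) / DIM('a))" if y: "y \<in> annulus"
    proof -
      note y0 = annulus_nonzero[OF y]
      have "(\<integral>\<^sup>+t. ennreal (t ^ (DIM('a) - 1)) * indicator {x. ball_gauge x \<le> 1} (t *\<^sub>R y) * indicator {0<..} t \<partial>lborel)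
        = (\<integral>\<^sup>+t. ennreal (t ^ (DIM('a) - 1)) * indicator {0<..1 / ball_gauge y} t \<partial>lborel)"
        by (intro nn_integral_cong) (auto simp: indicator_def ball_gauge_ray[OF y0])
      also have "\<dots> = ennreal ((1 / ball_gauge y) ^ (DIM('a) - 1 + 1) / (real (DIM('a) - 1) + 1))"
        by (rule nn_integral_power_interval) (simp add: ball_gauge_nonneg)
      also have "DIM('a) - 1 + 1 = DIM('a)" by simp
      also have "real (DIM('a) - 1) + 1 = DIM('a)" by (simp add: of_nat_diff)
      finally show ?thesis .
    qed
    then show "(\<integral>\<^sup>+t. ennreal (t ^ (DIM('a) - 1)) * indicator {x. ball_gauge x \<le> 1} (t *\<^sub>R y) * indicator {0<..} t \<partial>lborel) * indicator annulus y = ennreal ((1 / ball_gauge y) ^ DIM('a) / DIM('a)) * indicator annulus y"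
      by (auto simp: indicator_def)
  qed
  finally show ?thesis .
qed

text \<open>On the ray of y both sides carry the weight t^(n-1) t^2, and the integral of t^(n+1) up
  to the boundary of the body is the moment of order n + 1 by definition of the gauge. The parameter
  n + 2 of the Ball body is the one for which this happens.\<close>

lemma second_moment_gauge_body:
  "(\<integral>\<^sup>+x. ennreal ((x \<bullet> \<theta>)\<^sup>2) * indicator {x. ball_gauge x \<le> 1} x \<partial>lborel) = (\<integral>\<^sup>+x. ennreal ((x \<bullet> \<theta>)\<^sup>2 * h x ^ DIM('a)) \<partial>lborel)"
  unfolding integral_profile_second_moment_polar
proof (subst nn_integral_annulus_polar, simp, rule nn_integral_cong)
  fix y :: 'a
  have "(\<integral>\<^sup>+t. ennreal (t ^ (DIM('a) - 1)) * (ennreal ((t *\<^sub>R y \<bullet> \<theta>)\<^sup>2) * indicator {x. ball_gauge x \<le> 1} (t *\<^sub>R y)) * indicator {0<..} t \<partial>lborel) = ennreal ((y \<bullet> \<theta>)\<^sup>2 * mom (DIM('a) + 1) y)" if y: "y \<in> annulus"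
  proof -
    note y0 = annulus_nonzero[OF y]
    have "(\<integral>\<^sup>+t. ennreal (t ^ (DIM('a) - 1)) * (ennreal ((t *\<^sub>R y \<bullet> \<theta>)\<^sup>2) * indicator {x. ball_gauge x \<le> 1} (t *\<^sub>R y)) * indicator {0<..} t \<partial>lborel)
      = (\<integral>\<^sup>+t. ennreal ((y \<bullet> \<theta>)\<^sup>2) * (ennreal (t ^ (DIM('a) + 1)) * indicator {0<..1 / ball_gauge y} t) \<partial>lborel)"
    proof (rule nn_integral_cong)
      fix t :: real
      have "t ^ (DIM('a) - 1) * (t *\<^sub>R y \<bullet> \<theta>)\<^sup>2 = (y \<bullet> \<theta>)\<^sup>2 * t ^ (DIM('a) + 1)"
      proof -
        have "t ^ (DIM('a) + 1) = t ^ (DIM('a) - 1) * t\<^sup>2"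
          using power_DIM_Suc[of t] by (simp add: power2_eq_square flip: mult.assoc)
        then show ?thesis by (simp add: power_mult_distrib mult_ac)
      qed
      then have "t > 0 \<Longrightarrow> ennreal (t ^ (DIM('a) - 1)) * ennreal ((t *\<^sub>R y \<bullet> \<theta>)\<^sup>2) = ennreal ((y \<bullet> \<theta>)\<^sup>2) * ennreal (t ^ (DIM('a) + 1))"
        by (simp add: ennreal_mult[symmetric] del: power_Suc inner_scaleR_left)
      then show "ennreal (t ^ (DIM('a) - 1)) * (ennreal ((t *\<^sub>R y \<bullet> \<theta>)\<^sup>2) * indicator {x. ball_gauge x \<le> 1} (t *\<^sub>R y)) * indicator {0<..} t
        = ennreal ((y \<bullet> \<theta>)\<^sup>2) * (ennreal (t ^ (DIM('a) + 1)) * indicator {0<..1 / ball_gauge y} t)"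
        by (auto simp: indicator_def ball_gauge_ray[OF y0] simp del: power_Suc inner_scaleR_left)
    qed
    also have "\<dots> = ennreal ((y \<bullet> \<theta>)\<^sup>2) * (\<integral>\<^sup>+t. ennreal (t ^ (DIM('a) + 1)) * indicator {0<..1 / ball_gauge y} t \<partial>lborel)"
      by (rule nn_integral_cmult) simp
    also have "(\<integral>\<^sup>+t. ennreal (t ^ (DIM('a) + 1)) * indicator {0<..1 / ball_gauge y} t \<partial>lborel) = ennreal ((1 / ball_gauge y) ^ (DIM('a) + 1 + 1) / (real (DIM('a) + 1) + 1))"
      by (rule nn_integral_power_interval) (simp add: ball_gauge_nonneg)
    also have "(1 / ball_gauge y) ^ (DIM('a) + 1 + 1) / (real (DIM('a) + 1) + 1) = mom (DIM('a) + 1) y"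
    proof -
      have "(1 / ball_gauge y) ^ (DIM('a) + 1 + 1) = (real DIM('a) + 2) * mom (DIM('a) + 1) y"
        using ball_gauge_power[of y] by (simp add: power_one_over)
      moreover have "real (DIM('a) + 1) + 1 = real DIM('a) + 2" by simp
      moreover have "c * m / c = m" if "c > 0" for c m :: real using that by simp
      then have "(real DIM('a) + 2) * mom (DIM('a) + 1) y / (real DIM('a) + 2) = mom (DIM('a) + 1) y" by simp
      ultimately show ?thesis by (simp only:)
    qed
    finally show ?thesis using mom_nonneg by (simp add: ennreal_mult)
  qed
  then show "(\<integral>\<^sup>+t. ennreal (t ^ (DIM('a) - 1)) * (ennreal ((t *\<^sub>R y \<bullet> \<theta>)\<^sup>2) * indicator {x. ball_gauge x \<le> 1} (t *\<^sub>R y)) * indicator {0<..} t \<partial>lborel) * indicator annulus y = ennreal ((y \<bullet> \<theta>)\<^sup>2 * mom (DIM('a) + 1) y) * indicator annulus y"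
    by (auto simp: indicator_def)
qed

end


section \<open>Volume of the Ball body\<close>

context concave_profile_dim
begin

lemma ray_concave:
  assumes "0 \<le> s" "s \<le> t" "h (t *\<^sub>R y) > 0"
  shows "h (s *\<^sub>R y) \<ge> 1 - (s / t) * (1 - h (t *\<^sub>R y))"
proof (cases "t = 0")
  case True
  then show ?thesis using assms one by simp
next
  case False
  then have t: "t > 0" using assms by simp
  have "(s / t) * h (t *\<^sub>R y) + (1 - s / t) * h 0 \<le> h ((s / t) *\<^sub>R (t *\<^sub>R y) + (1 - s / t) *\<^sub>R 0)"
    by (rule concave) (use assms one t in auto)
  then show ?thesis using t one by (simp add: algebra_simps)
qed


text \<open>With \<open>E\<close> the (n+2)-nd root of binom(2n+2, n), the normalised upper moment
  on the ray is (E / ball_gauge y)^(n+2) and the normalised lower moment is a^n.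
  \<open>Berwald\<close> thus compares E / ball_gauge y with a.\<close>

lemma ball_gauge_Berwald:
  assumes y: "y \<noteq> 0"
  shows "(root (DIM('a) + 2) (real ((2 * DIM('a) + 2) choose DIM('a))) / ball_gauge y) ^ DIM('a) \<le> real ((2 * DIM('a)) choose DIM('a)) * (DIM('a) * mom (DIM('a) - 1) y)"
    and "(root (DIM('a) + 2) (real ((2 * DIM('a) + 2) choose DIM('a))) / ball_gauge y) ^ DIM('a) = real ((2 * DIM('a)) choose DIM('a)) * (DIM('a) * mom (DIM('a) - 1) y)
      \<Longrightarrow> \<exists>a>0. \<forall>t\<ge>0. h (t *\<^sub>R y) = max 0 (1 - t / a)"
proof -
  let ?n = "DIM('a)" and ?k = "\<lambda>t. h (t *\<^sub>R y)"
  obtain a where a: "a > 0" "a ^ ?n = real ((2 * DIM('a)) choose DIM('a)) * (real ?n * integral {0..R / norm y} (\<lambda>t. t ^ (?n - 1) * ?k t ^ ?n))"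
    "real ((2 * DIM('a) + 2) choose DIM('a)) * ((real ?n + 2) * integral {0..R / norm y} (\<lambda>t. t ^ (?n + 1) * ?k t ^ ?n)) \<le> a ^ (?n + 2)"
    "real ((2 * DIM('a) + 2) choose DIM('a)) * ((real ?n + 2) * integral {0..R / norm y} (\<lambda>t. t ^ (?n + 1) * ?k t ^ ?n)) = a ^ (?n + 2) \<Longrightarrow> \<forall>t\<ge>0. ?k t = max 0 (1 - t / a)"
  proof (rule Berwald[of ?n "R / norm y" ?k, OF n _ cont_ray nonneg _ ray_concave ray_zero[OF y]])
    show "R / norm y > 0" using y R by simp
    show "h (0 *\<^sub>R y) = 1" by (simp add: one)
  qed (assumption+, rule that)
  define E where "E = root (?n + 2) (real ((2 * DIM('a) + 2) choose DIM('a)))"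
  have E: "E > 0" "E ^ (?n + 2) = real ((2 * DIM('a) + 2) choose DIM('a))" unfolding E_def
    by (simp add: real_root_gt_zero) (rule real_root_pow_pos2, auto)
  have g: "ball_gauge y > 0" by (rule ball_gauge_pos[OF y])
  have up: "(E / ball_gauge y) ^ (?n + 2) = real ((2 * DIM('a) + 2) choose DIM('a)) * ((real ?n + 2) * integral {0..R / norm y} (\<lambda>t. t ^ (?n + 1) * ?k t ^ ?n))"
  proof -
    have "(E / ball_gauge y) ^ (?n + 2) = E ^ (?n + 2) * (1 / ball_gauge y ^ (?n + 2))" by (simp add: power_divide)
    then show ?thesis unfolding E ball_gauge_power by (simp add: mom_def)
  qed
  have low: "a ^ ?n = real ((2 * DIM('a)) choose DIM('a)) * (?n * mom (?n - 1) y)" unfolding a(2) mom_def ..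
  have "(E / ball_gauge y) ^ Suc (?n + 1) \<le> a ^ Suc (?n + 1)" using a(3) up by simp
  then have le: "E / ball_gauge y \<le> a" by (rule power_le_imp_le_base) (use a(1) in simp)
  then show "(root (?n + 2) (real ((2 * DIM('a) + 2) choose DIM('a))) / ball_gauge y) ^ ?n \<le> real ((2 * DIM('a)) choose DIM('a)) * (?n * mom (?n - 1) y)"
    unfolding low[symmetric] E_def[symmetric] using E g by (intro power_mono) auto
  assume "(root (?n + 2) (real ((2 * DIM('a) + 2) choose DIM('a))) / ball_gauge y) ^ ?n = real ((2 * DIM('a)) choose DIM('a)) * (?n * mom (?n - 1) y)"
  then have "(E / ball_gauge y) ^ ?n = a ^ ?n" unfolding low E_def .
  then have "E / ball_gauge y = a" by (rule power_eq_imp_eq_base) (use a(1) E(1) g in auto)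
  then have "real ((2 * DIM('a) + 2) choose DIM('a)) * ((real ?n + 2) * integral {0..R / norm y} (\<lambda>t. t ^ (?n + 1) * ?k t ^ ?n)) = a ^ (?n + 2)"
    using up by simp
  then show "\<exists>a>0. \<forall>t\<ge>0. h (t *\<^sub>R y) = max 0 (1 - t / a)" using a by blast
qed

lemma ball_gauge_affine_ray:
  assumes y: "y \<noteq> 0" and a: "a > 0" "\<And>t. t \<ge> 0 \<Longrightarrow> h (t *\<^sub>R y) = max 0 (1 - t / a)"
  shows "(root (DIM('a) + 2) (real ((2 * DIM('a) + 2) choose DIM('a))) / ball_gauge y) ^ DIM('a) = real ((2 * DIM('a)) choose DIM('a)) * (DIM('a) * mom (DIM('a) - 1) y)"
proof -
  let ?n = "DIM('a)"
  have S: "R / norm y > 0" using R y by simp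
  have "max 0 (1 - (R / norm y) / a) = 0" using a(2)[of "R / norm y"] ray_zero[OF y, of "R / norm y"] S by simp
  then have "1 \<le> (R / norm y) / a" using max.cobounded2[of "1 - (R / norm y) / a" 0] by linarith
  then have aS: "a \<le> R / norm y" using pos_le_divide_eq[OF a(1), of 1 "R / norm y"] by (simp only: mult_1)
  have m: "mom q y = integral {0..R / norm y} (\<lambda>t. t ^ q * max 0 (1 - t / a) ^ ?n)" for q
    unfolding mom_def by (rule integral_cong) (use a in auto)
  have low: "real ((2 * DIM('a)) choose DIM('a)) * (real ?n * mom (?n - 1) y) = a ^ ?n" unfolding m by (rule cone_moment_lower[OF a(1) aS]) simp
  have "real ((2 * DIM('a) + 2) choose DIM('a)) * ((real ?n + 2) * mom (?n + 1) y) = a ^ (?n + 2)" unfolding m by (rule cone_moment_upper[OF a(1) aS]) simp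
  moreover have "root (?n + 2) (real ((2 * DIM('a) + 2) choose DIM('a))) ^ (?n + 2) = real ((2 * DIM('a) + 2) choose DIM('a))" by (rule real_root_pow_pos2) auto
  ultimately have "root (?n + 2) (real ((2 * DIM('a) + 2) choose DIM('a))) ^ (?n + 2) * (1 / ball_gauge y ^ (?n + 2)) = a ^ (?n + 2)" unfolding ball_gauge_power by simp
  then have "(root (?n + 2) (real ((2 * DIM('a) + 2) choose DIM('a))) / ball_gauge y) ^ (?n + 2) = a ^ (?n + 2)" by (simp add: power_divide)
  then have "root (?n + 2) (real ((2 * DIM('a) + 2) choose DIM('a))) / ball_gauge y = a"
    by (rule power_eq_imp_eq_base) (use a(1) ball_gauge_pos[OF y] in auto)
  then show ?thesis using low by simp
qed

section \<open>From almost every ray to every ray, and the volume bound\<close>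

definition affine_rays :: bool where
  "affine_rays \<longleftrightarrow> (\<forall>y. y \<noteq> 0 \<longrightarrow> (\<exists>a>0. \<forall>t\<ge>0. h (t *\<^sub>R y) = max 0 (1 - t / a)))"

text \<open>The slope c can be recovered from the value at one t0 where the limit profile is
  positive, so slopes converge along with the directions. Writing c instead of 1/a also admits slope
  0, which is excluded only later.\<close>

lemma closed_affine_ray: "closed {y. \<exists>c. \<forall>t\<ge>0. h (t *\<^sub>R y) = max 0 (1 - t * c)}"
  unfolding closed_sequential_limits
proof (intro allI impI, elim conjE)
  fix f :: "nat \<Rightarrow> 'a" and y
  assume f: "\<forall>k. f k \<in> {y. \<exists>c. \<forall>t\<ge>0. h (t *\<^sub>R y) = max 0 (1 - t * c)}" and lim: "f \<longlonglongrightarrow> y"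
  then have "\<forall>k. \<exists>c. \<forall>t\<ge>0. h (t *\<^sub>R f k) = max 0 (1 - t * c)" by simp
  then have "\<exists>c. \<forall>k. \<forall>t\<ge>0. h (t *\<^sub>R f k) = max 0 (1 - t * c k)" by (rule choice)
  then obtain c where c: "\<And>k t. t \<ge> 0 \<Longrightarrow> h (t *\<^sub>R f k) = max 0 (1 - t * c k)" by blast
  have conv: "(\<lambda>k. h (t *\<^sub>R f k)) \<longlonglongrightarrow> h (t *\<^sub>R y)" for t
    by (rule continuous_on_tendsto_compose[OF cont]) (auto intro!: tendsto_intros lim)
  obtain d where d: "d > 0" "\<And>t. 0 \<le> t \<Longrightarrow> t < d \<Longrightarrow> h (t *\<^sub>R y) > 0" using ray_positive by blast
  define t0 where "t0 = d / 2"
  have t0: "t0 > 0" "h (t0 *\<^sub>R y) > 0" using d by (auto simp: t0_def)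
  have ev: "\<forall>\<^sub>F k in sequentially. c k = (1 - h (t0 *\<^sub>R f k)) / t0"
    using order_tendstoD(1)[OF conv t0(2)]
  proof eventually_elim
    case (elim k)
    then have "h (t0 *\<^sub>R f k) = 1 - t0 * c k" using c[of t0 k] t0 by (simp add: max_def split: if_splits)
    then show ?case using t0 by simp
  qed
  have "(\<lambda>k. (1 - h (t0 *\<^sub>R f k)) / t0) \<longlonglongrightarrow> (1 - h (t0 *\<^sub>R y)) / t0" using t0 by (intro tendsto_intros conv) auto
  then have clim: "c \<longlonglongrightarrow> (1 - h (t0 *\<^sub>R y)) / t0" using ev by (simp add: tendsto_cong)
  have "h (t *\<^sub>R y) = max 0 (1 - t * ((1 - h (t0 *\<^sub>R y)) / t0))" if t: "t \<ge> 0" for t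
  proof (rule LIMSEQ_unique[OF conv])
    show "(\<lambda>k. h (t *\<^sub>R f k)) \<longlonglongrightarrow> max 0 (1 - t * ((1 - h (t0 *\<^sub>R y)) / t0))"
      unfolding c[OF t] by (intro tendsto_intros clim)
  qed
  then show "y \<in> {y. \<exists>c. \<forall>t\<ge>0. h (t *\<^sub>R y) = max 0 (1 - t * c)}" by blast
qed

text \<open>The bad directions inside the open annulus form an open null set, hence none exist, and
  every ray meets the open annulus. The slope is positive because the profile vanishes far
  out.\<close>

lemma affine_raysI_annulus:
  assumes AE: "AE y in lborel. y \<in> annulus \<longrightarrow> (\<exists>c. \<forall>t\<ge>0. h (t *\<^sub>R y) = max 0 (1 - t * c))"
  shows affine_rays
proof -
  let ?G = "{y. \<exists>c. \<forall>t\<ge>0. h (t *\<^sub>R y) = max 0 (1 - t * c)}"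
  let ?U = "{y::'a. 1 < norm y} \<inter> {y. norm y < exp 1}"
  have oU: "open (?U - ?G)"
    by (intro open_Diff closed_affine_ray open_Int open_Collect_less continuous_intros)
  have "?U - ?G = {}"
  proof (rule ccontr)
    assume ne: "?U - ?G \<noteq> {}"
    from AE have "AE y in lebesgue. y \<in> annulus \<longrightarrow> y \<in> ?G" by (simp add: AE_completion)
    then have ae: "AE y in lebesgue. y \<notin> ?U - ?G" by eventually_elim (auto simp: annulus_def)
    have "?U - ?G \<in> sets lebesgue" using oU by (intro sets_completionI_sets) auto
    then have "?U - ?G \<in> null_sets lebesgue" using ae AE_iff_null_sets by blast
    then have "negligible (?U - ?G)" by (rule negligible_iff_null_sets[THEN iffD2])
    then show False using open_not_negligible[OF oU ne] by simp
  qed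
  then have UG: "?U \<subseteq> ?G" by blast
  show ?thesis unfolding affine_rays_def
  proof (intro allI impI)
    fix y :: 'a assume y: "y \<noteq> 0"
    \<comment> \<open>Moves y along its ray to norm (1 + exp 1) / 2, midway through the
      annulus.\<close>
    define \<rho> where "\<rho> = (1 + exp 1) / 2 / norm y"
    have e1: "exp (1::real) > 1" by simp
    have \<rho>: "\<rho> > 0" unfolding \<rho>_def using y by (intro divide_pos_pos) (auto intro: add_pos_pos)
    have n: "norm (\<rho> *\<^sub>R y) = (1 + exp 1) / 2" using y \<rho> unfolding \<rho>_def by (simp add: abs_of_pos)
    have "1 < norm (\<rho> *\<^sub>R y)" "norm (\<rho> *\<^sub>R y) < exp 1" unfolding n using e1 by simp_all
    then have "\<rho> *\<^sub>R y \<in> ?U" by blast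
    then obtain c where c: "\<And>t. t \<ge> 0 \<Longrightarrow> h (t *\<^sub>R \<rho> *\<^sub>R y) = max 0 (1 - t * c)" using UG by blast
    have hy: "h (t *\<^sub>R y) = max 0 (1 - t * (c / \<rho>))" if "t \<ge> 0" for t
      using c[of "t / \<rho>"] that \<rho> by simp
    have "c / \<rho> > 0"
    proof (rule ccontr)
      assume "\<not> c / \<rho> > 0"
      then have "R / norm y * (c / \<rho>) \<le> 0" using R by (intro mult_nonneg_nonpos) auto
      then have "h ((R / norm y) *\<^sub>R y) > 0" using hy[of "R / norm y"] R by simp
      then show False using ray_zero[OF y, of "R / norm y"] by simp
    qed
    then show "\<exists>a>0. \<forall>t\<ge>0. h (t *\<^sub>R y) = max 0 (1 - t / a)"
      using hy \<rho> by (intro exI[of _ "\<rho> / c"]) (auto simp: zero_less_divide_iff)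
  qed
qed

text \<open>\<open>F\<close> and \<open>G\<close> are the polar integrands of the two sides, and
  \<open>ball_gauge_Berwald\<close> gives \<open>F\<close> \<le> \<open>G\<close> on every ray. The
  integrals are finite, so equality forces \<open>F\<close> = \<open>G\<close> almost everywhere,
  which makes almost all rays affine.\<close>

lemma gauge_body_volume_le:
  assumes total: "(\<integral>\<^sup>+x. ennreal (h x ^ DIM('a)) \<partial>lborel) = 1"
  shows "root (DIM('a) + 2) (real ((2 * DIM('a) + 2) choose DIM('a))) ^ DIM('a) * measure lebesgue {x. ball_gauge x \<le> 1} \<le> real ((2 * DIM('a)) choose DIM('a))"
    and "root (DIM('a) + 2) (real ((2 * DIM('a) + 2) choose DIM('a))) ^ DIM('a) * measure lebesgue {x. ball_gauge x \<le> 1} = real ((2 * DIM('a)) choose DIM('a)) \<longleftrightarrow> affine_rays"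
proof -
  let ?n = "DIM('a)" and ?M = "{x. ball_gauge x \<le> 1}"
  define E where "E = root (?n + 2) (real ((2 * DIM('a) + 2) choose DIM('a)))"
  have E: "E > 0" unfolding E_def by (simp add: real_root_gt_zero)
  have cM: "compact ?M" using convex_body_ball_gauge by (simp add: convex_body_def)
  define F where "F y = ennreal ((E / ball_gauge y) ^ ?n / ?n) * indicator annulus y" for y
  \<comment> \<open>Written with the inner integral instead of \<open>mom\<close>, so that its
    measurability in y comes from the product structure.\<close>
  define G where "G y = (\<integral>\<^sup>+t. ennreal (real ((2 * DIM('a)) choose DIM('a))) * (ennreal (t ^ (?n - 1) * h (t *\<^sub>R y) ^ ?n) * indicator {0<..} t) \<partial>lborel) * indicator annulus y" for y
  have Fm: "F \<in> borel_measurable lborel" unfolding F_def by measurable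
  have Gm: "G \<in> borel_measurable lborel" unfolding G_def by measurable
  have Geq: "G y = ennreal (real ((2 * DIM('a)) choose DIM('a)) * mom (?n - 1) y) * indicator annulus y" for y
  proof (cases "y \<in> annulus")
    case True
    have "G y = ennreal (real ((2 * DIM('a)) choose DIM('a))) * ennreal (mom (?n - 1) y) * indicator annulus y"
      unfolding G_def mom_nn_pos[OF annulus_nonzero[OF True], symmetric] by (subst nn_integral_cmult) auto
    then show ?thesis using mom_nonneg by (simp add: ennreal_mult)
  qed (simp add: G_def)
  have intG: "integral\<^sup>N lborel G = ennreal (real ((2 * DIM('a)) choose DIM('a)))"
  proof -
    have "integral\<^sup>N lborel G = (\<integral>\<^sup>+y. ennreal (real ((2 * DIM('a)) choose DIM('a))) * (ennreal (mom (?n - 1) y) * indicator annulus y) \<partial>lborel)"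
      unfolding Geq using mom_nonneg by (intro nn_integral_cong) (simp add: ennreal_mult mult.assoc)
    also have "\<dots> = ennreal (real ((2 * DIM('a)) choose DIM('a))) * (\<integral>\<^sup>+y. ennreal (mom (?n - 1) y) * indicator annulus y \<partial>lborel)"
    proof (rule nn_integral_cmult)
      have "(\<lambda>y. (\<integral>\<^sup>+t. ennreal (t ^ (?n - 1) * h (t *\<^sub>R y) ^ ?n) * indicator {0<..} t \<partial>lborel) * indicator annulus y) \<in> borel_measurable lborel"
        by measurable
      moreover have "(\<lambda>y. (\<integral>\<^sup>+t. ennreal (t ^ (?n - 1) * h (t *\<^sub>R y) ^ ?n) * indicator {0<..} t \<partial>lborel) * indicator annulus y)
          = (\<lambda>y. ennreal (mom (?n - 1) y) * indicator annulus y)"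
      proof
        fix y :: 'a
        show "(\<integral>\<^sup>+t. ennreal (t ^ (?n - 1) * h (t *\<^sub>R y) ^ ?n) * indicator {0<..} t \<partial>lborel) * indicator annulus y
          = ennreal (mom (?n - 1) y) * indicator annulus y"
        proof (cases "y \<in> annulus")
          case True
          show ?thesis unfolding mom_nn_pos[OF annulus_nonzero[OF True]] ..
        qed simp
      qed
      ultimately show "(\<lambda>y. ennreal (mom (?n - 1) y) * indicator annulus y) \<in> borel_measurable lborel" by (simp only:)
    qed
    also have "\<dots> = ennreal (real ((2 * DIM('a)) choose DIM('a)))" unfolding integral_profile_polar[symmetric] total by simp
    finally show ?thesis .
  qed
  have intF: "integral\<^sup>N lborel F = ennreal (E ^ ?n * measure lebesgue ?M)"
  proof -
    have "integral\<^sup>N lborel F = (\<integral>\<^sup>+y. ennreal (E ^ ?n) * (ennreal ((1 / ball_gauge y) ^ ?n / ?n) * indicator annulus y) \<partial>lborel)"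
    proof (rule nn_integral_cong)
      fix y
      have "(E / ball_gauge y) ^ ?n / ?n = E ^ ?n * ((1 / ball_gauge y) ^ ?n / ?n)" by (simp add: power_divide)
      then have "ennreal ((E / ball_gauge y) ^ ?n / ?n) = ennreal (E ^ ?n) * ennreal ((1 / ball_gauge y) ^ ?n / ?n)"
        using E ball_gauge_nonneg[of y] by (simp only:) (rule ennreal_mult, auto)
      then show "F y = ennreal (E ^ ?n) * (ennreal ((1 / ball_gauge y) ^ ?n / ?n) * indicator annulus y)"
        unfolding F_def by (simp only: mult.assoc)
    qed
    also have "\<dots> = ennreal (E ^ ?n) * emeasure lborel ?M"
      unfolding volume_gauge_body_polar by (rule nn_integral_cmult) measurable
    also have "emeasure lborel ?M = ennreal (measure lebesgue ?M)"
    proof -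
      have "emeasure lborel ?M = ennreal (measure lborel ?M)"
        using emeasure_bounded_finite[OF compact_imp_bounded[OF cM]] by (intro emeasure_eq_ennreal_measure) auto
      then show ?thesis using cM by (simp add: borel_compact)
    qed
    also have "ennreal (E ^ ?n) * ennreal (measure lebesgue ?M) = ennreal (E ^ ?n * measure lebesgue ?M)"
      using E by (intro ennreal_mult[symmetric]) auto
    finally show ?thesis .
  qed
  have FG: "F y \<le> G y" for y
  proof (cases "y \<in> annulus")
    case True
    have "(E / ball_gauge y) ^ ?n / ?n \<le> real ((2 * DIM('a)) choose DIM('a)) * (?n * mom (?n - 1) y) / ?n"
      using ball_gauge_Berwald(1)[OF annulus_nonzero[OF True]] unfolding E_def by (intro divide_right_mono) auto
    then show ?thesis unfolding Geq F_def using True by (auto intro!: ennreal_leI)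
  qed (simp add: F_def)
  have "ennreal (E ^ ?n * measure lebesgue ?M) \<le> ennreal (real ((2 * DIM('a)) choose DIM('a)))"
    unfolding intF[symmetric] intG[symmetric] by (intro nn_integral_mono FG)
  then show "root (?n + 2) (real ((2 * DIM('a) + 2) choose DIM('a))) ^ ?n * measure lebesgue ?M \<le> real ((2 * DIM('a)) choose DIM('a))" unfolding E_def[symmetric] by (simp add: ennreal_le_iff)
  have eqFG: "E ^ ?n * measure lebesgue ?M = real ((2 * DIM('a)) choose DIM('a)) \<longleftrightarrow> integral\<^sup>N lborel F = integral\<^sup>N lborel G"
    unfolding intF intG using E by (subst ennreal_inj) auto
  have "integral\<^sup>N lborel F = integral\<^sup>N lborel G \<longleftrightarrow> affine_rays"
  proof
    assume eq: "integral\<^sup>N lborel F = integral\<^sup>N lborel G"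
    have "(\<integral>\<^sup>+y. G y - F y \<partial>lborel) = integral\<^sup>N lborel G - integral\<^sup>N lborel F"
      by (rule nn_integral_diff[OF Gm Fm]) (use FG intF in auto)
    then have "(\<integral>\<^sup>+y. G y - F y \<partial>lborel) = 0" using eq intG by simp
    then have "AE y in lborel. G y - F y = 0" using Gm Fm by (subst (asm) nn_integral_0_iff_AE) auto
    then have "AE y in lborel. y \<in> annulus \<longrightarrow> (\<exists>c. \<forall>t\<ge>0. h (t *\<^sub>R y) = max 0 (1 - t * c))"
    proof eventually_elim
      case (elim y)
      show ?case
      proof
        assume y: "y \<in> annulus"
        have "F y \<noteq> top" using y by (simp add: F_def)
        then have "G y \<le> F y" using elim by (metis diff_eq_0_iff_ennreal FG order_refl)
        then have "real ((2 * DIM('a)) choose DIM('a)) * mom (?n - 1) y \<le> (E / ball_gauge y) ^ ?n / ?n"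
          unfolding Geq F_def using y ball_gauge_nonneg[of y] E by (simp add: ennreal_le_iff)
        then have "real ((2 * DIM('a)) choose DIM('a)) * (?n * mom (?n - 1) y) \<le> (E / ball_gauge y) ^ ?n" by (simp add: pos_le_divide_eq mult_ac)
        then have "(root (?n + 2) (real ((2 * DIM('a) + 2) choose DIM('a))) / ball_gauge y) ^ ?n = real ((2 * DIM('a)) choose DIM('a)) * (?n * mom (?n - 1) y)"
          using ball_gauge_Berwald(1)[OF annulus_nonzero[OF y]] unfolding E_def by (intro antisym)
        then obtain a where "a > 0" "\<forall>t\<ge>0. h (t *\<^sub>R y) = max 0 (1 - t / a)"
          using ball_gauge_Berwald(2)[OF annulus_nonzero[OF y]] by blast
        then show "\<exists>c. \<forall>t\<ge>0. h (t *\<^sub>R y) = max 0 (1 - t * c)" by (intro exI[of _ "1 / a"]) auto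
      qed
    qed
    then show affine_rays by (rule affine_raysI_annulus)
  next
    assume rays: affine_rays
    show "integral\<^sup>N lborel F = integral\<^sup>N lborel G"
    proof (rule nn_integral_cong)
      fix y :: 'a
      show "F y = G y"
      proof (cases "y \<in> annulus")
        case True
        obtain a where a: "a > 0" "\<And>t. t \<ge> 0 \<Longrightarrow> h (t *\<^sub>R y) = max 0 (1 - t / a)"
          using rays annulus_nonzero[OF True] unfolding affine_rays_def by blast
        have e: "(E / ball_gauge y) ^ ?n = real ((2 * DIM('a)) choose DIM('a)) * (?n * mom (?n - 1) y)"
          unfolding E_def by (rule ball_gauge_affine_ray[OF annulus_nonzero[OF True] a(1)]) (rule a(2))
        show ?thesis unfolding Geq F_def e by simp
      qed (simp add: F_def G_def)
    qed
  qed
  then show "root (?n + 2) (real ((2 * DIM('a) + 2) choose DIM('a))) ^ ?n * measure lebesgue ?M = real ((2 * DIM('a)) choose DIM('a)) \<longleftrightarrow> affine_rays"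
    using eqFG unfolding E_def by blast
qed

end


section \<open>The covariogram\<close>

lemma covariogram_nonneg: "covariogram K x \<ge> 0"
  by (simp add: covariogram_def)

lemma covariogram_0: "covariogram K 0 = measure lebesgue K"
  by (simp add: covariogram_def)

lemma mem_translate_iff: "y \<in> (+) x ` K \<longleftrightarrow> y - x \<in> (K :: 'a::real_vector set)"
  by (auto intro: image_eqI[of _ _ "y - x"])

lemma compact_translate_Int:
  fixes K :: "'a::euclidean_space set"
  shows "compact K \<Longrightarrow> compact (K \<inter> (+) x ` K)"
  by (intro compact_Int compact_translation)

lemma convex_translate_Int:
  fixes K :: "'a::euclidean_space set"
  shows "convex K \<Longrightarrow> convex (K \<inter> (+) x ` K)"
  by (intro convex_Int convex_translation)

lemma convex_body_translate_Int:
  fixes K :: "'a::euclidean_space set"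
  assumes "compact K" "convex K" "covariogram K x > 0"
  shows "convex_body (K \<inter> (+) x ` K)"
  unfolding convex_body_def
proof (intro conjI compact_translate_Int convex_translate_Int assms)
  have "\<not> negligible (K \<inter> (+) x ` K)"
    using assms(3) negligible_imp_measure0 unfolding covariogram_def by fastforce
  then show "interior (K \<inter> (+) x ` K) \<noteq> {}"
    using negligible_convex_interior[OF convex_translate_Int[OF assms(2)]] by blast
qed

lemma covariogram_support:
  fixes K :: "'a::euclidean_space set"
  assumes "compact K"
  obtains R where "R > 0" "\<And>x. norm x \<ge> R \<Longrightarrow> covariogram K x = 0"
proof -
  obtain M where M: "M > 0" "\<And>x. x \<in> K \<Longrightarrow> norm x \<le> M" using compact_imp_bounded[OF assms] bounded_pos by metis
  have "covariogram K x = 0" if x: "norm x \<ge> 2 * M + 1" for x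
  proof -
    have "K \<inter> (+) x ` K = {}"
    proof (rule ccontr)
      assume "K \<inter> (+) x ` K \<noteq> {}"
      then obtain y where "y \<in> K" "y - x \<in> K" using mem_translate_iff by blast
      then show False using M(2)[of y] M(2)[of "y - x"] x norm_triangle_ineq4[of y "y - x"] by simp
    qed
    then show ?thesis by (simp add: covariogram_def)
  qed
  then show ?thesis using that[of "2 * M + 1"] M by simp
qed

text \<open>Off the translated boundary of K, which is negligible by convexity, membership in the
  moving translate is eventually constant.\<close>

lemma covariogram_continuous:
  fixes K :: "'a::euclidean_space set"
  assumes K: "compact K" "convex K"
  shows "continuous_on UNIV (covariogram K)"
proof (rule continuous_on_sequentiallyI)
  fix u :: "nat \<Rightarrow> 'a" and d assume u: "u \<longlonglongrightarrow> d"
  have m: "K \<inter> (+) x ` K \<in> sets lebesgue" for x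
    using lmeasurable_compact[OF compact_translate_Int[OF K(1)]] by (rule fmeasurableD)
  show "(\<lambda>n. covariogram K (u n)) \<longlonglongrightarrow> covariogram K d" unfolding covariogram_def
  proof (rule measure_tendsto_AE[where C=K and N="(+) d ` frontier K"])
    show "negligible ((+) d ` frontier K)" by (intro negligible_translation negligible_convex_frontier K)
    fix x assume "x \<notin> (+) d ` frontier K"
    then have x: "x - d \<notin> frontier K" by (simp add: mem_translate_iff)
    have lim: "(\<lambda>k. x - u k) \<longlonglongrightarrow> x - d" by (intro tendsto_intros u)
    have clK: "closure K = K" using K by (simp add: compact_imp_closed)
    consider "x - d \<in> interior K" | "x - d \<in> - K" using x clK unfolding frontier_def by blast
    then show "\<forall>\<^sub>F k in sequentially. (x \<in> K \<inter> (+) (u k) ` K) = (x \<in> K \<inter> (+) d ` K)"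
    proof cases
      case 1
      then have "\<forall>\<^sub>F k in sequentially. x - u k \<in> interior K" using lim by (intro topological_tendstoD[OF lim]) auto
      then show ?thesis using 1 interior_subset[of K] by (auto simp: mem_translate_iff elim!: eventually_mono)
    next
      case 2
      have "open (- K)" using K by (simp add: compact_imp_closed open_Compl)
      then have "\<forall>\<^sub>F k in sequentially. x - u k \<in> - K" using 2 by (intro topological_tendstoD[OF lim]) auto
      then show ?thesis using 2 by (auto simp: mem_translate_iff elim!: eventually_mono)
    qed
  qed (use m K lmeasurable_compact in auto)
qed

text \<open>By convexity the Minkowski combination of the two intersections lies in the intersection
  for the mean translation. Positivity of both values makes the intersections convex bodies, as
  \<open>Brunn_Minkowski\<close> requires.\<close>

lemma covariogram_root_concave:
  fixes K :: "'a::euclidean_space set"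
  assumes K: "compact K" "convex K" and xy: "covariogram K x > 0" "covariogram K y > 0" and l: "0 \<le> l" "l \<le> 1"
  shows "l * root DIM('a) (covariogram K x) + (1 - l) * root DIM('a) (covariogram K y)
    \<le> root DIM('a) (covariogram K (l *\<^sub>R x + (1 - l) *\<^sub>R y))"
proof (cases "l = 0 \<or> l = 1")
  case True then show ?thesis by auto
next
  case False
  then have l: "0 < l" "l < 1" using l by auto
  let ?r = "root DIM('a)"
  have scaled: "convex_body ((\<lambda>z. s *\<^sub>R z) ` (K \<inter> (+) a ` K))" and
    msc: "?r (measure lebesgue ((\<lambda>z. s *\<^sub>R z) ` (K \<inter> (+) a ` K))) = s * ?r (covariogram K a)"
    if s: "0 < s" and a: "covariogram K a > 0" for s a
  proof -
    have b: "convex_body (K \<inter> (+) a ` K)" by (rule convex_body_translate_Int[OF K a])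
    have lT: "linear (\<lambda>z::'a. s *\<^sub>R z)" by (simp add: linear_iff scaleR_right_distrib)
    have iT: "inj (\<lambda>z::'a. s *\<^sub>R z)" using s by (simp add: inj_def)
    show "convex_body ((\<lambda>z. s *\<^sub>R z) ` (K \<inter> (+) a ` K))"
      using b interior_injective_linear_image[OF lT iT] unfolding convex_body_def
      by (simp add: compact_scaling convex_scaling)
    have "measure lebesgue ((\<lambda>z. 0 + s *\<^sub>R z) ` (K \<inter> (+) a ` K)) = s ^ DIM('a) * covariogram K a"
      unfolding covariogram_def by (rule homothety_measure) (use b s in \<open>auto simp: convex_body_def\<close>)
    then have "?r (measure lebesgue ((\<lambda>z. s *\<^sub>R z) ` (K \<inter> (+) a ` K))) = ?r (s ^ DIM('a)) * ?r (covariogram K a)"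
      by (simp add: real_root_mult)
    also have "?r (s ^ DIM('a)) = s" by (rule real_root_power_cancel) (use s in auto)
    finally show "?r (measure lebesgue ((\<lambda>z. s *\<^sub>R z) ` (K \<inter> (+) a ` K))) = s * ?r (covariogram K a)" .
  qed
  let ?A = "(\<lambda>z. l *\<^sub>R z) ` (K \<inter> (+) x ` K)" and ?B = "(\<lambda>z. (1 - l) *\<^sub>R z) ` (K \<inter> (+) y ` K)"
  let ?m = "l *\<^sub>R x + (1 - l) *\<^sub>R y"
  have l1: "0 < 1 - l" using l by simp
  have "l * ?r (covariogram K x) + (1 - l) * ?r (covariogram K y) = ?r (measure lebesgue ?A) + ?r (measure lebesgue ?B)"
    unfolding msc[OF l(1) xy(1)] msc[OF l1 xy(2)] ..
  also have "\<dots> \<le> ?r (measure lebesgue (?A + ?B))"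
    by (rule Brunn_Minkowski[OF scaled[OF l(1) xy(1)] scaled[OF l1 xy(2)]])
  also have "\<dots> \<le> ?r (covariogram K ?m)"
    unfolding covariogram_def
  proof (intro real_root_le_mono measure_mono_fmeasurable)
    show "?A + ?B \<subseteq> K \<inter> (+) ?m ` K"
    proof
      fix z assume "z \<in> ?A + ?B"
      then obtain a b where ab: "a \<in> K" "a - x \<in> K" "b \<in> K" "b - y \<in> K" "z = l *\<^sub>R a + (1 - l) *\<^sub>R b"
        by (auto elim!: set_plus_elim simp: mem_translate_iff)
      have "z \<in> K" unfolding ab(5) by (rule convexD[OF K(2) ab(1,3)]) (use l in auto)
      moreover have "z - ?m = l *\<^sub>R (a - x) + (1 - l) *\<^sub>R (b - y)" unfolding ab(5) by (simp add: algebra_simps)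
      moreover have "l *\<^sub>R (a - x) + (1 - l) *\<^sub>R (b - y) \<in> K" by (rule convexD[OF K(2) ab(2,4)]) (use l in auto)
      ultimately show "z \<in> K \<inter> (+) ?m ` K" by (simp add: mem_translate_iff)
    qed
    show "?A + ?B \<in> sets lebesgue"
      by (intro fmeasurableD lmeasurable_compact compact_set_plus compact_scaling compact_translate_Int K)
    show "K \<inter> (+) ?m ` K \<in> lmeasurable" by (intro lmeasurable_compact compact_translate_Int K)
  qed simp
  finally show ?thesis .
qed

section \<open>Integration against the covariogram\<close>

lemma lin_scale_uminus: "lin_scale (uminus :: 'a::euclidean_space \<Rightarrow> 'a) 1"
proof -
  have T: "linear (uminus :: 'a \<Rightarrow> 'a)" "bij (uminus :: 'a \<Rightarrow> 'a)"
    by (auto simp: linear_iff intro!: o_bij[where g=uminus])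
  obtain c where c: "lin_scale (uminus :: 'a \<Rightarrow> 'a) c" using lin_scale_exists[OF T] .
  have "c = 1 ^ DIM('a)" by (rule lin_scale_conformal[OF c T]) auto
  then show ?thesis using c by simp
qed

lemma nn_integral_lborel_reflect:
  fixes f :: "'a::euclidean_space \<Rightarrow> ennreal"
  assumes [measurable]: "f \<in> borel_measurable borel"
  shows "(\<integral>\<^sup>+x. f (a - x) \<partial>lborel) = (\<integral>\<^sup>+x. f x \<partial>lborel)"
proof -
  have "(\<integral>\<^sup>+x. f (a + x) \<partial>lborel) = (\<integral>\<^sup>+x. f (a + x) \<partial>density (distr lborel borel uminus) (\<lambda>_. ennreal 1))"
    using lin_scale_uminus unfolding lin_scale_def by metis
  also have "\<dots> = (\<integral>\<^sup>+x. f (a - x) \<partial>lborel)"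
    by (subst nn_integral_density) (auto simp: nn_integral_distr)
  finally show ?thesis using nn_integral_lborel_translate[of f a] by simp
qed

text \<open>The covariogram is the density of the differences y - z with y and z in K: substitute x
  = y - z after exchanging the integrals.\<close>

lemma covariogram_Fubini:
  fixes K :: "'a::euclidean_space set" and f :: "'a \<Rightarrow> ennreal"
  assumes K: "compact K" and [measurable]: "f \<in> borel_measurable borel"
  shows "(\<integral>\<^sup>+x. f x * ennreal (covariogram K x) \<partial>lborel)
    = (\<integral>\<^sup>+y. (\<integral>\<^sup>+z. f (y - z) * indicator K z \<partial>lborel) * indicator K y \<partial>lborel)"
proof -
  have [measurable]: "K \<in> sets borel" using K by (rule borel_compact)
  have cov: "ennreal (covariogram K x) = (\<integral>\<^sup>+y. indicator K y * indicator K (y - x) \<partial>lborel)" for x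
  proof -
    have c: "compact (K \<inter> (+) x ` K)" by (rule compact_translate_Int[OF K])
    have "(\<integral>\<^sup>+y. indicator K y * indicator K (y - x) \<partial>lborel) = (\<integral>\<^sup>+y. indicator (K \<inter> (+) x ` K) y \<partial>lborel)"
      by (intro nn_integral_cong) (auto simp: indicator_def mem_translate_iff)
    also have "\<dots> = emeasure lborel (K \<inter> (+) x ` K)" using borel_compact[OF c] by simp
    also have "\<dots> = ennreal (measure lborel (K \<inter> (+) x ` K))"
      using emeasure_bounded_finite[OF compact_imp_bounded[OF c]] by (intro emeasure_eq_ennreal_measure) auto
    also have "measure lborel (K \<inter> (+) x ` K) = covariogram K x"
      unfolding covariogram_def using borel_compact[OF c] by simp
    finally show ?thesis ..
  qed
  have "(\<integral>\<^sup>+x. f x * ennreal (covariogram K x) \<partial>lborel) = (\<integral>\<^sup>+x. (\<integral>\<^sup>+y. f x * (indicator K y * indicator K (y - x)) \<partial>lborel) \<partial>lborel)"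
    unfolding cov by (subst nn_integral_cmult) auto
  also have "\<dots> = (\<integral>\<^sup>+y. (\<integral>\<^sup>+x. f x * (indicator K y * indicator K (y - x)) \<partial>lborel) \<partial>lborel)"
    by (rule lborel_pair.Fubini'[symmetric]) simp
  also have "\<dots> = (\<integral>\<^sup>+y. (\<integral>\<^sup>+z. f (y - z) * indicator K z \<partial>lborel) * indicator K y \<partial>lborel)"
  proof (rule nn_integral_cong)
    fix y :: 'a
    have "(\<integral>\<^sup>+x. f x * (indicator K y * indicator K (y - x)) \<partial>lborel) = (\<integral>\<^sup>+z. f (y - z) * (indicator K y * indicator K (y - (y - z))) \<partial>lborel)"
      by (rule nn_integral_lborel_reflect[symmetric]) simp
    also have "\<dots> = (\<integral>\<^sup>+z. f (y - z) * indicator K z * indicator K y \<partial>lborel)"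
      by (intro nn_integral_cong) (simp add: mult_ac)
    also have "\<dots> = (\<integral>\<^sup>+z. f (y - z) * indicator K z \<partial>lborel) * indicator K y"
      by (rule nn_integral_multc) simp
    finally show "(\<integral>\<^sup>+x. f x * (indicator K y * indicator K (y - x)) \<partial>lborel) = (\<integral>\<^sup>+z. f (y - z) * indicator K z \<partial>lborel) * indicator K y" .
  qed
  finally show ?thesis .
qed

lemma nn_integral_compact:
  fixes F :: "'a::euclidean_space \<Rightarrow> real"
  assumes K: "compact K" and F: "continuous_on UNIV F" "\<And>x. F x \<ge> 0"
  shows "(\<integral>\<^sup>+x. ennreal (F x) * indicator K x \<partial>lborel) = ennreal (LINT x:K|lebesgue. F x)"
proof -
  have i: "integrable lborel (\<lambda>x. indicator K x *\<^sub>R F x)"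
    by (rule borel_integrable_compact[OF K continuous_on_subset[OF F(1)]]) simp
  have "(\<integral>\<^sup>+x. ennreal (F x) * indicator K x \<partial>lborel) = (\<integral>\<^sup>+x. ennreal (indicator K x *\<^sub>R F x) \<partial>lborel)"
    by (intro nn_integral_cong) (auto simp: indicator_def)
  also have "\<dots> = ennreal (LINT x|lborel. indicator K x *\<^sub>R F x)"
    by (rule nn_integral_eq_integral[OF i]) (use F in \<open>auto simp: indicator_def\<close>)
  also have "(LINT x|lborel. indicator K x *\<^sub>R F x) = (LINT x:K|lebesgue. F x)"
    unfolding set_lebesgue_integral_def using i by (intro integral_completion[symmetric]) auto
  finally show ?thesis .
qed

lemma covariogram_total:
  fixes K :: "'a::euclidean_space set"
  assumes K: "compact K" and m: "measure lebesgue K = 1"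
  shows "(\<integral>\<^sup>+x. ennreal (covariogram K x) \<partial>lborel) = 1"
proof -
  have one: "(\<integral>\<^sup>+x. indicator K x \<partial>lborel) = (1 :: ennreal)"
  proof -
    have "emeasure lborel K = ennreal (measure lborel K)"
      using emeasure_bounded_finite[OF compact_imp_bounded[OF K]] by (intro emeasure_eq_ennreal_measure) auto
    then show ?thesis using borel_compact[OF K] m by simp
  qed
  show ?thesis using covariogram_Fubini[OF K, of "\<lambda>_. 1"] by (simp add: one)
qed

text \<open>This is the variance of the difference of two independent uniform points of K. The cross
  term vanishes since the barycentre is 0, which leaves the factor 2.\<close>

lemma covariogram_second_moment:
  fixes K :: "'a::euclidean_space set"
  assumes K: "compact K" and m: "measure lebesgue K = 1" and bar: "(LINT x:K|lebesgue. x) = 0"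
    and mom: "(LINT x:K|lebesgue. (x \<bullet> \<theta>)\<^sup>2) = l"
  shows "(\<integral>\<^sup>+x. ennreal ((x \<bullet> \<theta>)\<^sup>2 * covariogram K x) \<partial>lborel) = ennreal (2 * l)"
proof -
  have int: "set_integrable lebesgue K f" if "continuous_on UNIV f" for f :: "'a \<Rightarrow> real"
    by (rule integrable_compact[OF K that])
  have const: "(LINT x:K|lebesgue. c) = c" for c :: real
    using lmeasurable_compact[OF K] m unfolding set_lebesgue_integral_def by (auto simp: fmeasurable_def)
  have lin: "(LINT x:K|lebesgue. x \<bullet> \<theta>) = 0"
  proof -
    have "integrable lebesgue (\<lambda>x. indicat_real K x *\<^sub>R x)"
      using integrable_compact[OF K continuous_on_id] by (simp add: set_integrable_def)
    from integral_inner_left[OF this, of \<theta>] show ?thesis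
      using bar unfolding set_lebesgue_integral_def by simp
  qed
  have inner: "(LINT z:K|lebesgue. ((y - z) \<bullet> \<theta>)\<^sup>2) = (y \<bullet> \<theta>)\<^sup>2 + l" for y
  proof -
    have "(LINT z:K|lebesgue. ((y - z) \<bullet> \<theta>)\<^sup>2) = (LINT z:K|lebesgue. ((y \<bullet> \<theta>)\<^sup>2 - 2 * (y \<bullet> \<theta>) * (z \<bullet> \<theta>)) + (z \<bullet> \<theta>)\<^sup>2)"
      by (intro arg_cong2[where f="set_lebesgue_integral lebesgue"] ext) (auto simp: inner_diff_left power2_eq_square algebra_simps)
    also have "\<dots> = (LINT z:K|lebesgue. (y \<bullet> \<theta>)\<^sup>2 - 2 * (y \<bullet> \<theta>) * (z \<bullet> \<theta>)) + (LINT z:K|lebesgue. (z \<bullet> \<theta>)\<^sup>2)"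
      by (intro set_integral_add int continuous_intros)
    also have "(LINT z:K|lebesgue. (y \<bullet> \<theta>)\<^sup>2 - 2 * (y \<bullet> \<theta>) * (z \<bullet> \<theta>)) = (LINT z:K|lebesgue. (y \<bullet> \<theta>)\<^sup>2) - (LINT z:K|lebesgue. 2 * (y \<bullet> \<theta>) * (z \<bullet> \<theta>))"
      by (intro set_integral_diff int continuous_intros)
    also have "(LINT z:K|lebesgue. 2 * (y \<bullet> \<theta>) * (z \<bullet> \<theta>)) = 2 * (y \<bullet> \<theta>) * (LINT z:K|lebesgue. z \<bullet> \<theta>)"
      by (rule set_integral_mult_right)
    finally show ?thesis by (simp add: lin const mom)
  qed
  have l0: "l \<ge> 0" unfolding mom[symmetric] set_lebesgue_integral_def by (rule integral_nonneg_AE) auto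
  have "(\<integral>\<^sup>+x. ennreal ((x \<bullet> \<theta>)\<^sup>2 * covariogram K x) \<partial>lborel) = (\<integral>\<^sup>+x. ennreal ((x \<bullet> \<theta>)\<^sup>2) * ennreal (covariogram K x) \<partial>lborel)"
    by (intro nn_integral_cong ennreal_mult) (auto simp: covariogram_nonneg)
  also have "\<dots> = (\<integral>\<^sup>+y. (\<integral>\<^sup>+z. ennreal (((y - z) \<bullet> \<theta>)\<^sup>2) * indicator K z \<partial>lborel) * indicator K y \<partial>lborel)"
    by (rule covariogram_Fubini[OF K]) simp
  also have "\<dots> = (\<integral>\<^sup>+y. ennreal ((y \<bullet> \<theta>)\<^sup>2 + l) * indicator K y \<partial>lborel)"
  proof (rule nn_integral_cong)
    fix y :: 'a
    have "(\<integral>\<^sup>+z. ennreal (((y - z) \<bullet> \<theta>)\<^sup>2) * indicator K z \<partial>lborel) = ennreal ((y \<bullet> \<theta>)\<^sup>2 + l)"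
      unfolding inner[symmetric] by (rule nn_integral_compact[OF K]) (auto intro!: continuous_intros)
    then show "(\<integral>\<^sup>+z. ennreal (((y - z) \<bullet> \<theta>)\<^sup>2) * indicator K z \<partial>lborel) * indicator K y = ennreal ((y \<bullet> \<theta>)\<^sup>2 + l) * indicator K y"
      by simp
  qed
  also have "\<dots> = ennreal (LINT y:K|lebesgue. (y \<bullet> \<theta>)\<^sup>2 + l)"
    by (rule nn_integral_compact[OF K]) (use l0 in \<open>auto intro!: continuous_intros\<close>)
  also have "(LINT y:K|lebesgue. (y \<bullet> \<theta>)\<^sup>2 + l) = (LINT y:K|lebesgue. (y \<bullet> \<theta>)\<^sup>2) + (LINT y:K|lebesgue. l)"
    by (intro set_integral_add int continuous_intros)
  finally show ?thesis by (simp add: mom const)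
qed

lemma covariogram_uminus:
  fixes K :: "'a::euclidean_space set"
  assumes K: "compact K" shows "covariogram K (- x) = covariogram K x"
proof -
  have "(\<lambda>z. x + 1 *\<^sub>R z) ` (K \<inter> (+) (- x) ` K) = K \<inter> (+) x ` K"
  proof (intro equalityI subsetI)
    fix z assume "z \<in> K \<inter> (+) x ` K"
    then have "z - x \<in> K \<inter> (+) (- x) ` K" by (simp add: mem_translate_iff)
    then show "z \<in> (\<lambda>z. x + 1 *\<^sub>R z) ` (K \<inter> (+) (- x) ` K)" by (intro image_eqI[of _ _ "z - x"]) auto
  qed (auto simp: mem_translate_iff add.commute)
  then show ?thesis unfolding covariogram_def
    using homothety_measure[OF compact_translate_Int[OF K, of "- x"], of 1 x] by simp
qed

section \<open>Equality on all rays forces homothetic intersections\<close>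

lemma covariogram_superset:
  fixes K :: "'a::euclidean_space set"
  assumes K: "convex K" and q: "q \<in> K \<inter> (+) x ` K" and l: "0 \<le> l" "l \<le> 1"
  shows "(\<lambda>z. l *\<^sub>R q + (1 - l) *\<^sub>R z) ` K \<subseteq> K \<inter> (+) (l *\<^sub>R x) ` K"
proof
  fix y assume "y \<in> (\<lambda>z. l *\<^sub>R q + (1 - l) *\<^sub>R z) ` K"
  then obtain z where z: "z \<in> K" "y = l *\<^sub>R q + (1 - l) *\<^sub>R z" by blast
  have qK: "q \<in> K" "q - x \<in> K" using q by (auto simp: mem_translate_iff)
  have "y \<in> K" unfolding z by (rule convexD[OF K qK(1) z(1)]) (use l in auto)
  moreover have "l *\<^sub>R (q - x) + (1 - l) *\<^sub>R z \<in> K" by (rule convexD[OF K qK(2) z(1)]) (use l in auto)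
  moreover have "y - l *\<^sub>R x = l *\<^sub>R (q - x) + (1 - l) *\<^sub>R z" unfolding z by (simp add: algebra_simps)
  ultimately show "y \<in> K \<inter> (+) (l *\<^sub>R x) ` K" by (simp add: mem_translate_iff)
qed

text \<open>The interior of B minus A is open and null, hence empty, and a convex body is the
  closure of its interior.\<close>

lemma convex_body_eq_of_measure:
  fixes A B :: "'a::euclidean_space set"
  assumes A: "compact A" and B: "convex_body B" and sub: "A \<subseteq> B" and le: "measure lebesgue B \<le> measure lebesgue A"
  shows "A = B"
proof -
  have B': "compact B" "convex B" "interior B \<noteq> {}" using B by (auto simp: convex_body_def)
  have m: "A \<in> lmeasurable" "B \<in> lmeasurable" using A B' by (auto simp: lmeasurable_compact)
  have "measure lebesgue (B - A) = measure lebesgue B - measure lebesgue A"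
    by (rule measurable_measure_Diff[OF m(2) fmeasurableD[OF m(1)] sub])
  then have "measure lebesgue (B - A) = 0" using le measure_nonneg[of lebesgue "B - A"] by linarith
  then have neg: "negligible (B - A)" using m by (simp add: negligible_iff_measure fmeasurable.Diff)
  have o: "open (interior B - A)" using A by (intro open_Diff compact_imp_closed) auto
  have "negligible (interior B - A)" by (rule negligible_subset[OF neg]) (use interior_subset in blast)
  then have "interior B - A = {}" using open_not_negligible[OF o] by blast
  then have "closure (interior B) \<subseteq> A" using A by (intro closure_minimal compact_imp_closed) auto
  moreover have "closure (interior B) = B" using convex_closure_interior[OF B'(2,3)] B'(1) by (simp add: compact_imp_closed)
  ultimately show ?thesis using sub by blast
qed

text \<open>The point q must be taken from the intersection with the farthest translate, by a x.
  With weight 1/a the contained homothet then has volume (1 - 1/a)^n, which is the value of the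
  covariogram at x.\<close>

lemma homothetic_intersections_of_affine_rays:
  fixes K :: "'a::euclidean_space set"
  assumes K: "convex_body K" and m: "measure lebesgue K = 1"
    and rays: "\<And>y. y \<noteq> 0 \<Longrightarrow> \<exists>a>0. \<forall>t\<ge>0. covariogram K (t *\<^sub>R y) = max 0 (1 - t / a) ^ DIM('a)"
  shows "homothetic_intersections K"
proof
  have K': "compact K" "convex K" using K by (auto simp: convex_body_def)
  then show "compact K" "convex K" .
  fix x assume ne: "K \<inter> (+) x ` K \<noteq> {}"
  show "\<exists>\<sigma> p. 0 \<le> \<sigma> \<and> \<sigma> \<le> 1 \<and> K \<inter> (+) x ` K = (\<lambda>z. p + \<sigma> *\<^sub>R z) ` K"
  proof (cases "x = 0")
    case True
    then show ?thesis by (intro exI[of _ 1] exI[of _ 0]) simp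
  next
    case False
    obtain a where a: "a > 0" "\<And>t. t \<ge> 0 \<Longrightarrow> covariogram K (t *\<^sub>R x) = max 0 (1 - t / a) ^ DIM('a)" using rays[OF False] by blast
    have lower: "(1 - l) ^ DIM('a) \<le> covariogram K (l *\<^sub>R y)" if q: "q \<in> K \<inter> (+) y ` K" and l: "0 \<le> l" "l < 1" for q l y
    proof -
      have "measure lebesgue ((\<lambda>z. l *\<^sub>R q + (1 - l) *\<^sub>R z) ` K) \<le> covariogram K (l *\<^sub>R y)"
        unfolding covariogram_def
        by (intro measure_mono_fmeasurable covariogram_superset K' q fmeasurableD lmeasurable_compact compact_translate_Int)
          (use l K' in \<open>auto intro!: compact_continuous_image continuous_intros\<close>)
      then show ?thesis using homothety_measure[OF K'(1), of "1 - l" "l *\<^sub>R q"] l m by simp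
    qed
    have exact: "K \<inter> (+) (l *\<^sub>R y) ` K = (\<lambda>z. l *\<^sub>R q + (1 - l) *\<^sub>R z) ` K"
      if q: "q \<in> K \<inter> (+) y ` K" and l: "0 \<le> l" "l < 1" and eq: "covariogram K (l *\<^sub>R y) = (1 - l) ^ DIM('a)" for q l y
    proof (rule convex_body_eq_of_measure[symmetric])
      have "covariogram K (l *\<^sub>R y) > 0" unfolding eq using l by simp
      then show "convex_body (K \<inter> (+) (l *\<^sub>R y) ` K)" by (rule convex_body_translate_Int[OF K'])
      show "compact ((\<lambda>z. l *\<^sub>R q + (1 - l) *\<^sub>R z) ` K)" by (intro compact_continuous_image continuous_intros K')
      show "(\<lambda>z. l *\<^sub>R q + (1 - l) *\<^sub>R z) ` K \<subseteq> K \<inter> (+) (l *\<^sub>R y) ` K"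
        by (rule covariogram_superset[OF K'(2) q]) (use l in auto)
      show "measure lebesgue (K \<inter> (+) (l *\<^sub>R y) ` K) \<le> measure lebesgue ((\<lambda>z. l *\<^sub>R q + (1 - l) *\<^sub>R z) ` K)"
        using homothety_measure[OF K'(1), of "1 - l" "l *\<^sub>R q"] l m eq by (simp add: covariogram_def)
    qed
    obtain q0 where q0: "q0 \<in> K \<inter> (+) x ` K" using ne by blast
    \<comment> \<open>Otherwise the inclusion with weight a would give positive volume at a x, where
      the covariogram vanishes.\<close>
    have a1: "a \<ge> 1"
    proof (rule ccontr)
      assume "\<not> a \<ge> 1"
      then have "0 < (1 - a) ^ DIM('a)" by simp
      also have "\<dots> \<le> covariogram K (a *\<^sub>R x)" using \<open>\<not> a \<ge> 1\<close> a(1) by (intro lower[OF q0]) auto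
      also have "\<dots> = 0" using a(2)[of a] a(1) by simp
      finally show False by simp
    qed
    show ?thesis
    proof (cases "a = 1")
      \<comment> \<open>Here the intersection is null and must be shown to be one point. Two of its
        points would describe the intersection with the half-way translate as homothets that differ
        by a translation, and cancelling K makes the points equal.\<close>
      case True
      have "q = q0" if q: "q \<in> K \<inter> (+) x ` K" for q
      proof -
        have c: "covariogram K ((1/2) *\<^sub>R x) = (1 - 1/2) ^ DIM('a)" using a(2)[of "1/2"] True by simp
        have img: "(\<lambda>z. (1/2) *\<^sub>R q + (1 - 1/2) *\<^sub>R z) ` K = (\<lambda>z. (1/2) *\<^sub>R q0 + (1 - 1/2) *\<^sub>R z) ` K"
          using exact[OF q _ _ c] exact[OF q0 _ _ c] by simp
        have "cone_over K (1 - 1) (q - q0)"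
        proof (rule scaled_subset_cancel[OF K'])
          fix k assume "k \<in> K"
          then obtain k' where "k' \<in> K" "(1/2) *\<^sub>R q + (1 - 1/2) *\<^sub>R k = (1/2) *\<^sub>R q0 + (1 - 1/2) *\<^sub>R k'" using img by blast
          then have "2 *\<^sub>R ((1/2) *\<^sub>R q + (1/2) *\<^sub>R k) = 2 *\<^sub>R ((1/2) *\<^sub>R q0 + (1/2) *\<^sub>R k')" by simp
          then have "q + k = q0 + k'" by (simp add: scaleR_add_right)
          then show "\<exists>k'\<in>K. q - q0 + 1 *\<^sub>R k = 1 *\<^sub>R k'" using \<open>k' \<in> K\<close> by (intro bexI[of _ k']) (auto simp: algebra_simps)
        qed (use q in auto)
        then show ?thesis by (auto simp: cone_over_def)
      qed
      then have "K \<inter> (+) x ` K = {q0}" using q0 by blast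
      moreover have "(\<lambda>z. q0 + 0 *\<^sub>R z) ` K = {q0}" using q0 by auto
      ultimately show ?thesis by (intro exI[of _ 0] exI[of _ q0]) auto
    next
      case a_ne: False
      then have a2: "a > 1" using a1 by simp
      \<comment> \<open>For t < a the vector t x is a difference of two points of K; closedness of
        the difference set extends this to t = a.\<close>
      have "closed {y - z |y z. y \<in> K \<and> z \<in> K}" by (intro compact_imp_closed compact_differences K')
      then have cl: "closed ((\<lambda>t. t *\<^sub>R x) -` {y - z |y z. y \<in> K \<and> z \<in> K})"
        by (intro continuous_closed_vimage) auto
      have "{0..<a} \<subseteq> (\<lambda>t. t *\<^sub>R x) -` {y - z |y z. y \<in> K \<and> z \<in> K}"
      proof
        fix t assume t: "t \<in> {0..<a}"
        then have "covariogram K (t *\<^sub>R x) > 0" using a by simp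
        then have "K \<inter> (+) (t *\<^sub>R x) ` K \<noteq> {}" unfolding covariogram_def by auto
        then obtain y where "y \<in> K" "y - t *\<^sub>R x \<in> K" using mem_translate_iff by blast
        then have "\<exists>y z. t *\<^sub>R x = y - z \<and> y \<in> K \<and> z \<in> K" by (intro exI[of _ y] exI[of _ "y - t *\<^sub>R x"]) simp
        then show "t \<in> (\<lambda>t. t *\<^sub>R x) -` {y - z |y z. y \<in> K \<and> z \<in> K}" by simp
      qed
      then have "closure {0..<a} \<subseteq> (\<lambda>t. t *\<^sub>R x) -` {y - z |y z. y \<in> K \<and> z \<in> K}" using cl by (rule closure_minimal)
      moreover have "a \<in> closure {0..<a}" using a(1) by simp
      ultimately have "a \<in> (\<lambda>t. t *\<^sub>R x) -` {y - z |y z. y \<in> K \<and> z \<in> K}" by (rule subsetD)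
      then have "a *\<^sub>R x \<in> {y - z |y z. y \<in> K \<and> z \<in> K}" by (simp only: vimage_eq)
      then obtain y z where yz: "a *\<^sub>R x = y - z" "y \<in> K" "z \<in> K" by blast
      have q: "y \<in> K \<inter> (+) (a *\<^sub>R x) ` K" using yz by (simp add: mem_translate_iff)
      have ax: "(1 / a) *\<^sub>R (a *\<^sub>R x) = x" using a(1) by simp
      have "K \<inter> (+) ((1 / a) *\<^sub>R (a *\<^sub>R x)) ` K = (\<lambda>z. (1 / a) *\<^sub>R y + (1 - 1 / a) *\<^sub>R z) ` K"
      proof (rule exact[OF q])
        show "covariogram K ((1 / a) *\<^sub>R (a *\<^sub>R x)) = (1 - 1 / a) ^ DIM('a)"
          unfolding ax using a(2)[of 1] a2 by (simp add: max_def)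
      qed (use a2 in auto)
      then show ?thesis unfolding ax using a2 by (intro exI[of _ "1 - 1 / a"] exI[of _ "(1 / a) *\<^sub>R y"]) auto
    qed
  qed
qed


section \<open>Comparison of the isotropic constants\<close>

lemma covariogram_concave_profile:
  fixes K :: "'a::euclidean_space set"
  assumes K: "convex_body K" and m: "measure lebesgue K = 1"
  shows "\<exists>R. concave_profile_dim (\<lambda>x. root DIM('a) (covariogram K x)) R"
proof -
  have K': "compact K" "convex K" using K by (auto simp: convex_body_def)
  obtain R where R: "R > 0" "\<And>x. norm x \<ge> R \<Longrightarrow> covariogram K x = 0" using covariogram_support[OF K'(1)] by blast
  have "concave_profile_dim (\<lambda>x. root DIM('a) (covariogram K x)) R"
  proof
    show "continuous_on UNIV (\<lambda>x. root DIM('a) (covariogram K x))"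
      by (intro continuous_intros covariogram_continuous K')
    fix x y :: 'a and l :: real
    assume "root DIM('a) (covariogram K x) > 0" "root DIM('a) (covariogram K y) > 0" and l: "0 \<le> l" "l \<le> 1"
    then have "covariogram K x > 0" "covariogram K y > 0" by simp_all
    from covariogram_root_concave[OF K' this l]
    show "l * root DIM('a) (covariogram K x) + (1 - l) * root DIM('a) (covariogram K y) \<le> root DIM('a) (covariogram K (l *\<^sub>R x + (1 - l) *\<^sub>R y))" .
  qed (use R m in \<open>auto simp: covariogram_nonneg covariogram_0\<close>)
  then show ?thesis by blast
qed

lemma set_integral_symmetric_zero:
  fixes M :: "'a::euclidean_space set"
  assumes M: "compact M" and sym: "uminus ` M = M"
  shows "(LINT x:M|lebesgue. x) = 0"
proof -
  have T: "linear (uminus :: 'a \<Rightarrow> 'a)" "bij (uminus :: 'a \<Rightarrow> 'a)"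
    by (auto simp: linear_iff intro!: o_bij[where g=uminus])
  have "(LINT x:((\<lambda>x. 0 + - x) ` M)|lebesgue. x) = 1 *\<^sub>R (LINT x:M|lebesgue. 0 + - x)"
    by (rule affine_set_integral[OF lin_scale_uminus T _ M]) simp
  then have "(LINT x:M|lebesgue. x) = - (LINT x:M|lebesgue. x)"
    using sym by (simp add: set_lebesgue_integral_def)
  then have "2 *\<^sub>R (LINT x:M|lebesgue. x) = 0" by (simp add: scaleR_2 eq_neg_iff_add_eq_0)
  then show ?thesis by simp
qed

text \<open>With p = 1/2 + 1/n the power p of \<open>k\<close> is E^(1/2), so D equals L (C / (k
  V))^p, and the comparison of L with D is that of k V with C.\<close>

lemma powr_ratio_compare:
  fixes C E V k L :: real and n :: nat
  assumes n: "n > 0" and pos: "C > 0" "E > 0" "V > 0" "L > 0" and k: "k = root (n + 2) E ^ n"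
    and le: "k * V \<le> C"
  defines "D \<equiv> 1 / sqrt 2 * (C powr (1/2 + 1 / real n) / E powr (1/2)) * (sqrt (2 * L\<^sup>2) / V powr (1/2 + 1 / real n))"
  shows "L \<le> D" "L = D \<longleftrightarrow> k * V = C"
proof -
  define p where "p = 1/2 + 1 / real n"
  have p: "p > 0" using n by (simp add: p_def add_pos_pos)
  have k0: "k > 0" unfolding k using pos by (simp add: real_root_gt_zero)
  have kp: "k powr p = E powr (1/2)"
  proof -
    have "root (n + 2) E = E powr (1 / real (n + 2))" by (rule root_powr_inverse) (use pos in auto)
    then have "k = (E powr (1 / real (n + 2))) powr real n" unfolding k using pos by (simp add: powr_realpow)
    then have "k powr p = E powr (1 / real (n + 2) * real n * p)" by (simp add: powr_powr)
    also have "1 / real (n + 2) * real n * p = 1/2"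
    proof -
      have "p = real (n + 2) / (2 * real n)" using n unfolding p_def by (simp add: field_simps)
      moreover have "1 / c * d * (c / (2 * d)) = 1/2" if "c > 0" "d > 0" for c d :: real using that by simp
      ultimately show ?thesis using n by simp
    qed
    finally show ?thesis .
  qed
  define q where "q = C / (k * V)"
  have kV: "k * V > 0" using k0 pos by simp
  have q1: "q \<ge> 1" using le kV by (simp add: q_def)
  have "D = L * (C powr p / (k powr p * V powr p))"
    unfolding D_def p_def[symmetric] kp using pos by (simp add: real_sqrt_mult)
  also have "k powr p * V powr p = (k * V) powr p" using k0 pos by (simp add: powr_mult)
  also have "C powr p / (k * V) powr p = q powr p" unfolding q_def using kV pos by (simp add: powr_divide)
  finally have D: "D = L * q powr p" .
  have "1 \<le> q powr p" using q1 p by (simp add: ge_one_powr_ge_zero)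
  then show "L \<le> D" unfolding D using pos by simp
  have "L = D \<longleftrightarrow> q powr p = 1" unfolding D using pos by auto
  also have "\<dots> \<longleftrightarrow> q = 1"
  proof
    assume e: "q powr p = 1"
    show "q = 1"
    proof (rule ccontr)
      assume "q \<noteq> 1"
      then have "1 powr p < q powr p" using q1 p by (intro powr_less_mono2) auto
      then show False using e by simp
    qed
  qed simp
  also have "\<dots> \<longleftrightarrow> k * V = C" using kV by (auto simp: q_def)
  finally show "L = D \<longleftrightarrow> k * V = C" .
qed

theorem isotropic_const_ball_body:
  fixes K :: "'a::euclidean_space set"
  assumes iso: "isotropic K"
  shows "isotropic_const K \<le> D_const DIM('a) * isotropic_const (ball_body (real DIM('a) + 2) (covariogram K))"
    and "isotropic_const K = D_const DIM('a) * isotropic_const (ball_body (real DIM('a) + 2) (covariogram K))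
      \<longleftrightarrow> regular_simplex K"
proof -
  let ?n = "DIM('a)"
  obtain L where L: "isotropic_with K L" using iso by (auto simp: isotropic_def)
  have K: "convex_body K" "compact K" "convex K" and m: "measure lebesgue K = 1" and bar: "(LINT x:K|lebesgue. x) = 0"
    and L0: "L > 0" and mom: "\<And>\<theta>. norm \<theta> = 1 \<Longrightarrow> (LINT x:K|lebesgue. (x \<bullet> \<theta>)\<^sup>2) = L\<^sup>2"
    using L by (auto simp: isotropic_with_def convex_body_def barycenter_def)
  have intK: "interior K \<noteq> {}" using K(1) by (simp add: convex_body_def)
  define h where "h x = root ?n (covariogram K x)" for x
  obtain R where prof: "concave_profile_dim h R"
    using covariogram_concave_profile[OF K(1) m] unfolding h_def by blast
  interpret concave_profile_dim h R by (rule prof)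
  have hn: "h x ^ ?n = covariogram K x" for x unfolding h_def by (rule real_root_pow_pos2) (auto simp: covariogram_nonneg)
  define M where "M = {x. ball_gauge x \<le> 1}"
  have MB: "ball_body (real ?n + 2) (covariogram K) = M"
    using ball_body_eq_ball_gauge unfolding hn M_def .
  have cM: "convex_body M" unfolding M_def by (rule convex_body_ball_gauge)
  then have M: "compact M" by (simp add: convex_body_def)
  \<comment> \<open>The covariogram is even, so M is symmetric and its barycentre is 0, as the
    evaluation of its isotropic constant requires.\<close>
  have sym: "uminus ` M = M"
  proof -
    have "h (- x) = h x" for x by (simp add: h_def covariogram_uminus[OF K(2)])
    then have "ball_gauge (- x) = ball_gauge x" for x by (simp add: ball_gauge_def mom_def)
    then show ?thesis unfolding M_def by (auto intro: image_eqI[where x="- x" for x])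
  qed
  have barM: "(LINT x:M|lebesgue. x) = 0" by (rule set_integral_symmetric_zero[OF M sym])
  have momM: "(LINT x:M|lebesgue. (x \<bullet> \<theta>)\<^sup>2) = 2 * L\<^sup>2" if \<theta>: "norm \<theta> = 1" for \<theta>
  proof -
    have "ennreal (LINT x:M|lebesgue. (x \<bullet> \<theta>)\<^sup>2) = (\<integral>\<^sup>+x. ennreal ((x \<bullet> \<theta>)\<^sup>2) * indicator M x \<partial>lborel)"
      by (rule nn_integral_compact[OF M, symmetric]) (auto intro!: continuous_intros)
    also have "\<dots> = ennreal (2 * L\<^sup>2)"
      unfolding M_def second_moment_gauge_body hn by (rule covariogram_second_moment[OF K(2) m bar mom[OF \<theta>]])
    finally show ?thesis
      by (subst (asm) ennreal_inj) (auto simp: set_lebesgue_integral_def intro!: integral_nonneg_AE)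
  qed
  have LM: "isotropic_const M = sqrt (2 * L\<^sup>2) / measure lebesgue M powr (1/2 + 1 / ?n)"
    by (rule isotropic_const_eq[OF cM barM momM]) (use L0 in auto)
  have LK: "isotropic_const K = L" by (rule isotropic_const_isotropic_with[OF L])
  have total: "(\<integral>\<^sup>+x. ennreal (h x ^ ?n) \<partial>lborel) = 1" unfolding hn by (rule covariogram_total[OF K(2) m])
  let ?C = "real ((2 * ?n) choose ?n)" and ?E = "real ((2 * ?n + 2) choose ?n)"
  note vol = gauge_body_volume_le[OF total, folded M_def]
  have pos: "?C > 0" "?E > 0" "measure lebesgue M > 0" using convex_body_measure_pos[OF cM] by auto
  note cmp = powr_ratio_compare[OF DIM_positive pos L0 refl vol(1)]
  have D: "D_const ?n * isotropic_const M = 1 / sqrt 2 * (?C powr (1/2 + 1 / real ?n) / ?E powr (1/2)) * (sqrt (2 * L\<^sup>2) / measure lebesgue M powr (1/2 + 1 / real ?n))"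
    unfolding D_const_def LM ..
  show "isotropic_const K \<le> D_const ?n * isotropic_const (ball_body (real ?n + 2) (covariogram K))"
    unfolding MB LK D by (rule cmp(1))
  have "isotropic_const K = D_const ?n * isotropic_const (ball_body (real ?n + 2) (covariogram K)) \<longleftrightarrow> affine_rays"
    unfolding MB LK D cmp(2) vol(2) ..
  also have "affine_rays \<longleftrightarrow> regular_simplex K"
  proof
    assume rays: affine_rays
    interpret homothetic_intersections K
    proof (rule homothetic_intersections_of_affine_rays[OF K(1) m])
      fix y :: 'a assume "y \<noteq> 0"
      then show "\<exists>a>0. \<forall>t\<ge>0. covariogram K (t *\<^sub>R y) = max 0 (1 - t / a) ^ ?n"
        using rays unfolding affine_rays_def hn[symmetric] by fastforce
    qed
    from is_simplex[OF intK] obtain V where V: "\<not> affine_dependent V" "card V = ?n + 1" "K = convex hull V"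
      by (elim exE conjE)
    show "regular_simplex K" unfolding V(3)
      by (rule isotropic_simplex_imp_regular[OF _ V(1,2)]) (use iso V(3) in simp)
  next
    assume "regular_simplex K"
    then obtain V where V: "\<not> affine_dependent V" "card V = ?n + 1" "K = convex hull V"
      unfolding regular_simplex_def by blast
    show affine_rays unfolding affine_rays_def
    proof (intro allI impI)
      fix y :: 'a assume y: "y \<noteq> 0"
      obtain s where s: "s \<ge> 0" "\<And>t. t \<ge> 0 \<Longrightarrow> covariogram K (t *\<^sub>R y) = max 0 (1 - t * s) ^ ?n * measure lebesgue K"
        using simplex_covariogram_ray[OF V(1,2), of y] unfolding V(3) by metis
      have hs: "h (t *\<^sub>R y) = max 0 (1 - t * s)" if "t \<ge> 0" for t
        unfolding h_def s(2)[OF that] m by (simp add: real_root_power_cancel)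
      have "s \<noteq> 0"
      proof
        assume "s = 0"
        then have "h ((R / norm y) *\<^sub>R y) = 1" using hs[of "R / norm y"] R by simp
        then show False using ray_zero[OF y, of "R / norm y"] by simp
      qed
      then show "\<exists>a>0. \<forall>t\<ge>0. h (t *\<^sub>R y) = max 0 (1 - t / a)"
        using hs s(1) by (intro exI[of _ "1 / s"]) auto
    qed
  qed
  finally show "isotropic_const K = D_const ?n * isotropic_const (ball_body (real ?n + 2) (covariogram K)) \<longleftrightarrow> regular_simplex K" .
qed

theorem theorem1p1:
  "(\<forall>K :: (real ^ 'n) set. isotropic K \<longrightarrow>
      isotropic_const K
        \<le> D_const CARD('n) * isotropic_const (ball_body (real CARD('n) + 2) (covariogram K)) \<and>
      (isotropic_const K
        = D_const CARD('n) * isotropic_const (ball_body (real CARD('n) + 2) (covariogram K))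
       \<longleftrightarrow> regular_simplex K)) \<and>
   bdd_above (D_const ` {1..}) \<and> (SUP n\<in>{1..}. D_const n) = sqrt 2"
proof (intro conjI allI impI)
  fix K :: "(real ^ 'n) set" assume K: "isotropic K"
  have d: "DIM(real ^ 'n) = CARD('n)" by simp
  show "isotropic_const K \<le> D_const CARD('n) * isotropic_const (ball_body (real CARD('n) + 2) (covariogram K))"
    using isotropic_const_ball_body(1)[OF K] unfolding d .
  show "isotropic_const K = D_const CARD('n) * isotropic_const (ball_body (real CARD('n) + 2) (covariogram K))
      \<longleftrightarrow> regular_simplex K"
    using isotropic_const_ball_body(2)[OF K] unfolding d .
qed (rule D_const_bdd_above D_const_SUP)+

end
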